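(* Let $N\ge 1$, let $b_1,\dots,b_N>0$, and consider the $N$-particle multi-species TASEP on $\mathbb{Z}$ with species-dependent rates $b_l$. Let $c$ be a positively oriented circle centered at the origin of $\mathbb{C}$ with radius less than $1/b_l$ for all $l\in\{1,\dots,N\}$. Then for all $X=(x_1,\dots,x_N)\in\mathbb{Z}^N$ with $x_1<\cdots<x_N$, all $Y=(y_1,\dots,y_N)\in\mathbb{Z}^N$ with $y_1<\cdots<y_N$ and all $t\ge 0$, the $N^N\times N^N$ matrix $\mathbf{P}_Y(X;t)$ of transition probabilities, whose $(\pi,\nu)$-element is $P_{(Y,\nu)}(X,\pi;t)$, is $$\mathbf{P}_Y(X;t)=\sum_{\sigma\in\mathcal{S}_N}\Big(\frac{1}{2\pi i}\Big)^N\oint_c\cdots\oint_c \mathbf{J}(t)\,\mathbf{D}(x_1,\dots,x_N)\,\mathbf{A}_\sigma\,\mathbf{D}'(y_1,\dots,y_N)\prod_{i=1}^N \xi_{\sigma(i)}^{\,x_i-y_{\sigma(i)}-1}\; d\xi_1\cdots d\xi_N ,$$ where integrals of matrices are taken element-wise.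
   Context: **The process.** There are $N$ particles on $\mathbb{Z}$, at most one per site, each belonging to a species in $\{1,\dots,N\}$ (several particles may share a species). A particle of species $l$ attempts to jump one step to the right after an exponentially distributed waiting time with rate $b_l$ (independently of the others). If the target site is empty, the particle moves there. If it is occupied by a particle of species $l'\ge l$, the jump is prohibited. If it is occupied by a particle of species $l'<l$, the two particles interchange positions. A state is $(X,\pi)$ with $X=(x_1,\dots,x_N)\in\mathbb{Z}^N$, $x_1<\cdots<x_N$, the particle positions, and $\pi=\pi(1)\cdots\pi(N)\in\{1,\dots,N\}^N$, where $\pi(i)$ is the species of the $i$-th leftmost particle. $P_{(Y,\nu)}(X,\pi;t)$ is the probability of being in state $(X,\pi)$ at time $t$ starting from $(Y,\nu)$ at time $0$. **Matrix conventions.** Rows and columns of an $N^n\times N^n$ matrix are labelled by the words in $\{1,\dots,N\}^n$ in lexicographic order $1\cdots1,\dots,N\cdots N$; $\mathbf{I}_N$ is the $N\times N$ identity matrix, and $\otimes$ is the Kronecker product compatible with this labelling. **The matrices $\mathbf{R}_{\beta\alpha}$.** For complex variables $\xi_1,\dots,\xi_N$ and $\alpha,\beta\in\{1,\dots,N\}$ put $$S_{\beta\alpha}(i)=-\frac{1-b_i\xi_\beta}{1-b_i\xi_\alpha},\qquad T_{\beta\alpha}(i)=\frac{b_i(\xi_\beta-\xi_\alpha)}{1-b_i\xi_\alpha}.$$ $\mathbf{R}_{\beta\alpha}=[R_{ij,kl}]$ is the $N^2\times N^2$ matrix (row label $ij$, column label $kl$) with $R_{ij,kl}=S_{\beta\alpha}(i)$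 if $ij=kl$ and $i\le j$; $R_{ij,kl}=-1$ if $ij=kl$ and $i>j$; $R_{ij,kl}=T_{\beta\alpha}(i)$ if $ij=lk$ and $i<j$; and $R_{ij,kl}=0$ otherwise. **The matrices $\mathbf{A}_\sigma$.** Write $\sigma\in\mathcal{S}_N$ as the word $\sigma(1)\cdots\sigma(N)$. The simple transposition $\mathcal{T}_l$ ($1\le l\le N-1$) interchanges the numbers at the $l$-th and $(l+1)$-st slots of a word; when it maps $(\cdots\alpha\beta\cdots)$ to $(\cdots\beta\alpha\cdots)$, with $\alpha,\beta$ originally in slots $l,l+1$, it is written $\mathcal{T}_l(\beta,\alpha)$. Define the $N^N\times N^N$ matrix $$\mathbf{T}_l(\beta,\alpha)=\mathbf{I}_N^{\otimes(l-1)}\otimes\mathbf{R}_{\beta\alpha}\otimes\mathbf{I}_N^{\otimes(N-l-1)}.$$ If $\sigma=\mathcal{T}_{i_j}(\beta_j,\alpha_j)\cdots\mathcal{T}_{i_1}(\beta_1,\alpha_1)$ is obtained from the identity word $12\cdots N$ by applying successively $\mathcal{T}_{i_1},\dots,\mathcal{T}_{i_j}$, then $$\mathbf{A}_\sigma=\mathbf{T}_{i_j}(\beta_j,\alpha_j)\cdots\mathbf{T}_{i_1}(\beta_1,\alpha_1),$$ with $\mathbf{A}_{\mathrm{id}}$ the identity matrix; this is independent of the chosen expression of $\sigma$ as a product of simple transpositions. **The diagonal matrices.** $\mathbf{J}(t)$, $\mathbf{D}(x_1,\dots,x_N)$, $\mathbf{D}'(y_1,\dots,y_N)$ are the $N^N\times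 N^N$ diagonal matrices whose diagonal elements at $\pi$ (respectively $\pi$, $\nu$) are $e^{\varepsilon_{\pi\pi}t}$, $b_{\pi(1)}^{x_1}\cdots b_{\pi(N)}^{x_N}$ and $b_{\nu(1)}^{-y_1}\cdots b_{\nu(N)}^{-y_N}$, where $$\varepsilon_{\pi\pi}=\frac1{\xi_1}+\cdots+\frac1{\xi_N}-\big(b_{\pi(1)}+\cdots+b_{\pi(N)}\big).$$ *)

theory Defs
  imports
    "HOL-Probability.Probability"
    "HOL-Complex_Analysis.Complex_Analysis"
    "HOL-Combinatorics.Permutations"
    "Jordan_Normal_Form.Matrix"
begin

hide_const (open) Finite_Cartesian_Product.mat

text \<open>
  Sites, positions, species and slots are numbered from 1, as usual in the literature: words
  \<open>\<pi>\<close>, position vectors \<open>X\<close> and variables \<open>\<xi>\<close> are functions on \<open>nat\<close> of which only the values on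
  \<open>{1..N}\<close> matter. Rows and columns of a matrix are numbered from 0, as in
  \<^theory>\<open>Jordan_Normal_Form.Matrix\<close>.
\<close>

section \<open>The process\<close>

text \<open>
  The particles are named by their rank \<open>p \<in> {1..N}\<close> in the initial state; \<open>\<nu> p\<close> is the (unchanging)
  species of particle \<open>p\<close> and \<open>z p\<close> its current position. \<open>attempt N \<nu> p z\<close> is the configuration
  after particle \<open>p\<close> has attempted to jump in configuration \<open>z\<close>.
\<close>

definition attempt :: "nat \<Rightarrow> (nat \<Rightarrow> nat) \<Rightarrow> nat \<Rightarrow> (nat \<Rightarrow> int) \<Rightarrow> (nat \<Rightarrow> int)" where
  "attempt N \<nu> p z =
     (if \<exists>q\<in>{1..N}. z q = z p + 1
      then let q = (THE q. q \<in> {1..N} \<and> z q = z p + 1)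
           in if \<nu> q < \<nu> p then z(p := z q, q := z p) else z
      else z(p := z p + 1))"

text \<open>
  \<open>w (p, n)\<close> is the waiting time of particle \<open>p\<close> between its \<open>n\<close>-th and \<open>(n+1)\<close>-st attempt (its first
  attempt if \<open>n = 0\<close>). A prohibited attempt uses up its waiting time as well.
\<close>

definition attempt_time :: "(nat \<times> nat \<Rightarrow> real) \<Rightarrow> nat \<times> nat \<Rightarrow> real" where
  "attempt_time w = (\<lambda>(p, n). \<Sum>k\<le>n. w (p, k))"

text \<open>
  All attempts up to time \<open>t\<close> are carried out in chronological order. Almost surely there are finitely
  many of them and no two are simultaneous; only then is \<^const>\<open>sorted_key_list_of_set\<close> meaningful.
\<close>

definition config_at ::
  "nat \<Rightarrow> (nat \<Rightarrow> nat) \<Rightarrow> (nat \<Rightarrow> int) \<Rightarrow> (nat \<times> nat \<Rightarrow> real) \<Rightarrow> real \<Rightarrow> (nat \<Rightarrow> int)" where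
  "config_at N \<nu> Y w t =
     fold (\<lambda>(p, n). attempt N \<nu> p)
       (sorted_key_list_of_set (attempt_time w)
          {(p, n). p \<in> {1..N} \<and> attempt_time w (p, n) \<le> t}) Y"

definition waiting_times :: "nat \<Rightarrow> (nat \<Rightarrow> real) \<Rightarrow> (nat \<Rightarrow> nat) \<Rightarrow> (nat \<times> nat \<Rightarrow> real) measure" where
  "waiting_times N b \<nu> =
     (\<Pi>\<^sub>M (p, n)\<in>{1..N} \<times> UNIV. density lborel (exponential_density (b (\<nu> p))))"

text \<open>
  Configuration \<open>z\<close> represents the state \<open>(X, \<pi>)\<close>. For \<open>X 1 < \<dots> < X N\<close> the \<open>N\<close> distinct sites account
  for all \<open>N\<close> particles.
\<close>

definition in_state :: "nat \<Rightarrow> (nat \<Rightarrow> nat) \<Rightarrow> (nat \<Rightarrow> int) \<Rightarrow> (nat \<Rightarrow> int) \<Rightarrow> (nat \<Rightarrow> nat) \<Rightarrow> bool" where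
  "in_state N \<nu> z X \<pi> \<longleftrightarrow> (\<forall>i\<in>{1..N}. \<exists>p\<in>{1..N}. z p = X i \<and> \<nu> p = \<pi> i)"

definition transition_prob ::
  "nat \<Rightarrow> (nat \<Rightarrow> real) \<Rightarrow> (nat \<Rightarrow> int) \<Rightarrow> (nat \<Rightarrow> nat) \<Rightarrow> (nat \<Rightarrow> int) \<Rightarrow> (nat \<Rightarrow> nat) \<Rightarrow> real \<Rightarrow> real" where
  "transition_prob N b Y \<nu> X \<pi> t =
     measure (waiting_times N b \<nu>)
       {w \<in> space (waiting_times N b \<nu>). in_state N \<nu> (config_at N \<nu> Y w t) X \<pi>}"

section \<open>Matrices\<close>

text \<open>
  \<open>word N n r\<close> is the \<open>r\<close>-th word (counting from 0) of \<open>{1..N}\<^sup>n\<close> in lexicographic order: its letters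
  are, up to the shift by 1, the base-\<open>N\<close> digits of \<open>r\<close>, the most significant one in slot 1.
\<close>

definition word :: "nat \<Rightarrow> nat \<Rightarrow> nat \<Rightarrow> nat \<Rightarrow> nat" where
  "word N n r = (\<lambda>i. r div N ^ (n - i) mod N + 1)"

text \<open>The Kronecker product for which the labels of a product are the concatenated labels.\<close>

definition kron :: "'a::semiring_1 mat \<Rightarrow> 'a mat \<Rightarrow> 'a mat" (infixr "\<otimes>\<^sub>k" 71) where
  "A \<otimes>\<^sub>k B =
     mat (dim_row A * dim_row B) (dim_col A * dim_col B)
       (\<lambda>(r, c). A $$ (r div dim_row B, c div dim_col B) * B $$ (r mod dim_row B, c mod dim_col B))"

primrec kron_power :: "'a::semiring_1 mat \<Rightarrow> nat \<Rightarrow> 'a mat" where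
  "kron_power A 0 = 1\<^sub>m 1"
| "kron_power A (Suc n) = A \<otimes>\<^sub>k kron_power A n"

definition diagonal :: "nat \<Rightarrow> (nat \<Rightarrow> 'a::zero) \<Rightarrow> 'a mat" where
  "diagonal d f = mat d d (\<lambda>(r, c). if r = c then f r else 0)"

definition S_coeff :: "(nat \<Rightarrow> real) \<Rightarrow> (nat \<Rightarrow> complex) \<Rightarrow> nat \<Rightarrow> nat \<Rightarrow> nat \<Rightarrow> complex" where
  "S_coeff b \<xi> \<beta> \<alpha> i = - ((1 - b i * \<xi> \<beta>) / (1 - b i * \<xi> \<alpha>))"

definition T_coeff :: "(nat \<Rightarrow> real) \<Rightarrow> (nat \<Rightarrow> complex) \<Rightarrow> nat \<Rightarrow> nat \<Rightarrow> nat \<Rightarrow> complex" where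
  "T_coeff b \<xi> \<beta> \<alpha> i = b i * (\<xi> \<beta> - \<xi> \<alpha>) / (1 - b i * \<xi> \<alpha>)"

definition R_mat :: "nat \<Rightarrow> (nat \<Rightarrow> real) \<Rightarrow> (nat \<Rightarrow> complex) \<Rightarrow> nat \<Rightarrow> nat \<Rightarrow> complex mat" where
  "R_mat N b \<xi> \<beta> \<alpha> = mat (N ^ 2) (N ^ 2) (\<lambda>(r, c).
     let i = word N 2 r 1; j = word N 2 r 2; k = word N 2 c 1; l = word N 2 c 2
     in if (i, j) = (k, l) \<and> i \<le> j then S_coeff b \<xi> \<beta> \<alpha> i
        else if (i, j) = (k, l) \<and> i > j then - 1
        else if (i, j) = (l, k) \<and> i < j then T_coeff b \<xi> \<beta> \<alpha> i
        else 0)"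

definition T_mat ::
  "nat \<Rightarrow> (nat \<Rightarrow> real) \<Rightarrow> (nat \<Rightarrow> complex) \<Rightarrow> nat \<Rightarrow> nat \<Rightarrow> nat \<Rightarrow> complex mat" where
  "T_mat N b \<xi> l \<beta> \<alpha> =
     kron_power (1\<^sub>m N) (l - 1) \<otimes>\<^sub>k R_mat N b \<xi> \<beta> \<alpha> \<otimes>\<^sub>k kron_power (1\<^sub>m N) (N - l - 1)"

text \<open>
  A permutation \<open>\<sigma>\<close> is identified with the word \<open>\<sigma> 1 \<dots> \<sigma> N\<close>; interchanging the numbers in slots \<open>l\<close>
  and \<open>l + 1\<close> is composition with a transposition on the right. The list \<open>[i\<^sub>1, \<dots>, i\<^sub>j]\<close> stands for
  applying first the \<open>i\<^sub>1\<close>-st, \<dots>, finally the \<open>i\<^sub>j\<close>-th simple transposition.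
\<close>

definition swap_slots :: "nat \<Rightarrow> (nat \<Rightarrow> nat) \<Rightarrow> (nat \<Rightarrow> nat)" where
  "swap_slots l \<sigma> = \<sigma> \<circ> Transposition.transpose l (l + 1)"

definition expresses :: "nat \<Rightarrow> nat list \<Rightarrow> (nat \<Rightarrow> nat) \<Rightarrow> bool" where
  "expresses N ls \<sigma> \<longleftrightarrow> set ls \<subseteq> {1..<N} \<and> fold swap_slots ls id = \<sigma>"

text \<open>
  The product of the matrices \<open>T\<^sub>l(\<beta>, \<alpha>)\<close> along a list of simple transpositions, starting from the word
  \<open>\<sigma>\<close>; later transpositions contribute factors further to the left.
\<close>

primrec T_product ::
  "nat \<Rightarrow> (nat \<Rightarrow> real) \<Rightarrow> (nat \<Rightarrow> complex) \<Rightarrow> (nat \<Rightarrow> nat) \<Rightarrow> nat list \<Rightarrow> complex mat" where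
  "T_product N b \<xi> \<sigma> [] = 1\<^sub>m (N ^ N)"
| "T_product N b \<xi> \<sigma> (l # ls) =
     T_product N b \<xi> (swap_slots l \<sigma>) ls * T_mat N b \<xi> l (\<sigma> (l + 1)) (\<sigma> l)"

text \<open>
  The product does not depend on the expression (as long as no denominator vanishes), so an arbitrary
  one is chosen for each \<open>\<sigma>\<close>, uniformly in \<open>b\<close> and \<open>\<xi>\<close>.
\<close>

definition A_mat :: "nat \<Rightarrow> (nat \<Rightarrow> real) \<Rightarrow> (nat \<Rightarrow> complex) \<Rightarrow> (nat \<Rightarrow> nat) \<Rightarrow> complex mat" where
  "A_mat N b \<xi> \<sigma> = T_product N b \<xi> id (SOME ls. expresses N ls \<sigma>)"

definition J_mat :: "nat \<Rightarrow> (nat \<Rightarrow> real) \<Rightarrow> (nat \<Rightarrow> complex) \<Rightarrow> real \<Rightarrow> complex mat" where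
  "J_mat N b \<xi> t = diagonal (N ^ N) (\<lambda>r.
     exp (((\<Sum>i=1..N. 1 / \<xi> i) - complex_of_real (\<Sum>i=1..N. b (word N N r i))) * t))"

definition D_mat :: "nat \<Rightarrow> (nat \<Rightarrow> real) \<Rightarrow> (nat \<Rightarrow> int) \<Rightarrow> complex mat" where
  "D_mat N b X = diagonal (N ^ N) (\<lambda>r. \<Prod>i=1..N. complex_of_real (b (word N N r i)) powi X i)"

definition D'_mat :: "nat \<Rightarrow> (nat \<Rightarrow> real) \<Rightarrow> (nat \<Rightarrow> int) \<Rightarrow> complex mat" where
  "D'_mat N b Y = diagonal (N ^ N) (\<lambda>c. \<Prod>i=1..N. complex_of_real (b (word N N c i)) powi (- Y i))"

definition P_mat :: "nat \<Rightarrow> (nat \<Rightarrow> real) \<Rightarrow> (nat \<Rightarrow> int) \<Rightarrow> (nat \<Rightarrow> int) \<Rightarrow> real \<Rightarrow> complex mat" where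
  "P_mat N b Y X t = mat (N ^ N) (N ^ N) (\<lambda>(r, c).
     complex_of_real (transition_prob N b Y (word N N c) X (word N N r) t))"

text \<open>
  The iterated integral of \<open>F \<xi>\<close> over \<open>\<xi> 1, \<dots>, \<xi> n\<close>, with \<open>\<xi> 1\<close> innermost; the base point
  \<open>\<lambda>_. 0\<close> is overwritten in all coordinates that matter.
\<close>

primrec iterated_contour_integral ::
  "nat \<Rightarrow> (real \<Rightarrow> complex) \<Rightarrow> ((nat \<Rightarrow> complex) \<Rightarrow> complex) \<Rightarrow> complex" where
  "iterated_contour_integral 0 g F = F (\<lambda>_. 0)"
| "iterated_contour_integral (Suc n) g F =
     contour_integral g (\<lambda>z. iterated_contour_integral n g (\<lambda>\<xi>. F (\<xi>(Suc n := z))))"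

end

theory Submission
  imports Defs
begin

text \<open>
  Let \<open>B\<close> be the total rate of the particles. The sequence of the particles that attempt to jump up to time \<open>t\<close>
  equals a given list of length \<open>n\<close> with probability \<open>exp (- B * t) * t ^ n / fact n\<close> times the product of the rates of
  its members (\<open>emeasure_attempts_are\<close>), and the configuration at time \<open>t\<close> depends on this list only. So
  the transition probability is \<open>exp (- B * t)\<close> times the exponential generating function of the weights
  \<open>attempt_weight\<close>, the total rates of the lists of length \<open>n\<close> that lead to \<open>(X, \<pi>)\<close>
  (\<open>transition_prob_sums\<close>). Expanding \<open>exp (t * (1 / \<xi> 1 + \<dots> + 1 / \<xi> N))\<close> shows that the sum of integrals has the same
  form (\<open>moment_exp_sums\<close>). It remains to compare the coefficients of \<open>t ^ n / fact n\<close>, which is done by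
  induction on \<open>n\<close> (\<open>bethe_eq_attempt_weight\<close>).

  Both coefficients satisfy the same recursion, with the sum of the terms \<open>inflow\<close> on the right. For the
  weights it results from conditioning on the last attempt (\<open>attempt_weight_Suc\<close>). For the integrals, one
  more factor \<open>1 / \<xi> 1 + \<dots> + 1 / \<xi> N\<close> lowers one of the positions (\<open>moment_Suc\<close>). If the lowered position collides
  with its neighbour, a boundary condition (\<open>moment_boundary\<close>) expresses the integral by integrals at
  admissible positions; the resulting terms are those of blocked and of interchanging attempts. It follows by pairing
  \<open>\<sigma>\<close> with the permutation that has the two slots interchanged, since the amplitudes of the two differ by
  one factor \<open>T\<^sub>l(\<beta>, \<alpha>)\<close>. This requires that \<open>A\<^sub>\<sigma>\<close> does not depend on the expression of \<open>\<sigma>\<close>: the factors satisfy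
  the Coxeter relations (\<open>R_op_braid\<close>), and these suffice to bring every expression into a normal form
  that is determined by the permutation (\<open>fold_eq_if_same_permutation\<close>).

  For \<open>n = 0\<close> the identity permutation alone contributes, and its integral is the Kronecker delta. For any other \<open>\<sigma>\<close>
  the integral vanishes (\<open>wave_amplitude_integral_nontrivial\<close>): either the integrand is holomorphic in some
  variable, or all exponents are negative; then the exponent of the variable of the largest moved letter \<open>m\<close>,
  which stands in a slot \<open>i < m\<close>, is below \<open>- 1 - (m - i)\<close>, while the amplitude is a polynomial of degree at most
  \<open>m - i\<close> in it.
\<close>

section \<open>Products of simple transpositions\<close>

text \<open>
A state \<open>x\<close> carries the permutation \<open>perm x\<close> reached so far, and \<open>g l\<close> performs the \<open>l\<close>-th simple
transposition. The first three laws are the Coxeter relations of the symmetric group; as all words and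
not only the reduced ones have to be compared, the involution law is indispensable.
\<close>

locale braid_action =
  fixes g :: "nat \<Rightarrow> 'a \<Rightarrow> 'a" and perm :: "'a \<Rightarrow> nat \<Rightarrow> nat"
  assumes involution: "g l (g l x) = x"
    and far_commute: "Suc l < k \<Longrightarrow> g k (g l x) = g l (g k x)"
    and braid: "g l (g (Suc l) (g l x)) = g (Suc l) (g l (g (Suc l) x))"
    and perm_g: "perm (g l x) = swap_slots l (perm x)"
begin

lemma commute_above: "\<forall>k\<in>set ks. Suc l < k \<Longrightarrow> g l (fold g ks x) = fold g ks (g l x)"
proof (induction ks arbitrary: x)
  case (Cons k ks)
  then show ?case using far_commute[of l k x] by simp
qed simp

lemma commute_below: "\<forall>k\<in>set ks. Suc k < l \<Longrightarrow> g l (fold g ks x) = fold g ks (g l x)"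
proof (induction ks arbitrary: x)
  case (Cons k ks)
  then show ?case using far_commute[of k l x] by simp
qed simp

lemma pass_through_run:
  assumes "i \<le> k" "Suc k < m"
  shows "g (Suc k) (fold g (rev [i..<m]) x) = fold g (rev [i..<m]) (g k x)"
proof -
  have "[i..<m] = [i..<k] @ [k..<m]"
    using assms upt_add_eq_append[of i k "m - k"] by simp
  also have "[k..<m] = k # Suc k # [Suc (Suc k)..<m]"
    using assms by (simp add: upt_conv_Cons)
  finally have "rev [i..<m] = rev [Suc (Suc k)..<m] @ [Suc k, k] @ rev [i..<k]" by simp
  then have run: "fold g (rev [i..<m]) y =
      fold g (rev [i..<k]) (g k (g (Suc k) (fold g (rev [Suc (Suc k)..<m]) y)))" for y by simp
  have "fold g (rev [i..<m]) (g k x) =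
      fold g (rev [i..<k]) (g k (g (Suc k) (g k (fold g (rev [Suc (Suc k)..<m]) x))))"
    unfolding run by (subst commute_above) auto
  also have "\<dots> = g (Suc k) (fold g (rev [i..<m]) x)"
    unfolding run braid by (rule commute_below[symmetric]) auto
  finally show ?thesis by simp
qed

text \<open>
  Pushing one letter after another to the left through the last descending run, either
  the run changes its lower end or a smaller letter drops out in front of it.
\<close>

lemma normal_form:
  assumes "set ls \<subseteq> {1..<Suc m}"
  shows "\<exists>ls' i. set ls' \<subseteq> {1..<m} \<and> 1 \<le> i \<and> i \<le> Suc m \<and>
    (\<forall>x. fold g ls x = fold g (rev [i..<Suc m]) (fold g ls' x))"
  using assms
proof (induction ls rule: rev_induct)
  case Nil
  show ?case by (rule exI[of _ "[]"], rule exI[of _ "Suc m"]) simp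
next
  case (snoc l ls)
  then obtain ls' i where *: "set ls' \<subseteq> {1..<m}" "1 \<le> i" "i \<le> Suc m"
    "\<And>x. fold g ls x = fold g (rev [i..<Suc m]) (fold g ls' x)" by auto
  have l: "1 \<le> l" "l \<le> m" using snoc.prems by auto
  consider "Suc l = i" | "l = i" | "Suc l < i" | "i < l" by linarith
  then show ?case
  proof cases
    case 1
    have "rev [l..<Suc m] = rev [i..<Suc m] @ [l]" using 1 l by (simp add: upt_conv_Cons del: upt_Suc)
    then show ?thesis using * 1 l
      by (intro exI[of _ ls'] exI[of _ l]) (simp del: upt_Suc)
  next
    case 2
    have "rev [i..<Suc m] = rev [Suc l..<Suc m] @ [l]" using 2 l by (simp add: upt_conv_Cons del: upt_Suc)
    then show ?thesis using * 2 l
      by (intro exI[of _ ls'] exI[of _ "Suc l"]) (simp add: involution del: upt_Suc)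
  next
    case 3
    have "g l (fold g (rev [i..<Suc m]) y) = fold g (rev [i..<Suc m]) (g l y)" for y
      by (rule commute_above) (use 3 in auto)
    then show ?thesis using * 3 l
      by (intro exI[of _ "ls' @ [l]"] exI[of _ i]) (auto simp del: upt_Suc)
  next
    case 4
    then obtain k where k: "l = Suc k" "i \<le> k" by (cases l) auto
    have "g l (fold g (rev [i..<Suc m]) y) = fold g (rev [i..<Suc m]) (g k y)" for y
      unfolding k(1) by (rule pass_through_run) (use k l in auto)
    then show ?thesis using * 4 l k
      by (intro exI[of _ "ls' @ [k]"] exI[of _ i]) (auto simp del: upt_Suc)
  qed
qed

lemma perm_fold: "perm (fold g ls x) = fold swap_slots ls (perm x)"
  by (induction ls arbitrary: x) (simp_all add: perm_g)

end

lemma swap_slots_involution: "swap_slots l (swap_slots l \<sigma>) = \<sigma>"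
  by (simp add: swap_slots_def comp_assoc)

lemma fold_swap_slots_fixes:
  assumes "\<forall>l\<in>set ls. j \<noteq> l \<and> j \<noteq> Suc l"
  shows "fold swap_slots ls \<sigma> j = \<sigma> j"
  using assms by (induction ls arbitrary: \<sigma>) (auto simp: swap_slots_def)

lemma fold_swap_slots_run:
  assumes "i \<le> m"
  shows "fold swap_slots (rev [i..<m]) \<sigma> i = \<sigma> m"
  using assms
proof (induction m arbitrary: \<sigma>)
  case (Suc m)
  show ?case
  proof (cases "i = Suc m")
    case False
    then have "rev [i..<Suc m] = m # rev [i..<m]" "i \<le> m" using Suc.prems by auto
    then show ?thesis using Suc.IH[of "swap_slots m \<sigma>"] by (simp add: swap_slots_def)
  qed simp
qed simp

lemma fold_swap_slots_rev: "fold swap_slots (rev ls) (fold swap_slots ls \<sigma>) = \<sigma>"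
  by (induction ls arbitrary: \<sigma>) (simp_all add: swap_slots_involution)

lemma inj_fold_swap_slots: "inj \<sigma> \<Longrightarrow> inj (fold swap_slots ls \<sigma>)"
proof (induction ls arbitrary: \<sigma>)
  case (Cons l ls)
  have "inj (swap_slots l \<sigma>)"
    unfolding swap_slots_def by (rule inj_compose[OF Cons.prems inj_on_transpose])
  then show ?case using Cons.IH by simp
qed simp

lemma fold_swap_slots_permutes:
  assumes "set ls \<subseteq> {1..<m}" "\<sigma> permutes {1..m}"
  shows "fold swap_slots ls \<sigma> permutes {1..m}"
  using assms
proof (induction ls arbitrary: \<sigma>)
  case (Cons l ls)
  have "Transposition.transpose l (l + 1) permutes {1..m}"
    using Cons.prems by (intro permutes_swap_id) auto
  then have "swap_slots l \<sigma> permutes {1..m}"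
    unfolding swap_slots_def using Cons.prems by (intro permutes_compose)
  then show ?case using Cons by simp
qed simp

context braid_action begin

text \<open>
  The largest letter \<open>m\<close> ends up in the slot where the last run of a normal form stops, so the
  permutation determines the run and, recursively, the whole normal form.
\<close>

lemma fold_eq_if_same_permutation:
  assumes "set ls1 \<subseteq> {1..<m}" "set ls2 \<subseteq> {1..<m}" "perm x = id"
    and "fold swap_slots ls1 id = fold swap_slots ls2 id"
  shows "fold g ls1 x = fold g ls2 x"
  using assms
proof (induction m arbitrary: ls1 ls2)
  case (Suc m)
  have ex: "\<exists>ls' i. set ls' \<subseteq> {1..<m} \<and> i \<le> Suc m \<and>
      (\<forall>x. fold g ls x = fold g (rev [i..<Suc m]) (fold g ls' x)) \<and>
      fold swap_slots ls id = fold swap_slots (rev [i..<Suc m]) (fold swap_slots ls' id) \<and>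
      fold swap_slots ls id i = Suc m" if ls: "set ls \<subseteq> {1..<Suc m}" for ls
  proof (cases "m = 0")
    case True
    then show ?thesis using ls by (intro exI[of _ "[]"] exI[of _ "Suc m"]) auto
  next
    case False
    then obtain k where k: "m = Suc k" by (cases m) auto
    obtain ls' i where *: "set ls' \<subseteq> {1..<m}" "1 \<le> i" "i \<le> Suc m"
      "\<And>x. fold g ls x = fold g (rev [i..<Suc m]) (fold g ls' x)"
      using normal_form[OF ls] by blast
    have "perm (fold g ls x) = perm (fold g (rev [i..<Suc m]) (fold g ls' x))" by (simp only: *)
    then have 1: "fold swap_slots ls id = fold swap_slots (rev [i..<Suc m]) (fold swap_slots ls' id)"
      using Suc.prems by (simp only: perm_fold)
    have "fold swap_slots ls' id (Suc m) = id (Suc m)"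
      by (rule fold_swap_slots_fixes) (use *(1) in auto)
    then have "fold swap_slots ls id i = Suc m"
      unfolding 1 by (subst fold_swap_slots_run) (use *(3) in auto)
    then show ?thesis using * 1 by blast
  qed
  obtain ls1' i1 where 1: "set ls1' \<subseteq> {1..<m}" "i1 \<le> Suc m"
    "\<And>x. fold g ls1 x = fold g (rev [i1..<Suc m]) (fold g ls1' x)"
    "fold swap_slots ls1 id = fold swap_slots (rev [i1..<Suc m]) (fold swap_slots ls1' id)"
    "fold swap_slots ls1 id i1 = Suc m" using ex[OF Suc.prems(1)] by blast
  obtain ls2' i2 where 2: "set ls2' \<subseteq> {1..<m}" "i2 \<le> Suc m"
    "\<And>x. fold g ls2 x = fold g (rev [i2..<Suc m]) (fold g ls2' x)"
    "fold swap_slots ls2 id = fold swap_slots (rev [i2..<Suc m]) (fold swap_slots ls2' id)"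
    "fold swap_slots ls2 id i2 = Suc m" using ex[OF Suc.prems(2)] by blast
  have "inj (fold swap_slots ls1 id)" by (rule inj_fold_swap_slots) simp
  moreover have "fold swap_slots ls1 id i2 = fold swap_slots ls1 id i1"
    using 1(5) 2(5) Suc.prems(4) by (simp only:)
  ultimately have [simp]: "i2 = i1" by (rule injD)
  have "fold swap_slots ls1' id = fold swap_slots ls2' id"
    using arg_cong[OF Suc.prems(4), of "fold swap_slots (rev (rev [i1..<Suc m]))"]
    unfolding 1(4) 2(4) \<open>i2 = i1\<close> fold_swap_slots_rev .
  then have "fold g ls1' x = fold g ls2' x" using Suc.IH 1(1) 2(1) Suc.prems(3) by blast
  then show ?case by (simp add: 1(3) 2(3) del: upt_Suc)
qed simp

end

text \<open>
The largest letter can be moved last, in a single run. This is the expression in which the dependence of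
the amplitude on the variable of that letter is visible.
\<close>

lemma permutes_expressible_run:
  assumes "\<sigma> permutes {1..m}" "\<sigma> i = m" "1 \<le> m"
  shows "\<exists>ls. set ls \<subseteq> {1..<m - 1} \<and> fold swap_slots (ls @ rev [i..<m]) id = \<sigma>"
  using assms
proof (induction m arbitrary: \<sigma> i)
  case (Suc m)
  have i: "1 \<le> i" "i \<le> Suc m"
    using Suc.prems(1,2,3) permutes_in_image[of \<sigma> "{1..Suc m}" i] by auto
  define \<sigma>' where "\<sigma>' = fold swap_slots [i..<Suc m] \<sigma>"
  have \<sigma>: "fold swap_slots (rev [i..<Suc m]) \<sigma>' = \<sigma>"
    unfolding \<sigma>'_def by (rule fold_swap_slots_rev)
  have p: "\<sigma>' permutes {1..Suc m}"
    unfolding \<sigma>'_def by (rule fold_swap_slots_permutes) (use i Suc.prems in auto)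
  have top: "\<sigma>' (Suc m) = Suc m"
    using fold_swap_slots_run[OF i(2), of \<sigma>'] \<sigma> Suc.prems(2) by simp
  have "{1..Suc m} - {Suc m} = {1..m}" by auto
  then have p': "\<sigma>' permutes {1..m}"
    using permutes_superset[OF p, of "{1..m}"] top by (auto simp: le_Suc_eq)
  show ?case
  proof (cases "m = 0")
    case True
    then have "\<sigma>' = id" using p' by simp
    moreover have "i = Suc 0" using i True by simp
    ultimately show ?thesis using \<sigma> True by (intro exI[of _ "[]"]) simp
  next
    case False
    define i' where "i' = inv_into UNIV \<sigma>' m"
    have "\<sigma>' i' = m" using p' by (simp add: i'_def permutes_inverses)
    then obtain ls where ls: "set ls \<subseteq> {1..<m - 1}" "fold swap_slots (ls @ rev [i'..<m]) id = \<sigma>'"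
      using Suc.IH[OF p' \<open>\<sigma>' i' = m\<close>] False by (metis One_nat_def Suc_leI neq0_conv)
    have "1 \<le> i'" using permutes_in_image[OF p', of i'] \<open>\<sigma>' i' = m\<close> False by auto
    then have "set (ls @ rev [i'..<m]) \<subseteq> {1..<Suc m - 1}"
      using order.trans[OF ls(1), of "{1..<m}"] by auto
    moreover have "fold swap_slots ((ls @ rev [i'..<m]) @ rev [i..<Suc m]) id = \<sigma>"
      using ls(2) \<sigma> by (simp del: upt_Suc)
    ultimately show ?thesis by blast
  qed
qed simp

lemma permutes_expressible:
  assumes "\<sigma> permutes {1..N}"
  shows "\<exists>ls. expresses N ls \<sigma>"
proof (cases "N = 0")
  case True
  then show ?thesis using assms by (intro exI[of _ "[]"]) (simp add: expresses_def)
next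
  case False
  define i where "i = inv_into UNIV \<sigma> N"
  have i: "\<sigma> i = N" using assms by (simp add: i_def permutes_inverses)
  then have "1 \<le> i" using permutes_in_image[OF assms, of i] False by auto
  obtain ls where ls: "set ls \<subseteq> {1..<N - 1}" "fold swap_slots (ls @ rev [i..<N]) id = \<sigma>"
    using permutes_expressible_run[OF assms i] False by auto
  have "set (ls @ rev [i..<N]) \<subseteq> {1..<N}"
    using order.trans[OF ls(1), of "{1..<N}"] \<open>1 \<le> i\<close> by auto
  then show ?thesis unfolding expresses_def using ls(2) by blast
qed

section \<open>Iterated contour integrals of sums of products\<close>

abbreviation circ_integral :: "real \<Rightarrow> (complex \<Rightarrow> complex) \<Rightarrow> complex" where
  "circ_integral \<rho> \<equiv> contour_integral (circlepath 0 \<rho>)"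

abbreviation torus_integral :: "nat \<Rightarrow> real \<Rightarrow> ((nat \<Rightarrow> complex) \<Rightarrow> complex) \<Rightarrow> complex" where
  "torus_integral n \<rho> \<equiv> iterated_contour_integral n (circlepath 0 \<rho>)"

text \<open>
The coordinates that are not integrated keep the value 0 of the base point of
\<^const>\<open>iterated_contour_integral\<close>.
\<close>

definition torus :: "nat \<Rightarrow> real \<Rightarrow> (nat \<Rightarrow> complex) set" where
  "torus n \<rho> = {\<xi>. (\<forall>i\<in>{1..n}. norm (\<xi> i) = \<rho>) \<and> (\<forall>i. i \<notin> {1..n} \<longrightarrow> \<xi> i = 0)}"

text \<open>
On the torus every integrand is a finite sum of products of functions of one variable each.
The sets \<open>\<Phi> i\<close> below record what is known about the factors in the variable \<open>i\<close>: continuity is enough for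
linearity and estimates, whereas holomorphy and bounds on degrees make integrals vanish.
\<close>

definition sum_of_products ::
  "nat \<Rightarrow> (complex \<times> (nat \<Rightarrow> complex \<Rightarrow> complex)) list \<Rightarrow> (nat \<Rightarrow> complex) \<Rightarrow> complex" where
  "sum_of_products n ts \<xi> = (\<Sum>t\<leftarrow>ts. fst t * (\<Prod>i=1..n. snd t i (\<xi> i)))"

definition separable ::
  "nat \<Rightarrow> real \<Rightarrow> (nat \<Rightarrow> (complex \<Rightarrow> complex) set) \<Rightarrow> ((nat \<Rightarrow> complex) \<Rightarrow> complex) \<Rightarrow> bool" where
  "separable n \<rho> \<Phi> F \<longleftrightarrow>
     (\<exists>ts. (\<forall>t\<in>set ts. \<forall>i\<in>{1..n}. snd t i \<in> \<Phi> i) \<and> (\<forall>\<xi>\<in>torus n \<rho>. F \<xi> = sum_of_products n ts \<xi>))"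

abbreviation continuous_functions :: "real \<Rightarrow> nat \<Rightarrow> (complex \<Rightarrow> complex) set" where
  "continuous_functions \<rho> \<equiv> \<lambda>_. {f. continuous_on (sphere 0 \<rho>) f}"

abbreviation torus_continuous :: "nat \<Rightarrow> real \<Rightarrow> ((nat \<Rightarrow> complex) \<Rightarrow> complex) \<Rightarrow> bool" where
  "torus_continuous n \<rho> \<equiv> separable n \<rho> (continuous_functions \<rho>)"

lemma torus_Suc: "\<xi> \<in> torus n \<rho> \<Longrightarrow> norm z = \<rho> \<Longrightarrow> \<xi>(Suc n := z) \<in> torus (Suc n) \<rho>"
  by (auto simp: torus_def)

lemma torus_nonzero: "\<xi> \<in> torus n \<rho> \<Longrightarrow> \<rho> > 0 \<Longrightarrow> i \<in> {1..n} \<Longrightarrow> \<xi> i \<noteq> 0"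
  by (auto simp: torus_def)

lemma torus_norm_le: "\<xi> \<in> torus n \<rho> \<Longrightarrow> \<rho> > 0 \<Longrightarrow> norm (\<xi> i) \<le> \<rho>"
  by (cases "i \<in> {1..n}") (auto simp: torus_def)

subsection \<open>Closure properties\<close>

lemma separable_cong:
  "(\<And>\<xi>. \<xi> \<in> torus n \<rho> \<Longrightarrow> F \<xi> = G \<xi>) \<Longrightarrow> separable n \<rho> \<Phi> F \<longleftrightarrow> separable n \<rho> \<Phi> G"
  by (auto simp: separable_def)

lemma separable_mono:
  assumes "separable n \<rho> \<Phi> F" "\<And>i. i \<in> {1..n} \<Longrightarrow> \<Phi> i \<subseteq> \<Psi> i"
  shows "separable n \<rho> \<Psi> F"
  using assms unfolding separable_def by (meson subsetD)

lemma separable_zero [intro]: "separable n \<rho> \<Phi> (\<lambda>\<xi>. 0)"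
  unfolding separable_def by (rule exI[of _ "[]"]) (simp add: sum_of_products_def)

lemma separable_add:
  assumes "separable n \<rho> \<Phi> F" "separable n \<rho> \<Phi> G"
  shows "separable n \<rho> \<Phi> (\<lambda>\<xi>. F \<xi> + G \<xi>)"
proof -
  obtain ts us where *: "\<forall>t\<in>set ts. \<forall>i\<in>{1..n}. snd t i \<in> \<Phi> i" "\<forall>\<xi>\<in>torus n \<rho>. F \<xi> = sum_of_products n ts \<xi>"
    "\<forall>t\<in>set us. \<forall>i\<in>{1..n}. snd t i \<in> \<Phi> i" "\<forall>\<xi>\<in>torus n \<rho>. G \<xi> = sum_of_products n us \<xi>"
    using assms unfolding separable_def by blast
  show ?thesis unfolding separable_def
    by (rule exI[of _ "ts @ us"]) (use * in \<open>auto simp: sum_of_products_def\<close>)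
qed

lemma separable_sum:
  "(\<And>a. a \<in> A \<Longrightarrow> separable n \<rho> \<Phi> (F a)) \<Longrightarrow> separable n \<rho> \<Phi> (\<lambda>\<xi>. \<Sum>a\<in>A. F a \<xi>)"
  by (induction A rule: infinite_finite_induct) (auto intro: separable_add)

lemma separable_single:
  "(\<And>i. i \<in> {1..n} \<Longrightarrow> f i \<in> \<Phi> i) \<Longrightarrow> separable n \<rho> \<Phi> (\<lambda>\<xi>. \<Prod>i=1..n. f i (\<xi> i))"
  unfolding separable_def by (rule exI[of _ "[(1, f)]"]) (simp add: sum_of_products_def)

lemma separable_mult:
  assumes "separable n \<rho> \<Phi> F" "separable n \<rho> \<Psi> G"
    and closed: "\<And>i f g. i \<in> {1..n} \<Longrightarrow> f \<in> \<Phi> i \<Longrightarrow> g \<in> \<Psi> i \<Longrightarrow> (\<lambda>z. f z * g z) \<in> \<Theta> i"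
  shows "separable n \<rho> \<Theta> (\<lambda>\<xi>. F \<xi> * G \<xi>)"
proof -
  obtain ts us where *: "\<forall>t\<in>set ts. \<forall>i\<in>{1..n}. snd t i \<in> \<Phi> i" "\<forall>\<xi>\<in>torus n \<rho>. F \<xi> = sum_of_products n ts \<xi>"
    "\<forall>t\<in>set us. \<forall>i\<in>{1..n}. snd t i \<in> \<Psi> i" "\<forall>\<xi>\<in>torus n \<rho>. G \<xi> = sum_of_products n us \<xi>"
    using assms(1,2) unfolding separable_def by blast
  define m :: "complex \<times> (nat \<Rightarrow> complex \<Rightarrow> complex) \<Rightarrow> complex \<times> (nat \<Rightarrow> complex \<Rightarrow> complex) \<Rightarrow>
      complex \<times> (nat \<Rightarrow> complex \<Rightarrow> complex)"
    where "m = (\<lambda>t u. (fst t * fst u, \<lambda>i z. snd t i z * snd u i z))"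
  have one: "sum_of_products n (map (m t) us) \<xi> = fst t * (\<Prod>i=1..n. snd t i (\<xi> i)) * sum_of_products n us \<xi>"
    for t us \<xi>
    by (induction us) (auto simp: sum_of_products_def m_def prod.distrib algebra_simps)
  have "sum_of_products n (concat (map (\<lambda>t. map (m t) us) ts)) \<xi> = sum_of_products n ts \<xi> * sum_of_products n us \<xi>" for \<xi>
  proof (induction ts)
    case (Cons t ts)
    have "sum_of_products n (concat (map (\<lambda>t. map (m t) us) (t # ts))) \<xi> =
        sum_of_products n (map (m t) us) \<xi> + sum_of_products n (concat (map (\<lambda>t. map (m t) us) ts)) \<xi>"
      by (simp add: sum_of_products_def)
    then show ?case
      by (simp only: Cons one) (simp add: sum_of_products_def algebra_simps)
  qed (simp add: sum_of_products_def)
  moreover have "\<forall>t\<in>set (concat (map (\<lambda>t. map (m t) us) ts)). \<forall>i\<in>{1..n}. snd t i \<in> \<Theta> i"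
  proof (intro ballI)
    fix v i assume "v \<in> set (concat (map (\<lambda>t. map (m t) us) ts))" and i: "i \<in> {1..n}"
    then obtain t u where "t \<in> set ts" "u \<in> set us" "v = m t u" by auto
    then show "snd v i \<in> \<Theta> i" using closed[OF i] *(1,3) i by (simp add: m_def)
  qed
  ultimately show ?thesis unfolding separable_def using *(2,4) by metis
qed

lemma separable_const:
  assumes "\<And>i. i \<in> {1..n} \<Longrightarrow> (\<lambda>z. 1) \<in> \<Phi> i"
  shows "separable n \<rho> \<Phi> (\<lambda>\<xi>. c)"
  unfolding separable_def
  by (rule exI[of _ "[(c, \<lambda>i z. 1)]"]) (use assms in \<open>simp add: sum_of_products_def\<close>)

lemma separable_coordinate:
  assumes "j \<in> {1..n}" "f \<in> \<Phi> j" "\<And>i. i \<in> {1..n} \<Longrightarrow> i \<noteq> j \<Longrightarrow> (\<lambda>z. 1) \<in> \<Phi> i"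
  shows "separable n \<rho> \<Phi> (\<lambda>\<xi>. f (\<xi> j))"
proof -
  define h where "h = (\<lambda>i. if i = j then f else (\<lambda>z. 1))"
  have "(\<Prod>i=1..n. h i (\<xi> i)) = f (\<xi> j)" for \<xi> :: "nat \<Rightarrow> complex"
  proof -
    have "(\<Prod>i=1..n. h i (\<xi> i)) = (\<Prod>i=1..n. if i = j then f (\<xi> j) else 1)"
      by (rule prod.cong) (auto simp: h_def)
    also have "\<dots> = f (\<xi> j)" by (subst prod.delta) (use assms(1) in auto)
    finally show ?thesis .
  qed
  then have "(\<lambda>\<xi>. f (\<xi> j)) = (\<lambda>\<xi>. \<Prod>i=1..n. h i (\<xi> i))" by simp
  then show ?thesis using separable_single[of n h \<Phi> \<rho>] assms by (simp add: h_def)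
qed

lemma separable_cmult:
  assumes "separable n \<rho> \<Phi> F"
  shows "separable n \<rho> \<Phi> (\<lambda>\<xi>. c * F \<xi>)"
proof -
  obtain ts where *: "\<forall>t\<in>set ts. \<forall>i\<in>{1..n}. snd t i \<in> \<Phi> i" "\<forall>\<xi>\<in>torus n \<rho>. F \<xi> = sum_of_products n ts \<xi>"
    using assms unfolding separable_def by blast
  have "sum_of_products n (map (\<lambda>t. (c * fst t, snd t)) ts) \<xi> = c * sum_of_products n ts \<xi>" for \<xi>
    by (induction ts) (auto simp: sum_of_products_def algebra_simps)
  then show ?thesis unfolding separable_def
    by (intro exI[of _ "map (\<lambda>t. (c * fst t, snd t)) ts"]) (use * in auto)
qed

lemma continuous_mult:
  assumes "torus_continuous n \<rho> F" "torus_continuous n \<rho> G"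
  shows "torus_continuous n \<rho> (\<lambda>\<xi>. F \<xi> * G \<xi>)"
  using assms by (rule separable_mult) (auto intro: continuous_on_mult)

lemma continuous_power:
  assumes "torus_continuous n \<rho> F"
  shows "torus_continuous n \<rho> (\<lambda>\<xi>. F \<xi> ^ k)"
  by (induction k) (auto intro!: continuous_mult assms separable_const)

lemma separable_bounded:
  assumes "torus_continuous n \<rho> F"
  shows "\<exists>B\<ge>0. \<forall>\<xi>\<in>torus n \<rho>. norm (F \<xi>) \<le> B"
proof -
  obtain ts where ts: "\<forall>t\<in>set ts. \<forall>i\<in>{1..n}. continuous_on (sphere 0 \<rho>) (snd t i)"
    "\<forall>\<xi>\<in>torus n \<rho>. F \<xi> = sum_of_products n ts \<xi>"
    using assms unfolding separable_def by auto
  have "\<exists>B\<ge>0. \<forall>\<xi>\<in>torus n \<rho>. norm (sum_of_products n ts \<xi>) \<le> B"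
    using ts(1)
  proof (induction ts)
    case Nil
    then show ?case by (auto simp: sum_of_products_def)
  next
    case (Cons t ts)
    obtain c f where t: "t = (c, f)" by (cases t)
    obtain B where B: "B \<ge> 0" "\<forall>\<xi>\<in>torus n \<rho>. norm (sum_of_products n ts \<xi>) \<le> B"
      using Cons by auto
    have "\<exists>C. \<forall>z\<in>sphere 0 \<rho>. norm (f i z) \<le> C" if "i \<in> {1..n}" for i
    proof -
      have "compact (f i ` sphere 0 \<rho>)"
        by (rule compact_continuous_image) (use Cons.prems t that in auto)
      then show ?thesis by (metis bounded_iff compact_imp_bounded imageI)
    qed
    then obtain C where C: "\<And>i z. i \<in> {1..n} \<Longrightarrow> z \<in> sphere 0 \<rho> \<Longrightarrow> norm (f i z) \<le> C i" by metis
    have "norm (sum_of_products n (t # ts) \<xi>) \<le> norm c * (\<Prod>i=1..n. \<bar>C i\<bar>) + B" if "\<xi> \<in> torus n \<rho>" for \<xi>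
    proof -
      have "norm (\<Prod>i=1..n. f i (\<xi> i)) \<le> (\<Prod>i=1..n. \<bar>C i\<bar>)"
        unfolding prod_norm[symmetric]
      proof (rule prod_mono)
        fix i assume i: "i \<in> {1..n}"
        then have "\<xi> i \<in> sphere 0 \<rho>" using that by (simp add: torus_def)
        then show "0 \<le> norm (f i (\<xi> i)) \<and> norm (f i (\<xi> i)) \<le> \<bar>C i\<bar>"
          using C[OF i] by (meson abs_ge_self norm_ge_zero order_trans)
      qed
      then have "norm (c * (\<Prod>i=1..n. f i (\<xi> i))) \<le> norm c * (\<Prod>i=1..n. \<bar>C i\<bar>)"
        by (simp add: norm_mult mult_left_mono)
      moreover have "norm (sum_of_products n ts \<xi>) \<le> B" using B that by auto
      moreover have "sum_of_products n (t # ts) \<xi> = c * (\<Prod>i=1..n. f i (\<xi> i)) + sum_of_products n ts \<xi>"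
        by (simp add: sum_of_products_def t)
      ultimately show ?thesis by (metis add_mono norm_triangle_le)
    qed
    moreover have "norm c * (\<Prod>i=1..n. \<bar>C i\<bar>) + B \<ge> 0" using B by (simp add: prod_nonneg)
    ultimately show ?case by blast
  qed
  then show ?thesis using ts(2) by auto
qed

subsection \<open>Evaluation\<close>

lemma has_contour_integral_sum_list:
  assumes "\<And>t. t \<in> set ts \<Longrightarrow> (F t has_contour_integral I t) g"
  shows "((\<lambda>z. \<Sum>t\<leftarrow>ts. F t z) has_contour_integral (\<Sum>t\<leftarrow>ts. I t)) g"
  using assms by (induction ts) (auto intro: has_contour_integral_add has_contour_integral_0)

lemma circ_integrable:
  assumes "\<rho> > 0" "continuous_on (sphere 0 \<rho>) f"
  shows "(f has_contour_integral circ_integral \<rho> f) (circlepath 0 \<rho>)"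
  by (intro has_contour_integral_integral contour_integrable_continuous_circlepath) (use assms in auto)

lemma sum_of_products_slice:
  assumes "\<forall>\<xi>\<in>torus (Suc n) \<rho>. F \<xi> = sum_of_products (Suc n) ts \<xi>" "norm z = \<rho>" "\<xi> \<in> torus n \<rho>"
  shows "F (\<xi>(Suc n := z)) = sum_of_products n (map (\<lambda>t. (fst t * snd t (Suc n) z, snd t)) ts) \<xi>"
proof -
  have "(\<Prod>i=1..n. f i ((\<xi>(Suc n := z)) i)) = (\<Prod>i=1..n. f i (\<xi> i))" for f :: "nat \<Rightarrow> complex \<Rightarrow> complex"
    by (rule prod.cong) auto
  moreover have "F (\<xi>(Suc n := z)) = sum_of_products (Suc n) ts (\<xi>(Suc n := z))"
    using assms(1) torus_Suc[OF assms(3,2)] by blast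
  ultimately show ?thesis by (simp add: sum_of_products_def o_def mult_ac)
qed

text \<open>
  The integral of a product is the product of the integrals, by evaluating from the inside. Hence one
  vanishing factor suffices, whatever the place of its variable in the order of integration.
\<close>

lemma torus_integral_products:
  assumes "\<rho> > 0" "\<forall>t\<in>set ts. \<forall>i\<in>{1..n}. continuous_on (sphere 0 \<rho>) (snd t i)"
    "\<forall>\<xi>\<in>torus n \<rho>. F \<xi> = sum_of_products n ts \<xi>"
  shows "torus_integral n \<rho> F = (\<Sum>t\<leftarrow>ts. fst t * (\<Prod>i=1..n. circ_integral \<rho> (snd t i)))"
  using assms(2,3)
proof (induction n arbitrary: F ts)
  case 0
  have "(\<lambda>_. 0) \<in> torus 0 \<rho>" by (simp add: torus_def)
  then show ?case using 0 by (simp add: sum_of_products_def)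
next
  case (Suc n)
  let ?c = "\<lambda>t. fst t * (\<Prod>i=1..n. circ_integral \<rho> (snd t i))"
  have slice: "torus_integral n \<rho> (\<lambda>\<xi>. F (\<xi>(Suc n := z))) = (\<Sum>t\<leftarrow>ts. ?c t * snd t (Suc n) z)" if z: "norm z = \<rho>" for z
  proof -
    define ts' where "ts' = map (\<lambda>t. (fst t * snd t (Suc n) z, snd t)) ts"
    have "\<forall>t\<in>set ts'. \<forall>i\<in>{1..n}. continuous_on (sphere 0 \<rho>) (snd t i)"
      using Suc.prems(1) by (auto simp: ts'_def)
    then have "torus_integral n \<rho> (\<lambda>\<xi>. F (\<xi>(Suc n := z))) = (\<Sum>t\<leftarrow>ts'. ?c t)"
      using sum_of_products_slice[OF Suc.prems(2) z] unfolding ts'_def by (intro Suc.IH) blast+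
    then show ?thesis by (simp add: ts'_def o_def mult_ac)
  qed
  have "((\<lambda>z. \<Sum>t\<leftarrow>ts. ?c t * snd t (Suc n) z) has_contour_integral
     (\<Sum>t\<leftarrow>ts. ?c t * circ_integral \<rho> (snd t (Suc n)))) (circlepath 0 \<rho>)"
    by (intro has_contour_integral_sum_list has_contour_integral_lmul circ_integrable assms(1))
       (use Suc.prems(1) in auto)
  then have "torus_integral (Suc n) \<rho> F = (\<Sum>t\<leftarrow>ts. ?c t * circ_integral \<rho> (snd t (Suc n)))"
    by (auto intro!: contour_integral_unique has_contour_integral_eq[OF _ slice[symmetric]] simp: \<open>\<rho> > 0\<close> less_imp_le)
  then show ?case by (simp add: mult_ac)
qed

lemma torus_integral_cong:
  assumes "\<rho> > 0" "\<And>\<xi>. \<xi> \<in> torus n \<rho> \<Longrightarrow> F \<xi> = G \<xi>"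
  shows "torus_integral n \<rho> F = torus_integral n \<rho> G"
  using assms(2)
proof (induction n arbitrary: F G)
  case 0
  have "(\<lambda>_. 0) \<in> torus 0 \<rho>" by (simp add: torus_def)
  then show ?case using 0 by simp
next
  case (Suc n)
  have "torus_integral n \<rho> (\<lambda>\<xi>. F (\<xi>(Suc n := z))) = torus_integral n \<rho> (\<lambda>\<xi>. G (\<xi>(Suc n := z)))"
    if "norm z = \<rho>" for z
    by (rule Suc.IH) (rule Suc.prems, rule torus_Suc[OF _ that])
  then show ?case by (auto intro!: contour_integral_cong simp: \<open>\<rho> > 0\<close> less_imp_le)
qed

lemma torus_integral_add:
  assumes "\<rho> > 0" "torus_continuous n \<rho> F" "torus_continuous n \<rho> G"
  shows "torus_integral n \<rho> (\<lambda>\<xi>. F \<xi> + G \<xi>) = torus_integral n \<rho> F + torus_integral n \<rho> G"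
proof -
  obtain ts us where *: "\<forall>t\<in>set ts. \<forall>i\<in>{1..n}. continuous_on (sphere 0 \<rho>) (snd t i)"
    "\<forall>\<xi>\<in>torus n \<rho>. F \<xi> = sum_of_products n ts \<xi>"
    "\<forall>t\<in>set us. \<forall>i\<in>{1..n}. continuous_on (sphere 0 \<rho>) (snd t i)"
    "\<forall>\<xi>\<in>torus n \<rho>. G \<xi> = sum_of_products n us \<xi>"
    using assms(2,3) unfolding separable_def by auto
  have "torus_integral n \<rho> (\<lambda>\<xi>. F \<xi> + G \<xi>) = (\<Sum>t\<leftarrow>ts @ us. fst t * (\<Prod>i=1..n. circ_integral \<rho> (snd t i)))"
    by (rule torus_integral_products) (use * assms(1) in \<open>auto simp: sum_of_products_def\<close>)
  then show ?thesis
    by (simp add: torus_integral_products[OF assms(1) *(1,2)] torus_integral_products[OF assms(1) *(3,4)])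
qed

lemma torus_integral_cmult:
  assumes "\<rho> > 0" "torus_continuous n \<rho> F"
  shows "torus_integral n \<rho> (\<lambda>\<xi>. c * F \<xi>) = c * torus_integral n \<rho> F"
proof -
  obtain ts where *: "\<forall>t\<in>set ts. \<forall>i\<in>{1..n}. continuous_on (sphere 0 \<rho>) (snd t i)"
    "\<forall>\<xi>\<in>torus n \<rho>. F \<xi> = sum_of_products n ts \<xi>"
    using assms(2) unfolding separable_def by auto
  have "torus_integral n \<rho> (\<lambda>\<xi>. c * F \<xi>) =
      (\<Sum>t\<leftarrow>map (\<lambda>t. (c * fst t, snd t)) ts. fst t * (\<Prod>i=1..n. circ_integral \<rho> (snd t i)))"
    by (rule torus_integral_products)
       (use * assms(1) in \<open>auto simp: sum_of_products_def sum_list_const_mult[symmetric] o_def mult.assoc\<close>)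
  then show ?thesis
    by (simp add: torus_integral_products[OF assms(1) *] sum_list_const_mult[symmetric] o_def mult.assoc)
qed

lemma torus_integral_zero [simp]: "torus_integral n \<rho> (\<lambda>\<xi>. 0) = 0"
  by (induction n) auto

lemma torus_integral_sum:
  assumes "\<rho> > 0" "\<And>a. a \<in> A \<Longrightarrow> torus_continuous n \<rho> (F a)"
  shows "torus_integral n \<rho> (\<lambda>\<xi>. \<Sum>a\<in>A. F a \<xi>) = (\<Sum>a\<in>A. torus_integral n \<rho> (F a))"
  using assms(2)
  by (induction A rule: infinite_finite_induct)
     (auto simp: torus_integral_add[OF assms(1)] separable_sum)

lemma torus_integral_eq_0:
  assumes "\<rho> > 0" "separable n \<rho> \<Phi> F" "\<And>i. i \<in> {1..n} \<Longrightarrow> \<Phi> i \<subseteq> continuous_functions \<rho> i"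
    "j \<in> {1..n}" "\<And>f. f \<in> \<Phi> j \<Longrightarrow> circ_integral \<rho> f = 0"
  shows "torus_integral n \<rho> F = 0"
proof -
  obtain ts where *: "\<forall>t\<in>set ts. \<forall>i\<in>{1..n}. snd t i \<in> \<Phi> i" "\<forall>\<xi>\<in>torus n \<rho>. F \<xi> = sum_of_products n ts \<xi>"
    using assms(2) unfolding separable_def by blast
  have "(\<Prod>i=1..n. circ_integral \<rho> (snd t i)) = 0" if "t \<in> set ts" for t
  proof -
    have "circ_integral \<rho> (snd t j) = 0" using * that assms(4,5) by blast
    then show ?thesis using assms(4) by (intro prod_zero) auto
  qed
  then have "(\<Sum>t\<leftarrow>ts. fst t * (\<Prod>i=1..n. circ_integral \<rho> (snd t i))) = (\<Sum>_\<leftarrow>ts. 0)"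
    by (intro arg_cong[where f = sum_list] map_cong) auto
  moreover have "torus_integral n \<rho> F = (\<Sum>t\<leftarrow>ts. fst t * (\<Prod>i=1..n. circ_integral \<rho> (snd t i)))"
    by (rule torus_integral_products) (use * assms(1,3) in blast)+
  ultimately show ?thesis by simp
qed

lemma torus_integral_bound:
  assumes "\<rho> > 0" "torus_continuous n \<rho> F" "B \<ge> 0"
    "\<And>\<xi>. \<xi> \<in> torus n \<rho> \<Longrightarrow> norm (F \<xi>) \<le> B"
  shows "norm (torus_integral n \<rho> F) \<le> B * (2 * pi * \<rho>) ^ n"
  using assms(2,4)
proof (induction n arbitrary: F)
  case 0
  have "(\<lambda>_. 0) \<in> torus 0 \<rho>" by (simp add: torus_def)
  then show ?case using 0 by simp
next
  case (Suc n)
  obtain ts where ts: "\<forall>t\<in>set ts. \<forall>i\<in>{1..Suc n}. continuous_on (sphere 0 \<rho>) (snd t i)"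
    "\<forall>\<xi>\<in>torus (Suc n) \<rho>. F \<xi> = sum_of_products (Suc n) ts \<xi>"
    using Suc.prems(1) unfolding separable_def by auto
  define h where "h = (\<lambda>z. torus_integral n \<rho> (\<lambda>\<xi>. F (\<xi>(Suc n := z))))"
  have "torus_continuous n \<rho> (\<lambda>\<xi>. F (\<xi>(Suc n := z))) \<and>
    h z = (\<Sum>t\<leftarrow>ts. fst t * snd t (Suc n) z * (\<Prod>i=1..n. circ_integral \<rho> (snd t i)))"
    if z: "norm z = \<rho>" for z
  proof -
    define ts' where "ts' = map (\<lambda>t. (fst t * snd t (Suc n) z, snd t)) ts"
    have 1: "\<forall>\<xi>\<in>torus n \<rho>. F (\<xi>(Suc n := z)) = sum_of_products n ts' \<xi>"
      using sum_of_products_slice[OF ts(2) z] unfolding ts'_def by blast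
    have 2: "\<forall>t\<in>set ts'. \<forall>i\<in>{1..n}. continuous_on (sphere 0 \<rho>) (snd t i)"
      using ts(1) by (auto simp: ts'_def)
    have "h z = (\<Sum>t\<leftarrow>ts'. fst t * (\<Prod>i=1..n. circ_integral \<rho> (snd t i)))"
      unfolding h_def by (rule torus_integral_products) (use assms(1) 1 2 in blast)+
    moreover have "torus_continuous n \<rho> (\<lambda>\<xi>. F (\<xi>(Suc n := z)))"
      unfolding separable_def by (rule exI[of _ ts']) (use 1 2 in simp)
    ultimately show ?thesis by (simp add: ts'_def o_def)
  qed
  note slice = this
  have "continuous_on (sphere 0 \<rho>) (\<lambda>z. \<Sum>t\<leftarrow>ts'. fst t * snd t (Suc n) z * (\<Prod>i=1..n. circ_integral \<rho> (snd t i)))"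
    if "set ts' \<subseteq> set ts" for ts'
    using that
  proof (induction ts')
    case (Cons t ts')
    then have "continuous_on (sphere 0 \<rho>) (snd t (Suc n))" using ts(1) by auto
    then show ?case using Cons by (auto intro!: continuous_intros)
  qed simp
  then have "continuous_on (sphere 0 \<rho>) h"
    using slice by (subst continuous_on_cong[OF refl]) auto
  then have "(h has_contour_integral circ_integral \<rho> h) (circlepath 0 \<rho>)"
    by (rule circ_integrable[OF assms(1)])
  moreover have "norm (h z) \<le> B * (2 * pi * \<rho>) ^ n" if "norm z = \<rho>" for z
    unfolding h_def
    by (rule Suc.IH) (use slice[OF that] Suc.prems(2) torus_Suc[OF _ that] in blast)+
  ultimately have "norm (circ_integral \<rho> h) \<le> B * (2 * pi * \<rho>) ^ n * (2 * pi * \<rho>)"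
    using assms(1,3) by (intro has_contour_integral_bound_circlepath) auto
  then show ?case by (simp add: h_def mult_ac)
qed

text \<open>Uniform convergence of the exponential series on the torus allows termwise integration.\<close>

lemma torus_integral_exp_sums:
  assumes "\<rho> > 0"
    and F: "torus_continuous n \<rho> F" and E: "torus_continuous n \<rho> E"
    and FE: "torus_continuous n \<rho> (\<lambda>\<xi>. F \<xi> * exp (t * E \<xi>))"
  shows "(\<lambda>k. t ^ k / fact k * torus_integral n \<rho> (\<lambda>\<xi>. F \<xi> * E \<xi> ^ k)) sums
    torus_integral n \<rho> (\<lambda>\<xi>. F \<xi> * exp (t * E \<xi>))"
proof -
  obtain A where A: "A \<ge> 0" "\<forall>\<xi>\<in>torus n \<rho>. norm (F \<xi>) \<le> A" using separable_bounded[OF F] by blast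
  obtain R where R: "R \<ge> 0" "\<forall>\<xi>\<in>torus n \<rho>. norm (t * E \<xi>) \<le> R"
    using separable_bounded[OF separable_cmult[OF E, of t]] by blast
  let ?I = "torus_integral n \<rho> (\<lambda>\<xi>. F \<xi> * exp (t * E \<xi>))"
  define S where "S = (\<lambda>m. \<Sum>k\<le>m. t ^ k / fact k * torus_integral n \<rho> (\<lambda>\<xi>. F \<xi> * E \<xi> ^ k))"
  have summand: "torus_continuous n \<rho> (\<lambda>\<xi>. (- (t ^ k / fact k)) * (F \<xi> * E \<xi> ^ k))" for k
    by (intro separable_cmult continuous_mult F continuous_power E)
  have bound: "norm (?I - S m) \<le> A * (exp R * R ^ Suc m / fact m) * (2 * pi * \<rho>) ^ n" for m
  proof -
    have sum: "torus_continuous n \<rho> (\<lambda>\<xi>. \<Sum>k\<le>m. (- (t ^ k / fact k)) * (F \<xi> * E \<xi> ^ k))"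
      by (rule separable_sum) (rule summand)
    have "?I - S m = ?I + (\<Sum>k\<le>m. torus_integral n \<rho> (\<lambda>\<xi>. (- (t ^ k / fact k)) * (F \<xi> * E \<xi> ^ k)))"
      by (subst torus_integral_cmult)
         (auto simp: S_def sum_negf assms(1) intro!: continuous_mult F continuous_power E)
    also have "\<dots> = torus_integral n \<rho> (\<lambda>\<xi>. F \<xi> * exp (t * E \<xi>) + (\<Sum>k\<le>m. (- (t ^ k / fact k)) * (F \<xi> * E \<xi> ^ k)))"
      by (simp only: torus_integral_add[OF assms(1) FE sum] torus_integral_sum[OF assms(1) summand])
    also have "norm \<dots> \<le> A * (exp R * R ^ Suc m / fact m) * (2 * pi * \<rho>) ^ n"
    proof (rule torus_integral_bound)
      show "torus_continuous n \<rho>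
        (\<lambda>\<xi>. F \<xi> * exp (t * E \<xi>) + (\<Sum>k\<le>m. (- (t ^ k / fact k)) * (F \<xi> * E \<xi> ^ k)))"
        by (rule separable_add[OF FE sum])
      fix \<xi> assume \<xi>: "\<xi> \<in> torus n \<rho>"
      have "F \<xi> * exp (t * E \<xi>) + (\<Sum>k\<le>m. (- (t ^ k / fact k)) * (F \<xi> * E \<xi> ^ k)) =
          F \<xi> * (exp (t * E \<xi>) - (\<Sum>k\<le>m. (t * E \<xi>) ^ k / fact k))"
        by (simp add: right_diff_distrib sum_distrib_left sum_negf power_mult_distrib mult_ac)
      moreover have "norm (exp (t * E \<xi>) - (\<Sum>k\<le>m. (t * E \<xi>) ^ k / fact k)) \<le>
          exp \<bar>Re (t * E \<xi>)\<bar> * norm (t * E \<xi>) ^ Suc m / fact m"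
        by (rule Taylor_exp)
      moreover have "exp \<bar>Re (t * E \<xi>)\<bar> * norm (t * E \<xi>) ^ Suc m / fact m \<le> exp R * R ^ Suc m / fact m"
        using R \<xi> abs_Re_le_cmod[of "t * E \<xi>"]
        by (intro divide_right_mono mult_mono power_mono) (auto intro: order_trans)
      ultimately show "norm (F \<xi> * exp (t * E \<xi>) + (\<Sum>k\<le>m. (- (t ^ k / fact k)) * (F \<xi> * E \<xi> ^ k))) \<le>
          A * (exp R * R ^ Suc m / fact m)"
        using A \<xi> by (simp only: norm_mult) (intro mult_mono, auto intro: order_trans)
    qed (use assms(1) A R in auto)
    finally show ?thesis .
  qed
  have "(\<lambda>m. A * (exp R * R ^ Suc m / fact m) * (2 * pi * \<rho>) ^ n) =
      (\<lambda>m. (A * exp R * R * (2 * pi * \<rho>) ^ n) * (R ^ m / fact m))" by (simp add: fun_eq_iff)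
  moreover have "\<dots> \<longlonglongrightarrow> (A * exp R * R * (2 * pi * \<rho>) ^ n) * 0"
    using summable_LIMSEQ_zero[OF summable_exp_generic[of R]]
    by (intro tendsto_mult_left) (simp add: divide_inverse mult.commute)
  ultimately have "(\<lambda>m. A * (exp R * R ^ Suc m / fact m) * (2 * pi * \<rho>) ^ n) \<longlonglongrightarrow> 0" by simp
  then have "(\<lambda>m. ?I - S m) \<longlonglongrightarrow> 0"
    by (rule Lim_null_comparison[rotated]) (use bound in auto)
  then have "S \<longlonglongrightarrow> ?I" using tendsto_diff[OF tendsto_const[of ?I], of "\<lambda>m. ?I - S m" 0] by simp
  then show ?thesis by (simp add: S_def sums_def_le)
qed

section \<open>The amplitudes\<close>

text \<open>
The matrix \<open>T\<^sub>l(\<beta>, \<alpha>)\<close> as an operator on functions of words. All words are admitted, so that the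
relations between these operators become identities of functions.
\<close>

definition R_op ::
  "(nat \<Rightarrow> real) \<Rightarrow> (nat \<Rightarrow> complex) \<Rightarrow> nat \<Rightarrow> nat \<Rightarrow> nat \<Rightarrow>
    ((nat \<Rightarrow> nat) \<Rightarrow> complex) \<Rightarrow> (nat \<Rightarrow> nat) \<Rightarrow> complex" where
  "R_op b \<xi> l \<beta> \<alpha> f = (\<lambda>\<pi>.
     if \<pi> l = \<pi> (Suc l) then S_coeff b \<xi> \<beta> \<alpha> (\<pi> l) * f \<pi>
     else if \<pi> l < \<pi> (Suc l)
       then S_coeff b \<xi> \<beta> \<alpha> (\<pi> l) * f \<pi> + T_coeff b \<xi> \<beta> \<alpha> (\<pi> l) * f (swap_slots l \<pi>)
     else - f \<pi>)"

text \<open>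
The indices \<open>\<beta>\<close> and \<open>\<alpha>\<close> are read off the permutation reached so far, which therefore is part of the state.
\<close>

definition scatter ::
  "(nat \<Rightarrow> real) \<Rightarrow> (nat \<Rightarrow> complex) \<Rightarrow> nat \<Rightarrow>
    (nat \<Rightarrow> nat) \<times> ((nat \<Rightarrow> nat) \<Rightarrow> complex) \<Rightarrow> (nat \<Rightarrow> nat) \<times> ((nat \<Rightarrow> nat) \<Rightarrow> complex)" where
  "scatter b \<xi> l = (\<lambda>(\<sigma>, f). (swap_slots l \<sigma>, R_op b \<xi> l (\<sigma> (Suc l)) (\<sigma> l) f))"

lemma scatter_Pair: "scatter b \<xi> l (\<sigma>, f) = (swap_slots l \<sigma>, R_op b \<xi> l (\<sigma> (Suc l)) (\<sigma> l) f)"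
  by (simp add: scatter_def)

locale nonsingular =
  fixes b :: "nat \<Rightarrow> real" and \<xi> :: "nat \<Rightarrow> complex"
  assumes nonsingular: "1 - complex_of_real (b i) * \<xi> a \<noteq> 0"
begin

definition q :: "nat \<Rightarrow> nat \<Rightarrow> complex" where "q a i = 1 - b i * \<xi> a"

lemma q_nonzero [simp]: "q a i \<noteq> 0"
  unfolding q_def by (rule nonsingular)

lemma S_coeff_q: "S_coeff b \<xi> \<beta> \<alpha> i = - (q \<beta> i / q \<alpha> i)"
  by (simp add: S_coeff_def q_def)

lemma T_coeff_q: "T_coeff b \<xi> \<beta> \<alpha> i = 1 - q \<beta> i / q \<alpha> i"
  using nonsingular[of i \<alpha>] by (simp add: T_coeff_def q_def field_simps)

lemma R_op_involution: "R_op b \<xi> l \<alpha> \<beta> (R_op b \<xi> l \<beta> \<alpha> f) = f"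
proof
  fix \<pi> :: "nat \<Rightarrow> nat"
  have "swap_slots l \<pi> l = \<pi> (Suc l)" "swap_slots l \<pi> (Suc l) = \<pi> l"
    by (simp_all add: swap_slots_def)
  then show "R_op b \<xi> l \<alpha> \<beta> (R_op b \<xi> l \<beta> \<alpha> f) \<pi> = f \<pi>"
    by (simp add: R_op_def S_coeff_q T_coeff_q swap_slots_involution field_simps)
qed

lemma R_op_far_commute:
  assumes "Suc l < k"
  shows "R_op b \<xi> k \<delta> \<gamma> (R_op b \<xi> l \<beta> \<alpha> f) = R_op b \<xi> l \<beta> \<alpha> (R_op b \<xi> k \<delta> \<gamma> f)"
proof
  fix \<pi> :: "nat \<Rightarrow> nat"
  have "swap_slots l \<pi> k = \<pi> k" "swap_slots l \<pi> (Suc k) = \<pi> (Suc k)"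
    "swap_slots k \<pi> l = \<pi> l" "swap_slots k \<pi> (Suc l) = \<pi> (Suc l)"
    using assms by (simp_all add: swap_slots_def Transposition.transpose_def)
  moreover have "swap_slots k (swap_slots l \<pi>) = swap_slots l (swap_slots k \<pi>)"
    using assms by (auto simp: swap_slots_def fun_eq_iff Transposition.transpose_def)
  ultimately show "R_op b \<xi> k \<delta> \<gamma> (R_op b \<xi> l \<beta> \<alpha> f) \<pi> = R_op b \<xi> l \<beta> \<alpha> (R_op b \<xi> k \<delta> \<gamma> f) \<pi>"
    by (simp add: R_op_def algebra_simps)
qed

lemma R_op_braid:
  "R_op b \<xi> l \<gamma> \<beta> (R_op b \<xi> (Suc l) \<gamma> \<alpha> (R_op b \<xi> l \<beta> \<alpha> f)) =
   R_op b \<xi> (Suc l) \<beta> \<alpha> (R_op b \<xi> l \<gamma> \<alpha> (R_op b \<xi> (Suc l) \<gamma> \<beta> f))"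
proof
  fix \<pi> :: "nat \<Rightarrow> nat"
  define w :: "nat \<Rightarrow> nat \<Rightarrow> nat \<Rightarrow> nat \<Rightarrow> nat" where "w x y z = \<pi>(l := x, Suc l := y, Suc (Suc l) := z)" for x y z
  have w: "w x y z l = x" "w x y z (Suc l) = y" "w x y z (Suc (Suc l)) = z" for x y z
    by (simp_all add: w_def)
  have s: "swap_slots l (w x y z) = w y x z" "swap_slots (Suc l) (w x y z) = w x z y" for x y z
    by (auto simp: w_def swap_slots_def fun_eq_iff Transposition.transpose_def)
  define x y z where "x = \<pi> l" and "y = \<pi> (Suc l)" and "z = \<pi> (Suc (Suc l))"
  have \<pi>: "\<pi> = w x y z" by (simp add: w_def x_def y_def z_def)
  \<comment> \<open>Two relations suffice: the ratios are multiplicative in the variables, and each \<open>T\<close>-coefficient of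
    species \<open>i\<close> is \<open>b i / q \<alpha> i\<close> times a factor independent of \<open>i\<close>.\<close>
  define u v where "u i = q \<beta> i / q \<alpha> i" and "v i = q \<gamma> i / q \<beta> i" for i
  have "S_coeff b \<xi> \<beta> \<alpha> i = - u i" "T_coeff b \<xi> \<beta> \<alpha> i = 1 - u i"
    "S_coeff b \<xi> \<gamma> \<beta> i = - v i" "T_coeff b \<xi> \<gamma> \<beta> i = 1 - v i"
    "S_coeff b \<xi> \<gamma> \<alpha> i = - (u i * v i)" "T_coeff b \<xi> \<gamma> \<alpha> i = 1 - u i * v i" for i
    by (simp_all add: S_coeff_q T_coeff_q u_def v_def)
  note coeffs = this
  have "1 - u i = b i * (\<xi> \<beta> - \<xi> \<alpha>) / q \<alpha> i" "1 - u i * v i = b i * (\<xi> \<gamma> - \<xi> \<alpha>) / q \<alpha> i" for i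
    using nonsingular[of i \<alpha>] by (simp_all add: u_def v_def divide_simps) (simp_all add: q_def algebra_simps)
  then have "(1 - u i) * (1 - u j * v j) = (1 - u j) * (1 - u i * v i)" for i j
    by (simp only: times_divide_times_eq) (simp only: mult_ac)
  then have key: "u i + u j * v j + u i * u j * v i = u j + u i * v i + u i * u j * v j" for i j
    by (simp add: algebra_simps)
  show "R_op b \<xi> l \<gamma> \<beta> (R_op b \<xi> (Suc l) \<gamma> \<alpha> (R_op b \<xi> l \<beta> \<alpha> f)) \<pi> =
      R_op b \<xi> (Suc l) \<beta> \<alpha> (R_op b \<xi> l \<gamma> \<alpha> (R_op b \<xi> (Suc l) \<gamma> \<beta> f)) \<pi>"
    unfolding \<pi>
    by (cases x y rule: linorder_cases; cases y z rule: linorder_cases; cases x z rule: linorder_cases;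
        simp add: R_op_def w s coeffs algebra_simps;
        ((thin_tac "_ = (_ :: nat)")?, use key[of x y] key[of x z] key[of z y] in Groebner_Basis.algebra)?)
qed

sublocale braid_action "scatter b \<xi>" fst
proof
  show "scatter b \<xi> l (scatter b \<xi> l x) = x" for l x
    by (cases x) (simp add: scatter_def swap_slots_involution, simp add: swap_slots_def R_op_involution)
  show "scatter b \<xi> k (scatter b \<xi> l x) = scatter b \<xi> l (scatter b \<xi> k x)" if "Suc l < k" for l k x
  proof (cases x)
    case (Pair \<sigma> f)
    have "swap_slots l \<sigma> k = \<sigma> k" "swap_slots l \<sigma> (Suc k) = \<sigma> (Suc k)"
      "swap_slots k \<sigma> l = \<sigma> l" "swap_slots k \<sigma> (Suc l) = \<sigma> (Suc l)"
      using that by (simp_all add: swap_slots_def Transposition.transpose_def)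
    moreover have "swap_slots k (swap_slots l \<sigma>) = swap_slots l (swap_slots k \<sigma>)"
      using that by (auto simp: swap_slots_def fun_eq_iff Transposition.transpose_def)
    ultimately show ?thesis by (simp add: Pair scatter_def R_op_far_commute[OF that])
  qed
  show "scatter b \<xi> l (scatter b \<xi> (Suc l) (scatter b \<xi> l x)) =
      scatter b \<xi> (Suc l) (scatter b \<xi> l (scatter b \<xi> (Suc l) x))" for l x
  proof (cases x)
    case (Pair \<sigma> f)
    have "swap_slots l (swap_slots (Suc l) (swap_slots l \<sigma>)) =
        swap_slots (Suc l) (swap_slots l (swap_slots (Suc l) \<sigma>))"
      by (auto simp: swap_slots_def fun_eq_iff Transposition.transpose_def)
    moreover have "swap_slots l \<sigma> l = \<sigma> (Suc l)" "swap_slots l \<sigma> (Suc l) = \<sigma> l"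
      "swap_slots l \<sigma> (Suc (Suc l)) = \<sigma> (Suc (Suc l))" for l \<sigma>
      by (simp_all add: swap_slots_def Transposition.transpose_def)
    moreover have "swap_slots (Suc l) \<sigma> l = \<sigma> l" for \<sigma>
      by (simp add: swap_slots_def Transposition.transpose_def)
    ultimately show ?thesis by (simp add: Pair scatter_def R_op_braid)
  qed
qed (auto simp: scatter_def)

end

definition same_word :: "nat \<Rightarrow> (nat \<Rightarrow> nat) \<Rightarrow> (nat \<Rightarrow> nat) \<Rightarrow> bool" where
  "same_word N \<pi> \<nu> \<longleftrightarrow> (\<forall>i\<in>{1..N}. \<pi> i = \<nu> i)"

text \<open>
The entry of \<open>A\<^sub>\<sigma>\<close> in row \<open>\<pi>\<close> and column \<open>\<nu>\<close>, with \<open>\<pi>\<close> ranging over all words.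
\<close>

definition amplitude ::
  "nat \<Rightarrow> (nat \<Rightarrow> real) \<Rightarrow> (nat \<Rightarrow> nat) \<Rightarrow> (nat \<Rightarrow> nat) \<Rightarrow> (nat \<Rightarrow> complex) \<Rightarrow> (nat \<Rightarrow> nat) \<Rightarrow> complex" where
  "amplitude N b \<nu> \<sigma> \<xi> =
     snd (fold (scatter b \<xi>) (SOME ls. expresses N ls \<sigma>) (id, \<lambda>\<pi>. if same_word N \<pi> \<nu> then 1 else 0))"

context nonsingular begin

lemma amplitude_eq:
  assumes "expresses N ls \<sigma>"
  shows "amplitude N b \<nu> \<sigma> \<xi> = snd (fold (scatter b \<xi>) ls (id, \<lambda>\<pi>. if same_word N \<pi> \<nu> then 1 else 0))"
proof -
  have "expresses N (SOME ls. expresses N ls \<sigma>) \<sigma>" using assms by (rule someI)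
  then show ?thesis unfolding amplitude_def
    using assms by (subst fold_eq_if_same_permutation[of _ N ls]) (auto simp: expresses_def)
qed

text \<open>
Appending \<open>l\<close> to an expression of \<open>\<sigma>\<close> gives an expression of \<open>swap_slots l \<sigma>\<close>, hardly ever the chosen one.
This is where independence of the expression is needed.
\<close>

lemma amplitude_swap:
  assumes "\<sigma> permutes {1..N}" "l \<in> {1..<N}"
  shows "amplitude N b \<nu> (swap_slots l \<sigma>) \<xi> = R_op b \<xi> l (\<sigma> (Suc l)) (\<sigma> l) (amplitude N b \<nu> \<sigma> \<xi>)"
proof -
  obtain ls where ls: "expresses N ls \<sigma>" using permutes_expressible[OF assms(1)] by blast
  then have "expresses N (ls @ [l]) (swap_slots l \<sigma>)" using assms(2) by (auto simp: expresses_def)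
  moreover have "fst (fold (scatter b \<xi>) ls (id, f)) = \<sigma>" for f
    using ls by (simp add: perm_fold expresses_def)
  ultimately show ?thesis
    by (simp add: amplitude_eq[OF ls] amplitude_eq scatter_def case_prod_beta)
qed

end

section \<open>Integrals of the amplitudes\<close>

definition disc_functions :: "real \<Rightarrow> (complex \<Rightarrow> complex) set" where
  "disc_functions \<rho> = {f. continuous_on (cball 0 \<rho>) f \<and> f holomorphic_on ball 0 \<rho>}"

text \<open>
A letter \<open>m\<close> that only moves to the left enters the coefficients only through numerators \<open>\<xi> \<beta>\<close>, so the
dependence on its variable is polynomial. The poles in the other variables lie outside the disc.
\<close>

definition amplitude_functions :: "real \<Rightarrow> nat \<Rightarrow> nat \<Rightarrow> nat \<Rightarrow> (complex \<Rightarrow> complex) set" where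
  "amplitude_functions \<rho> d m = (\<lambda>j. if j = m then {f. \<exists>p. degree p \<le> d \<and> f = poly p} else disc_functions \<rho>)"

lemma poly_disc_functions: "poly p \<in> disc_functions \<rho>"
  by (auto simp: disc_functions_def intro!: continuous_intros holomorphic_intros)

lemma disc_functions_mult: "f \<in> disc_functions \<rho> \<Longrightarrow> g \<in> disc_functions \<rho> \<Longrightarrow> (\<lambda>z. f z * g z) \<in> disc_functions \<rho>"
  by (auto simp: disc_functions_def intro!: continuous_intros holomorphic_intros)

lemma disc_functions_one: "(\<lambda>z. 1) \<in> disc_functions \<rho>"
  by (auto simp: disc_functions_def)

lemma disc_functions_power: "(\<lambda>z. z ^ k) \<in> disc_functions \<rho>"
  by (auto simp: disc_functions_def intro!: continuous_intros holomorphic_intros)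

lemma disc_functions_linear: "(\<lambda>z. 1 - c * z) \<in> disc_functions \<rho>"
  by (auto simp: disc_functions_def intro!: continuous_intros holomorphic_intros)

lemma amplitude_functions_disc: "amplitude_functions \<rho> d m j \<subseteq> disc_functions \<rho>"
  by (auto simp: amplitude_functions_def poly_disc_functions)

lemma disc_functions_continuous: "disc_functions \<rho> \<subseteq> continuous_functions \<rho> j"
  by (auto simp: disc_functions_def elim: continuous_on_subset)

lemma amplitude_functions_one: "(\<lambda>z. 1) \<in> amplitude_functions \<rho> d m j"
  by (auto simp: amplitude_functions_def disc_functions_one intro!: exI[of _ 1])

lemma amplitude_functions_mono: "d \<le> e \<Longrightarrow> amplitude_functions \<rho> d m j \<subseteq> amplitude_functions \<rho> e m j"
  by (auto simp: amplitude_functions_def intro: order_trans)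

lemma circ_integral_disc:
  assumes "\<rho> > 0" "f \<in> disc_functions \<rho>"
  shows "circ_integral \<rho> f = 0"
proof -
  have "((\<lambda>u. (f u * u) / (u - 0)) has_contour_integral (2 * of_real pi * \<i> * (f 0 * 0))) (circlepath 0 \<rho>)"
    by (rule Cauchy_integral_circlepath)
       (use assms in \<open>auto simp: disc_functions_def intro!: continuous_intros holomorphic_intros\<close>)
  then have "((\<lambda>u. (f u * u) / (u - 0)) has_contour_integral 0) (circlepath 0 \<rho>)" by simp
  then have "(f has_contour_integral 0) (circlepath 0 \<rho>)"
    by (rule has_contour_integral_eq) (use assms(1) in auto)
  then show ?thesis by (rule contour_integral_unique)
qed

lemma circ_integral_powi:
  assumes "\<rho> > 0"
  shows "circ_integral \<rho> (\<lambda>z. z powi k) = (if k = - 1 then 2 * of_real pi * \<i> else 0)"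
proof (cases "k \<ge> 0")
  case True
  then have "(\<lambda>z::complex. z powi k) = (\<lambda>z. z ^ nat k)" by (simp add: power_int_def)
  then show ?thesis using True circ_integral_disc[OF assms disc_functions_power[of "nat k"]] by simp
next
  case False
  define n where "n = nat (- k) - 1"
  have k: "k = - int (Suc n)" using False by (simp add: n_def)
  have "((\<lambda>u. 1 / (u - 0) ^ Suc n) has_contour_integral
      (2 * pi * \<i> / fact n * (deriv ^^ n) (\<lambda>z. 1) 0)) (circlepath 0 \<rho>)"
    by (rule Cauchy_has_contour_integral_higher_derivative_circlepath) (use assms in auto)
  moreover have "(deriv ^^ n) (\<lambda>z. 1) (0::complex) = (if n = 0 then 1 else 0)" by simp
  moreover have "(\<lambda>u::complex. 1 / (u - 0) ^ Suc n) = (\<lambda>u. u powi k)"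
    by (simp add: k power_int_minus fun_eq_iff inverse_eq_divide del: power_Suc of_nat_Suc)
  ultimately show ?thesis by (auto simp: k dest!: contour_integral_unique)
qed

lemma continuous_powi: "\<rho> > 0 \<Longrightarrow> continuous_on (sphere 0 \<rho>) (\<lambda>z::complex. z powi k)"
  by (intro continuous_intros) auto

lemma circ_integral_poly_powi:
  assumes "\<rho> > 0" "int (degree p) + k < - 1"
  shows "circ_integral \<rho> (\<lambda>z. z powi k * poly p z) = 0"
proof -
  have "circ_integral \<rho> (\<lambda>z. z powi k * poly p z) =
      circ_integral \<rho> (\<lambda>z. \<Sum>i\<le>degree p. coeff p i * z powi (k + int i))"
  proof (rule contour_integral_cong)
    fix z assume "z \<in> path_image (circlepath 0 \<rho>)"
    then have "z \<noteq> 0" using assms(1) by auto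
    then show "z powi k * poly p z = (\<Sum>i\<le>degree p. coeff p i * z powi (k + int i))"
      by (simp add: poly_altdef sum_distrib_left power_int_add mult_ac)
  qed simp
  also have "\<dots> = (\<Sum>i\<le>degree p. coeff p i * circ_integral \<rho> (\<lambda>z. z powi (k + int i)))"
    by (intro contour_integral_unique has_contour_integral_sum has_contour_integral_lmul circ_integrable
        continuous_powi assms(1)) auto
  also have "\<dots> = 0"
    using assms by (intro sum.neutral) (auto simp: circ_integral_powi)
  finally show ?thesis .
qed

lemma separable_mult_coordinate:
  assumes "separable n \<rho> \<Phi> F" "j \<in> {1..n}" "\<And>f. f \<in> \<Phi> j \<Longrightarrow> (\<lambda>z. h z * f z) \<in> \<Theta> j"
    "\<And>i. i \<in> {1..n} \<Longrightarrow> i \<noteq> j \<Longrightarrow> \<Phi> i \<subseteq> \<Theta> i"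
  shows "separable n \<rho> \<Theta> (\<lambda>\<xi>. h (\<xi> j) * F \<xi>)"
proof (rule separable_mult[OF _ assms(1)])
  show "separable n \<rho> (\<lambda>i. if i = j then {h} else {\<lambda>z. 1}) (\<lambda>\<xi>. h (\<xi> j))"
    by (rule separable_coordinate) (use assms(2) in auto)
qed (use assms(3,4) in \<open>auto split: if_splits\<close>)

locale contour =
  fixes N :: nat and b :: "nat \<Rightarrow> real" and \<rho> :: real
  assumes radius: "\<rho> > 0" and small: "\<And>i. \<bar>b i\<bar> * \<rho> < 1"
begin

lemma no_pole: "norm z \<le> \<rho> \<Longrightarrow> 1 - complex_of_real (b i) * z \<noteq> 0"
proof
  assume z: "norm z \<le> \<rho>" and "1 - complex_of_real (b i) * z = 0"
  then have "\<bar>b i\<bar> * norm z = 1" by (metis eq_iff_diff_eq_0 norm_mult norm_of_real norm_one)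
  moreover have "\<bar>b i\<bar> * norm z \<le> \<bar>b i\<bar> * \<rho>" using z by (intro mult_left_mono) auto
  ultimately show False using small[of i] by simp
qed

lemma torus_nonsingular: "\<xi> \<in> torus N \<rho> \<Longrightarrow> nonsingular b \<xi>"
  by unfold_locales (intro no_pole torus_norm_le radius)

lemma disc_functions_inverse: "(\<lambda>z. 1 / (1 - complex_of_real (b i) * z)) \<in> disc_functions \<rho>"
  using no_pole by (auto simp: disc_functions_def intro!: continuous_intros holomorphic_intros)

text \<open>Multiplication by a coefficient raises the degree in the variable \<open>\<xi> \<beta>\<close> of its numerator only.\<close>

lemma separable_S_coeff:
  assumes F: "separable N \<rho> (amplitude_functions \<rho> d m) F"
    and ab: "\<alpha> \<in> {1..N}" "\<beta> \<in> {1..N}" "\<alpha> \<noteq> m" and e: "e = (if \<beta> = m then Suc d else d)"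
  shows "separable N \<rho> (amplitude_functions \<rho> e m) (\<lambda>\<xi>. S_coeff b \<xi> \<beta> \<alpha> i * F \<xi>)"
proof -
  have 1: "separable N \<rho> (amplitude_functions \<rho> d m) (\<lambda>\<xi>. 1 / (1 - complex_of_real (b i) * \<xi> \<alpha>) * F \<xi>)"
    by (rule separable_mult_coordinate[OF F ab(1), where h = "\<lambda>z. 1 / (1 - complex_of_real (b i) * z)"])
       (use ab disc_functions_mult[OF disc_functions_inverse] in \<open>auto simp: amplitude_functions_def\<close>)
  have "separable N \<rho> (amplitude_functions \<rho> e m)
      (\<lambda>\<xi>. (1 - complex_of_real (b i) * \<xi> \<beta>) * (1 / (1 - complex_of_real (b i) * \<xi> \<alpha>) * F \<xi>))"
  proof (rule separable_mult_coordinate[OF 1 ab(2), where h = "\<lambda>z. 1 - complex_of_real (b i) * z"])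
    fix f assume f: "f \<in> amplitude_functions \<rho> d m \<beta>"
    show "(\<lambda>z. (1 - complex_of_real (b i) * z) * f z) \<in> amplitude_functions \<rho> e m \<beta>"
    proof (cases "\<beta> = m")
      case True
      then obtain p where p: "degree p \<le> d" "f = poly p" using f by (auto simp: amplitude_functions_def)
      have "(\<lambda>z. (1 - complex_of_real (b i) * z) * f z) = poly ([:1, - complex_of_real (b i):] * p)"
        by (simp add: p fun_eq_iff algebra_simps)
      moreover have "degree ([:1, - complex_of_real (b i):] * p) \<le> degree [:1, - complex_of_real (b i):] + degree p"
        by (rule degree_mult_le)
      then have "degree ([:1, - complex_of_real (b i):] * p) \<le> Suc d"
        using p(1) degree_pCons_le[of 1 "[:- complex_of_real (b i):]"] by simp
      ultimately show ?thesis using True e unfolding amplitude_functions_def by auto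
    next
      case False
      then show ?thesis using f disc_functions_mult[OF disc_functions_linear]
        by (auto simp: amplitude_functions_def)
    qed
  qed (use e in \<open>auto simp: amplitude_functions_def\<close>)
  from separable_cmult[OF this, of "- 1"] show ?thesis
    by (simp add: S_coeff_def)
qed

lemma separable_R_op:
  assumes F: "\<And>\<pi>. separable N \<rho> (amplitude_functions \<rho> d m) (\<lambda>\<xi>. f \<xi> \<pi>)"
    and ab: "\<alpha> \<in> {1..N}" "\<beta> \<in> {1..N}" "\<alpha> \<noteq> m" and e: "e = (if \<beta> = m then Suc d else d)"
  shows "separable N \<rho> (amplitude_functions \<rho> e m) (\<lambda>\<xi>. R_op b \<xi> l \<beta> \<alpha> (f \<xi>) \<pi>)"
proof -
  have S: "separable N \<rho> (amplitude_functions \<rho> e m) (\<lambda>\<xi>. S_coeff b \<xi> \<beta> \<alpha> i * f \<xi> \<pi>)" for i \<pi>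
    by (rule separable_S_coeff[OF F ab e])
  have F': "separable N \<rho> (amplitude_functions \<rho> e m) (\<lambda>\<xi>. f \<xi> \<pi>)" for \<pi>
    by (rule separable_mono[OF F]) (use e amplitude_functions_mono in auto)
  have T: "separable N \<rho> (amplitude_functions \<rho> e m) (\<lambda>\<xi>. T_coeff b \<xi> \<beta> \<alpha> i * f \<xi> \<pi>)" for i \<pi>
  proof (subst separable_cong)
    fix \<xi> assume "\<xi> \<in> torus N \<rho>"
    then interpret nonsingular b \<xi> by (rule torus_nonsingular)
    show "T_coeff b \<xi> \<beta> \<alpha> i * f \<xi> \<pi> = f \<xi> \<pi> + S_coeff b \<xi> \<beta> \<alpha> i * f \<xi> \<pi>"
      by (simp add: S_coeff_q T_coeff_q algebra_simps)
  qed (intro separable_add F' S)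
  show ?thesis
    using separable_cmult[OF F'[of \<pi>], of "- 1"] S T separable_add[OF S T]
    by (cases "\<pi> l = \<pi> (Suc l)"; cases "\<pi> l < \<pi> (Suc l)") (simp_all add: R_op_def)
qed

lemma separable_fold_scatter:
  assumes "\<sigma> permutes {1..N}" "\<sigma> m = m" "set ls \<subseteq> {1..<N}" "\<forall>l\<in>set ls. l \<noteq> m \<and> Suc l \<noteq> m"
    and "\<And>\<pi>. separable N \<rho> (amplitude_functions \<rho> d m) (\<lambda>\<xi>. f \<xi> \<pi>)"
  shows "separable N \<rho> (amplitude_functions \<rho> d m) (\<lambda>\<xi>. snd (fold (scatter b \<xi>) ls (\<sigma>, f \<xi>)) \<pi>)"
  using assms
proof (induction ls arbitrary: \<sigma> f \<pi>)
  case (Cons l ls)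
  have l: "l \<in> {1..N}" "Suc l \<in> {1..N}" "l \<noteq> m" "Suc l \<noteq> m" using Cons.prems(3,4) by auto
  have "\<sigma> l \<noteq> m" "\<sigma> (Suc l) \<noteq> m"
    using l(3,4) Cons.prems(1,2) by (metis permutes_inj injD)+
  moreover have "\<sigma> l \<in> {1..N}" "\<sigma> (Suc l) \<in> {1..N}"
    using permutes_in_image[OF Cons.prems(1)] l by auto
  ultimately have R: "separable N \<rho> (amplitude_functions \<rho> d m) (\<lambda>\<xi>. R_op b \<xi> l (\<sigma> (Suc l)) (\<sigma> l) (f \<xi>) \<pi>)" for \<pi>
    by (intro separable_R_op[where d = d] Cons.prems(5)) auto
  have "swap_slots l \<sigma> permutes {1..N}"
    using fold_swap_slots_permutes[of "[l]" N \<sigma>] Cons.prems(1,3) by simp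
  moreover have "swap_slots l \<sigma> m = m"
    using l(3,4) Cons.prems(2) by (simp add: swap_slots_def Transposition.transpose_def)
  ultimately show ?case
    using Cons.IH[of "swap_slots l \<sigma>", OF _ _ _ _ R] Cons.prems(3,4) by (simp add: scatter_Pair)
qed simp

text \<open>
The letter \<open>m\<close> passes \<open>k - i\<close> others, and each time the degree grows by at most one.
\<close>

lemma separable_fold_scatter_run:
  assumes "\<sigma> permutes {1..N}" "\<sigma> k = m" "1 \<le> i" "i \<le> k" "k \<le> N"
    and "\<And>\<pi>. separable N \<rho> (amplitude_functions \<rho> d m) (\<lambda>\<xi>. f \<xi> \<pi>)"
  shows "separable N \<rho> (amplitude_functions \<rho> (d + (k - i)) m) (\<lambda>\<xi>. snd (fold (scatter b \<xi>) (rev [i..<k]) (\<sigma>, f \<xi>)) \<pi>)"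
  using assms
proof (induction k arbitrary: \<sigma> f \<pi> d)
  case (Suc k)
  show ?case
  proof (cases "i = Suc k")
    case False
    then have r: "rev [i..<Suc k] = k # rev [i..<k]" "i \<le> k" using Suc.prems(4) by auto
    have k: "k \<in> {1..N}" "Suc k \<in> {1..N}" using Suc.prems(3,5) r by auto
    have m: "\<sigma> k \<noteq> m" using Suc.prems(1,2) by (metis permutes_inj injD n_not_Suc_n)
    moreover have "\<sigma> k \<in> {1..N}" "\<sigma> (Suc k) \<in> {1..N}"
      using permutes_in_image[OF Suc.prems(1)] k by auto
    ultimately have R: "separable N \<rho> (amplitude_functions \<rho> (Suc d) m) (\<lambda>\<xi>. R_op b \<xi> k (\<sigma> (Suc k)) (\<sigma> k) (f \<xi>) \<pi>)" for \<pi>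
      using Suc.prems(2) by (intro separable_R_op[where d = d] Suc.prems(6)) auto
    have "swap_slots k \<sigma> permutes {1..N}"
      using fold_swap_slots_permutes[of "[k]" N \<sigma>] Suc.prems(1) k by simp
    moreover have "swap_slots k \<sigma> k = m" using Suc.prems(2) by (simp add: swap_slots_def)
    ultimately have "separable N \<rho> (amplitude_functions \<rho> (Suc d + (k - i)) m)
      (\<lambda>\<xi>. snd (fold (scatter b \<xi>) (rev [i..<k]) (swap_slots k \<sigma>, R_op b \<xi> k (\<sigma> (Suc k)) (\<sigma> k) (f \<xi>))) \<pi>)"
      by (rule Suc.IH) (use Suc.prems r R in auto)
    then have "separable N \<rho> (amplitude_functions \<rho> (d + (Suc k - i)) m)
      (\<lambda>\<xi>. snd (fold (scatter b \<xi>) (rev [i..<k]) (swap_slots k \<sigma>, R_op b \<xi> k (\<sigma> (Suc k)) (\<sigma> k) (f \<xi>))) \<pi>)"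
      using r(2) by (simp add: Suc_diff_le)
    then show ?thesis unfolding r(1) by (simp add: scatter_Pair)
  qed (use Suc.prems in simp)
qed simp

lemma separable_amplitude_degree:
  assumes "\<sigma> permutes {1..m}" "\<sigma> i = m" "m \<in> {1..N}"
  shows "separable N \<rho> (amplitude_functions \<rho> (m - i) m) (\<lambda>\<xi>. amplitude N b \<nu> \<sigma> \<xi> \<pi>)"
proof -
  obtain ls where ls: "set ls \<subseteq> {1..<m - 1}" "fold swap_slots (ls @ rev [i..<m]) id = \<sigma>"
    using permutes_expressible_run[OF assms(1,2)] assms(3) by auto
  have i: "1 \<le> i" "i \<le> m" using permutes_in_image[OF assms(1), of i] assms(2,3) by auto
  let ?\<sigma> = "fold swap_slots ls id"
  have lsN: "set ls \<subseteq> {1..<N}" by (rule order.trans[OF ls(1)]) (use assms(3) in auto)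
  then have e: "expresses N (ls @ rev [i..<m]) \<sigma>"
    unfolding expresses_def using ls(2) i assms(3) by auto
  have "l \<noteq> m \<and> Suc l \<noteq> m" if "l \<in> set ls" for l using subsetD[OF ls(1) that] by auto
  then have fixed: "\<forall>l\<in>set ls. l \<noteq> m \<and> Suc l \<noteq> m" by blast
  have p: "?\<sigma> permutes {1..N}" by (rule fold_swap_slots_permutes[OF lsN]) (rule permutes_id)
  have "?\<sigma> m = id m" by (rule fold_swap_slots_fixes) (use fixed in auto)
  then have m: "?\<sigma> m = m" by simp
  define \<delta> :: "(nat \<Rightarrow> nat) \<Rightarrow> complex" where "\<delta> = (\<lambda>\<pi>. if same_word N \<pi> \<nu> then 1 else 0)"
  have "separable N \<rho> (amplitude_functions \<rho> 0 m) (\<lambda>\<xi>. snd (fold (scatter b \<xi>) ls (id, \<delta>)) \<pi>)" for \<pi>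
    by (rule separable_fold_scatter[where f = "\<lambda>_. \<delta>", OF permutes_id _ lsN fixed])
       (auto intro: separable_const amplitude_functions_one)
  then have "separable N \<rho> (amplitude_functions \<rho> (0 + (m - i)) m)
     (\<lambda>\<xi>. snd (fold (scatter b \<xi>) (rev [i..<m]) (?\<sigma>, snd (fold (scatter b \<xi>) ls (id, \<delta>)))) \<pi>)"
    using assms(3) by (intro separable_fold_scatter_run[OF p m i]) auto
  then show ?thesis
  proof (subst separable_cong)
    fix \<xi> assume "\<xi> \<in> torus N \<rho>"
    then interpret nonsingular b \<xi> by (rule torus_nonsingular)
    have "fold (scatter b \<xi>) ls (id, \<delta>) = (?\<sigma>, snd (fold (scatter b \<xi>) ls (id, \<delta>)))"
      by (simp add: prod_eq_iff perm_fold)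
    then show "amplitude N b \<nu> \<sigma> \<xi> \<pi> =
        snd (fold (scatter b \<xi>) (rev [i..<m]) (?\<sigma>, snd (fold (scatter b \<xi>) ls (id, \<delta>)))) \<pi>"
      by (simp add: amplitude_eq[OF e] \<delta>_def[symmetric])
  qed simp
qed

lemma separable_amplitude:
  assumes "\<sigma> permutes {1..N}"
  shows "separable N \<rho> (\<lambda>_. disc_functions \<rho>) (\<lambda>\<xi>. amplitude N b \<nu> \<sigma> \<xi> \<pi>)"
proof (cases "N = 0")
  case True
  have "separable N \<rho> (\<lambda>_. disc_functions \<rho>) (\<lambda>\<xi>. amplitude N b \<nu> \<sigma> (\<lambda>_. 0) \<pi>)"
    by (rule separable_const) (simp add: disc_functions_one)
  then show ?thesis
  proof (subst separable_cong)
    fix \<xi> assume "\<xi> \<in> torus N \<rho>"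
    then have "\<xi> = (\<lambda>_. 0)" using True by (auto simp: torus_def)
    then show "amplitude N b \<nu> \<sigma> \<xi> \<pi> = amplitude N b \<nu> \<sigma> (\<lambda>_. 0) \<pi>" by simp
  qed
next
  case False
  then have "\<sigma> (inv_into UNIV \<sigma> N) = N" "N \<in> {1..N}" using assms by (auto simp: permutes_inverses)
  from separable_amplitude_degree[OF assms this]
  show ?thesis by (rule separable_mono) (rule amplitude_functions_disc)
qed

end

section \<open>The master equation for the integrals\<close>

text \<open>
  The boundary condition on the level of amplitudes: if \<open>f\<close> belongs to a permutation with \<open>\<alpha>\<close>, \<open>\<beta>\<close> in the slots
  \<open>l\<close>, \<open>l + 1\<close>, the left-hand side is the contribution of \<open>f\<close> and of its partner at coinciding positions, and
  the factors \<open>\<xi> \<beta>\<close>, \<open>\<xi> \<alpha>\<close> on the right arise from moving the right particle one step further.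
\<close>

lemma (in nonsingular) R_op_boundary:
  "f \<pi> + R_op b \<xi> l \<beta> \<alpha> f \<pi> =
    (if \<pi> l < \<pi> (Suc l)
     then b (\<pi> l) * (\<xi> \<beta> * (f \<pi> + f (swap_slots l \<pi>)) +
       \<xi> \<alpha> * (R_op b \<xi> l \<beta> \<alpha> f \<pi> + R_op b \<xi> l \<beta> \<alpha> f (swap_slots l \<pi>)))
     else if \<pi> l = \<pi> (Suc l) then b (\<pi> l) * (\<xi> \<beta> * f \<pi> + \<xi> \<alpha> * R_op b \<xi> l \<beta> \<alpha> f \<pi>)
     else 0)"
proof -
  have "swap_slots l \<pi> l = \<pi> (Suc l)" "swap_slots l \<pi> (Suc l) = \<pi> l"
    by (simp_all add: swap_slots_def)
  note swap = this
  have *: "b (\<pi> l) * (\<xi> \<beta> * u + \<xi> \<alpha> * v) = (1 - q \<beta> (\<pi> l)) * u + (1 - q \<alpha> (\<pi> l)) * v" for u v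
    by (simp add: q_def algebra_simps)
  show ?thesis
    unfolding * by (simp add: swap R_op_def S_coeff_q T_coeff_q swap_slots_involution field_simps)
qed

lemma strict_mono_on_gap:
  fixes X :: "nat \<Rightarrow> int"
  assumes "strict_mono_on {1..n} X" "1 \<le> i" "i \<le> m" "m \<le> n"
  shows "X i + int (m - i) \<le> X m"
  using assms(3,4)
proof (induction m rule: dec_induct)
  case (step k)
  then have "X k < X (Suc k)" using assms(1,2) by (intro strict_mono_onD[OF assms(1)]) auto
  then show ?case using step by simp
qed simp

context contour begin

definition plane_wave :: "(nat \<Rightarrow> int) \<Rightarrow> (nat \<Rightarrow> int) \<Rightarrow> (nat \<Rightarrow> nat) \<Rightarrow> (nat \<Rightarrow> complex) \<Rightarrow> complex" where
  "plane_wave Y X \<sigma> \<xi> = (\<Prod>i=1..N. \<xi> (\<sigma> i) powi (X i - Y (\<sigma> i) - 1))"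

abbreviation bethe_wave where
  "bethe_wave \<nu> Y X \<pi> \<sigma> \<xi> \<equiv> plane_wave Y X \<sigma> \<xi> * amplitude N b \<nu> \<sigma> \<xi> \<pi>"

definition energy :: "(nat \<Rightarrow> complex) \<Rightarrow> complex" where
  "energy \<xi> = (\<Sum>i=1..N. 1 / \<xi> i)"

text \<open>
Up to factors that do not involve \<open>\<xi>\<close>, the coefficient of \<open>t ^ n / fact n\<close> in the sum of integrals.
The positions \<open>X\<close> may be arbitrary integers here, even coinciding ones.
\<close>

definition moment :: "(nat \<Rightarrow> nat) \<Rightarrow> (nat \<Rightarrow> int) \<Rightarrow> nat \<Rightarrow> (nat \<Rightarrow> int) \<Rightarrow> (nat \<Rightarrow> nat) \<Rightarrow> complex" where
  "moment \<nu> Y n X \<pi> = (\<Sum>\<sigma> | \<sigma> permutes {1..N}.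
     torus_integral N \<rho> (\<lambda>\<xi>. bethe_wave \<nu> Y X \<pi> \<sigma> \<xi> * energy \<xi> ^ n))"

lemma plane_wave_by_variable:
  assumes "\<sigma> permutes {1..N}"
  shows "plane_wave Y X \<sigma> \<xi> = (\<Prod>j=1..N. \<xi> j powi (X (inv_into UNIV \<sigma> j) - Y j - 1))"
  unfolding plane_wave_def
  by (subst prod.permute[OF assms, of "\<lambda>j. \<xi> j powi (X (inv_into UNIV \<sigma> j) - Y j - 1)"])
     (simp add: o_def permutes_inverses[OF assms])

lemma energy_permuted: "\<sigma> permutes {1..N} \<Longrightarrow> energy \<xi> = (\<Sum>i=1..N. 1 / \<xi> (\<sigma> i))"
  unfolding energy_def by (subst sum.permute[of \<sigma>]) (auto simp: o_def)

lemma torus_continuous_coordinate: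
  "j \<in> {1..N} \<Longrightarrow> continuous_on (sphere 0 \<rho>) f \<Longrightarrow> torus_continuous N \<rho> (\<lambda>\<xi>. f (\<xi> j))"
  by (rule separable_coordinate) auto

lemma torus_continuous_plane_wave:
  assumes "\<sigma> permutes {1..N}"
  shows "torus_continuous N \<rho> (plane_wave Y X \<sigma>)"
  unfolding ext[of "plane_wave Y X \<sigma>", OF plane_wave_by_variable[OF assms]]
  by (rule separable_single[where f = "\<lambda>j z. z powi (X (inv_into UNIV \<sigma> j) - Y j - 1)"])
     (simp add: continuous_powi radius)

lemma torus_continuous_energy: "torus_continuous N \<rho> energy"
  unfolding energy_def[abs_def]
  by (intro separable_sum torus_continuous_coordinate[where f = "\<lambda>z. 1 / z"] continuous_intros)
     (use radius in auto)

lemma torus_continuous_exp_energy: "torus_continuous N \<rho> (\<lambda>\<xi>. exp (c * energy \<xi>))"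
proof -
  have "(\<lambda>\<xi>. exp (c * energy \<xi>)) = (\<lambda>\<xi>. \<Prod>i=1..N. exp (c * (1 / \<xi> i)))"
    by (simp add: energy_def sum_distrib_left exp_sum)
  moreover have "continuous_on (sphere 0 \<rho>) (\<lambda>z. exp (c * (1 / z)))"
    by (intro continuous_intros) (use radius in auto)
  ultimately show ?thesis
    using separable_single[of N "\<lambda>i z. exp (c * (1 / z))" "continuous_functions \<rho>" \<rho>] by simp
qed

lemma torus_continuous_amplitude:
  "\<sigma> permutes {1..N} \<Longrightarrow> torus_continuous N \<rho> (\<lambda>\<xi>. amplitude N b \<nu> \<sigma> \<xi> \<pi>)"
  by (rule separable_mono[OF separable_amplitude]) (auto simp: disc_functions_def elim: continuous_on_subset)

lemma torus_continuous_wave_amplitude: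
  "\<sigma> permutes {1..N} \<Longrightarrow> torus_continuous N \<rho> (\<lambda>\<xi>. bethe_wave \<nu> Y X \<pi> \<sigma> \<xi>)"
  by (intro continuous_mult torus_continuous_plane_wave torus_continuous_amplitude)

lemma torus_continuous_integrand:
  "\<sigma> permutes {1..N} \<Longrightarrow>
    torus_continuous N \<rho> (\<lambda>\<xi>. bethe_wave \<nu> Y X \<pi> \<sigma> \<xi> * energy \<xi> ^ n)"
  by (intro continuous_mult[OF torus_continuous_wave_amplitude] continuous_power torus_continuous_energy)

subsection \<open>Time evolution\<close>

lemma plane_wave_shift:
  assumes "i \<in> {1..N}" "\<sigma> permutes {1..N}" "\<xi> \<in> torus N \<rho>"
  shows "plane_wave Y (X(i := X i + k)) \<sigma> \<xi> = plane_wave Y X \<sigma> \<xi> * \<xi> (\<sigma> i) powi k"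
proof -
  have nz: "\<xi> (\<sigma> i) \<noteq> 0"
    using torus_nonzero[OF assms(3) radius] permutes_in_image[OF assms(2)] assms(1) by blast
  have "plane_wave Y (X(i := X i + k)) \<sigma> \<xi> =
      \<xi> (\<sigma> i) powi (X i - Y (\<sigma> i) - 1 + k) * (\<Prod>j\<in>{1..N} - {i}. \<xi> (\<sigma> j) powi (X j - Y (\<sigma> j) - 1))"
    unfolding plane_wave_def using assms(1)
    by (subst prod.remove[of _ i]) (auto intro!: prod.cong arg_cong2[where f = "(*)"] arg_cong2[where f = "(powi)"])
  also have "\<dots> = plane_wave Y X \<sigma> \<xi> * \<xi> (\<sigma> i) powi k"
    unfolding plane_wave_def using assms(1) nz
    by (subst (2) prod.remove[of _ i]) (auto simp: power_int_add)
  finally show ?thesis .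
qed

text \<open>
The energy is a symmetric function of the variables, and \<open>1 / \<xi> (\<sigma> i)\<close> lowers the position in slot \<open>i\<close> by one.
\<close>

lemma moment_Suc: "moment \<nu> Y (Suc n) X \<pi> = (\<Sum>i=1..N. moment \<nu> Y n (X(i := X i - 1)) \<pi>)"
proof -
  have "torus_integral N \<rho> (\<lambda>\<xi>. bethe_wave \<nu> Y X \<pi> \<sigma> \<xi> * energy \<xi> ^ Suc n) =
      (\<Sum>i=1..N. torus_integral N \<rho>
        (\<lambda>\<xi>. bethe_wave \<nu> Y (X(i := X i - 1)) \<pi> \<sigma> \<xi> * energy \<xi> ^ n))"
    if p: "\<sigma> permutes {1..N}" for \<sigma>
  proof -
    have "torus_integral N \<rho> (\<lambda>\<xi>. bethe_wave \<nu> Y X \<pi> \<sigma> \<xi> * energy \<xi> ^ Suc n) =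
      torus_integral N \<rho> (\<lambda>\<xi>. \<Sum>i=1..N.
        bethe_wave \<nu> Y (X(i := X i - 1)) \<pi> \<sigma> \<xi> * energy \<xi> ^ n)"
    proof (rule torus_integral_cong[OF radius])
      fix \<xi> assume \<xi>: "\<xi> \<in> torus N \<rho>"
      have "plane_wave Y (X(i := X i - 1)) \<sigma> \<xi> = plane_wave Y X \<sigma> \<xi> * (1 / \<xi> (\<sigma> i))"
        if "i \<in> {1..N}" for i
        using plane_wave_shift[OF that p \<xi>, of Y X "- 1"] by (simp add: power_int_minus inverse_eq_divide)
      then have "(\<Sum>i=1..N. bethe_wave \<nu> Y (X(i := X i - 1)) \<pi> \<sigma> \<xi> * energy \<xi> ^ n) =
          (\<Sum>i=1..N. (bethe_wave \<nu> Y X \<pi> \<sigma> \<xi> * energy \<xi> ^ n) * (1 / \<xi> (\<sigma> i)))"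
        by (intro sum.cong) (auto simp: mult_ac)
      also have "\<dots> = (bethe_wave \<nu> Y X \<pi> \<sigma> \<xi> * energy \<xi> ^ n) * energy \<xi>"
        by (simp only: sum_distrib_left energy_permuted[OF p])
      finally show "bethe_wave \<nu> Y X \<pi> \<sigma> \<xi> * energy \<xi> ^ Suc n =
        (\<Sum>i=1..N. bethe_wave \<nu> Y (X(i := X i - 1)) \<pi> \<sigma> \<xi> * energy \<xi> ^ n)"
        by (simp add: mult_ac)
    qed
    also have "\<dots> = (\<Sum>i=1..N. torus_integral N \<rho>
        (\<lambda>\<xi>. bethe_wave \<nu> Y (X(i := X i - 1)) \<pi> \<sigma> \<xi> * energy \<xi> ^ n))"
      by (rule torus_integral_sum[OF radius]) (rule torus_continuous_integrand[OF p])
    finally show ?thesis .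
  qed
  then show ?thesis
    unfolding moment_def by (subst sum.swap) (auto intro!: sum.cong)
qed

lemma moment_exp_sums:
  "(\<lambda>n. complex_of_real t ^ n / fact n * moment \<nu> Y n X \<pi>) sums
    (\<Sum>\<sigma> | \<sigma> permutes {1..N}.
      torus_integral N \<rho> (\<lambda>\<xi>. bethe_wave \<nu> Y X \<pi> \<sigma> \<xi> * exp (t * energy \<xi>)))"
proof -
  have "(\<lambda>n. \<Sum>\<sigma> | \<sigma> permutes {1..N}. complex_of_real t ^ n / fact n * torus_integral N \<rho>
        (\<lambda>\<xi>. bethe_wave \<nu> Y X \<pi> \<sigma> \<xi> * energy \<xi> ^ n)) sums
    (\<Sum>\<sigma> | \<sigma> permutes {1..N}.
      torus_integral N \<rho> (\<lambda>\<xi>. bethe_wave \<nu> Y X \<pi> \<sigma> \<xi> * exp (t * energy \<xi>)))"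
    by (intro sums_sum torus_integral_exp_sums radius torus_continuous_energy torus_continuous_wave_amplitude
        continuous_mult[OF torus_continuous_wave_amplitude] torus_continuous_exp_energy) auto
  then show ?thesis by (simp add: moment_def sum_distrib_left)
qed

subsection \<open>The boundary condition\<close>

lemma swap_slots_permutes: "\<sigma> permutes {1..N} \<Longrightarrow> l \<in> {1..<N} \<Longrightarrow> swap_slots l \<sigma> permutes {1..N}"
  using fold_swap_slots_permutes[of "[l]" N \<sigma>] by simp

lemma bij_betw_swap_slots:
  "l \<in> {1..<N} \<Longrightarrow> bij_betw (swap_slots l) {\<sigma>. \<sigma> permutes {1..N}} {\<sigma>. \<sigma> permutes {1..N}}"
  by (rule bij_betw_byWitness[where f' = "swap_slots l"]) (auto simp: swap_slots_involution swap_slots_permutes simp del: One_nat_def)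

lemma plane_wave_swap_slots:
  assumes "X (Suc l) = X l" "l \<in> {1..<N}"
  shows "plane_wave Y X (swap_slots l \<sigma>) \<xi> = plane_wave Y X \<sigma> \<xi>"
proof -
  have "Transposition.transpose l (Suc l) permutes {1..N}"
    using assms(2) by (intro permutes_swap_id) auto
  moreover have "X (Transposition.transpose l (Suc l) i) = X i" for i
    using assms(1) by (simp add: Transposition.transpose_def)
  ultimately show ?thesis
    unfolding plane_wave_def swap_slots_def
    by (subst (2) prod.permute[of "Transposition.transpose l (Suc l)"]) (auto simp: o_def)
qed

text \<open>
  At coinciding positions the terms for \<open>\<sigma>\<close> and \<open>swap_slots l \<sigma>\<close> have the same plane wave, and the boundary
  condition for their amplitudes makes the difference of both sides cancel pairwise.
\<close>

lemma moment_boundary: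
  assumes X: "X (Suc l) = X l" and l: "l \<in> {1..<N}"
  defines "X' \<equiv> X(Suc l := X (Suc l) + 1)"
  shows "moment \<nu> Y n X \<pi> =
    (if \<pi> l < \<pi> (Suc l) then b (\<pi> l) * (moment \<nu> Y n X' \<pi> + moment \<nu> Y n X' (swap_slots l \<pi>))
     else if \<pi> l = \<pi> (Suc l) then b (\<pi> l) * moment \<nu> Y n X' \<pi>
     else 0)"
proof -
  define A where "A = amplitude N b \<nu>"
  define c1 c2 where "c1 = (if \<pi> l \<le> \<pi> (Suc l) then complex_of_real (b (\<pi> l)) else 0)"
    and "c2 = (if \<pi> l < \<pi> (Suc l) then complex_of_real (b (\<pi> l)) else 0)"
  define H where "H = (\<lambda>\<sigma> \<xi>. plane_wave Y X \<sigma> \<xi> * A \<sigma> \<xi> \<pi> * energy \<xi> ^ n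
    + (- c1) * (plane_wave Y X' \<sigma> \<xi> * A \<sigma> \<xi> \<pi> * energy \<xi> ^ n)
    + (- c2) * (plane_wave Y X' \<sigma> \<xi> * A \<sigma> \<xi> (swap_slots l \<pi>) * energy \<xi> ^ n))"
  let ?S = "\<Sum>\<sigma> | \<sigma> permutes {1..N}. torus_integral N \<rho> (H \<sigma>)"
  have cont: "torus_continuous N \<rho> (H \<sigma>)" if "\<sigma> permutes {1..N}" for \<sigma>
    unfolding H_def A_def by (intro separable_add separable_cmult torus_continuous_integrand that)
  have T: "torus_integral N \<rho> (H \<sigma>) =
      torus_integral N \<rho> (\<lambda>\<xi>. plane_wave Y X \<sigma> \<xi> * A \<sigma> \<xi> \<pi> * energy \<xi> ^ n)
      - c1 * torus_integral N \<rho> (\<lambda>\<xi>. plane_wave Y X' \<sigma> \<xi> * A \<sigma> \<xi> \<pi> * energy \<xi> ^ n)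
      - c2 * torus_integral N \<rho> (\<lambda>\<xi>. plane_wave Y X' \<sigma> \<xi> * A \<sigma> \<xi> (swap_slots l \<pi>) * energy \<xi> ^ n)"
    if p: "\<sigma> permutes {1..N}" for \<sigma>
    unfolding H_def A_def
    by (simp only: torus_integral_add[OF radius] torus_integral_cmult[OF radius]
        separable_add separable_cmult torus_continuous_integrand[OF p]) simp
  have S: "?S = moment \<nu> Y n X \<pi> - c1 * moment \<nu> Y n X' \<pi> - c2 * moment \<nu> Y n X' (swap_slots l \<pi>)"
    by (simp add: T sum_subtractf sum_distrib_left moment_def A_def)
  have cancel: "H \<sigma> \<xi> + H (swap_slots l \<sigma>) \<xi> = 0" if p: "\<sigma> permutes {1..N}" and \<xi>: "\<xi> \<in> torus N \<rho>" for \<sigma> \<xi>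
  proof -
    interpret nonsingular b \<xi> by (rule torus_nonsingular[OF \<xi>])
    have Suc_l: "Suc l \<in> {1..N}" using l by auto
    have X': "plane_wave Y X' \<tau> \<xi> = plane_wave Y X \<tau> \<xi> * \<xi> (\<tau> (Suc l))" if "\<tau> permutes {1..N}" for \<tau>
      unfolding X'_def using plane_wave_shift[OF Suc_l that \<xi>, of Y X 1] by simp
    have A': "A (swap_slots l \<sigma>) \<xi> = R_op b \<xi> l (\<sigma> (Suc l)) (\<sigma> l) (A \<sigma> \<xi>)"
      unfolding A_def by (rule amplitude_swap[OF p l])
    have "H \<sigma> \<xi> + H (swap_slots l \<sigma>) \<xi> = plane_wave Y X \<sigma> \<xi> * energy \<xi> ^ n *
      ((A \<sigma> \<xi> \<pi> + A (swap_slots l \<sigma>) \<xi> \<pi>)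
       - c1 * (\<xi> (\<sigma> (Suc l)) * A \<sigma> \<xi> \<pi> + \<xi> (\<sigma> l) * A (swap_slots l \<sigma>) \<xi> \<pi>)
       - c2 * (\<xi> (\<sigma> (Suc l)) * A \<sigma> \<xi> (swap_slots l \<pi>) + \<xi> (\<sigma> l) * A (swap_slots l \<sigma>) \<xi> (swap_slots l \<pi>)))"
      by (simp add: H_def X'[OF p] X'[OF swap_slots_permutes[OF p l]] plane_wave_swap_slots[OF X l])
         (simp add: swap_slots_def algebra_simps)
    also have "\<dots> = 0"
      using R_op_boundary[of "A \<sigma> \<xi>" \<pi> l "\<sigma> (Suc l)" "\<sigma> l"]
      by (auto simp: A' c1_def c2_def algebra_simps split: if_splits)
    finally show ?thesis .
  qed
  have "?S = (\<Sum>\<sigma> | \<sigma> permutes {1..N}. torus_integral N \<rho> (H (swap_slots l \<sigma>)))"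
    by (rule sum.reindex_bij_betw[OF bij_betw_swap_slots[OF l], symmetric])
  then have "?S + ?S = (\<Sum>\<sigma> | \<sigma> permutes {1..N}. torus_integral N \<rho> (H \<sigma>) + torus_integral N \<rho> (H (swap_slots l \<sigma>)))"
    by (simp add: sum.distrib)
  also have "\<dots> = 0"
  proof (intro sum.neutral ballI)
    fix \<sigma> assume "\<sigma> \<in> {\<sigma>. \<sigma> permutes {1..N}}"
    then have p: "\<sigma> permutes {1..N}" by simp
    have "torus_integral N \<rho> (H \<sigma>) + torus_integral N \<rho> (H (swap_slots l \<sigma>)) =
        torus_integral N \<rho> (\<lambda>\<xi>. H \<sigma> \<xi> + H (swap_slots l \<sigma>) \<xi>)"
      by (rule torus_integral_add[OF radius cont[OF p] cont[OF swap_slots_permutes[OF p l]], symmetric])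
    also have "\<dots> = torus_integral N \<rho> (\<lambda>\<xi>. 0)"
      by (rule torus_integral_cong[OF radius cancel[OF p]])
    finally show "torus_integral N \<rho> (H \<sigma>) + torus_integral N \<rho> (H (swap_slots l \<sigma>)) = 0" by simp
  qed
  finally have "?S = 0" by simp
  with S show ?thesis by (auto simp: c1_def c2_def algebra_simps)
qed

subsection \<open>Initial condition\<close>

lemma wave_amplitude_integral_eq_0:
  assumes p: "\<sigma> permutes {1..N}" and "j \<in> {1..N}"
    and amp: "separable N \<rho> \<Phi> (\<lambda>\<xi>. amplitude N b \<nu> \<sigma> \<xi> \<pi>)"
    and \<Phi>: "\<And>i. i \<in> {1..N} \<Longrightarrow> \<Phi> i \<subseteq> disc_functions \<rho>"
    and zero: "\<And>f. f \<in> \<Phi> j \<Longrightarrow> circ_integral \<rho> (\<lambda>z. z powi (X (inv_into UNIV \<sigma> j) - Y j - 1) * f z) = 0"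
  shows "torus_integral N \<rho> (\<lambda>\<xi>. bethe_wave \<nu> Y X \<pi> \<sigma> \<xi>) = 0"
proof -
  define e where "e i = X (inv_into UNIV \<sigma> i) - Y i - 1" for i
  have wave: "separable N \<rho> (\<lambda>i. {\<lambda>z. z powi e i}) (plane_wave Y X \<sigma>)"
    unfolding ext[of "plane_wave Y X \<sigma>", OF plane_wave_by_variable[OF p]] e_def
    by (rule separable_single[where f = "\<lambda>i z. z powi (X (inv_into UNIV \<sigma> i) - Y i - 1)"]) simp
  have prod: "separable N \<rho> (\<lambda>i. {\<lambda>z. z powi e i * f z |f. f \<in> \<Phi> i})
      (\<lambda>\<xi>. bethe_wave \<nu> Y X \<pi> \<sigma> \<xi>)"
    by (rule separable_mult[OF wave amp]) auto
  show ?thesis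
  proof (rule torus_integral_eq_0[OF radius prod _ \<open>j \<in> {1..N}\<close>])
    fix i assume "i \<in> {1..N}"
    then have "\<Phi> i \<subseteq> continuous_functions \<rho> i" using \<Phi> disc_functions_continuous by blast
    then show "{\<lambda>z. z powi e i * f z |f. f \<in> \<Phi> i} \<subseteq> continuous_functions \<rho> i"
      by (auto intro!: continuous_on_mult continuous_powi radius)
  qed (use zero in \<open>auto simp: e_def\<close>)
qed

text \<open>
  If all exponents are negative, the largest moved letter \<open>m\<close> stands far to the left: its exponent is so
  small that even multiplication with a polynomial of the degree of the amplitude leaves no residue.
\<close>

lemma wave_amplitude_integral_nontrivial:
  assumes p: "\<sigma> permutes {1..N}" and "\<sigma> \<noteq> id"
    and X: "strict_mono_on {1..N} X" and Y: "strict_mono_on {1..N} Y"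
  shows "torus_integral N \<rho> (\<lambda>\<xi>. bethe_wave \<nu> Y X \<pi> \<sigma> \<xi>) = 0"
proof (cases "\<exists>j\<in>{1..N}. X (inv_into UNIV \<sigma> j) - Y j - 1 \<ge> 0")
  case True
  then obtain j where j: "j \<in> {1..N}" "X (inv_into UNIV \<sigma> j) - Y j - 1 \<ge> 0" by blast
  show ?thesis
  proof (rule wave_amplitude_integral_eq_0[OF p j(1) separable_amplitude[OF p]])
    fix f assume "f \<in> disc_functions \<rho>"
    then show "circ_integral \<rho> (\<lambda>z. z powi (X (inv_into UNIV \<sigma> j) - Y j - 1) * f z) = 0"
      using j(2) circ_integral_disc[OF radius disc_functions_mult[OF disc_functions_power]]
      by (simp add: power_int_def)
  qed simp
next
  case False
  then have neg: "X (inv_into UNIV \<sigma> j) \<le> Y j" if "j \<in> {1..N}" for j using that by force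
  define M where "M = {j. \<sigma> j \<noteq> j}"
  have "M \<subseteq> {1..N}" using p unfolding M_def by (auto simp: permutes_def)
  then have fin: "finite M" by (rule finite_subset) simp
  have "M \<noteq> {}" using \<open>\<sigma> \<noteq> id\<close> by (auto simp: M_def fun_eq_iff)
  define m where "m = Max M"
  have m: "\<sigma> m \<noteq> m" "m \<in> {1..N}"
    using Max_in[OF fin \<open>M \<noteq> {}\<close>] \<open>M \<subseteq> {1..N}\<close> by (auto simp: m_def M_def)
  have above: "\<sigma> j = j" if "j > m" for j
    using Max_ge[OF fin, of j] that by (auto simp: m_def M_def)
  have pm: "\<sigma> permutes {1..m}"
    by (rule permutes_superset[OF p]) (use above in auto)
  define i where "i = inv_into UNIV \<sigma> m"
  have i: "\<sigma> i = m" by (simp add: i_def permutes_inverses[OF p])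
  have im: "i \<in> {1..m}" "\<sigma> m \<in> {1..m}"
    using permutes_in_image[OF pm, of i] permutes_in_image[OF pm, of m] i m(2) by auto
  then have "X i + int (m - i) \<le> X m" using m(2) by (intro strict_mono_on_gap[OF X]) auto
  also have "X m \<le> Y (\<sigma> m)"
    using neg[of "\<sigma> m"] permutes_in_image[OF p] m(2) by (simp add: permutes_inverses[OF p])
  also have "Y (\<sigma> m) < Y m"
    using im(2) m by (intro strict_mono_onD[OF Y]) auto
  finally have e: "X i + int (m - i) < Y m" .
  show ?thesis
  proof (rule wave_amplitude_integral_eq_0[OF p m(2) separable_amplitude_degree[OF pm i m(2)]])
    fix f assume "f \<in> amplitude_functions \<rho> (m - i) m m"
    then obtain q where q: "degree q \<le> m - i" "f = poly q" by (auto simp: amplitude_functions_def)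
    then show "circ_integral \<rho> (\<lambda>z. z powi (X (inv_into UNIV \<sigma> m) - Y m - 1) * f z) = 0"
      unfolding i_def[symmetric] q(2) using e by (intro circ_integral_poly_powi radius) auto
  qed (rule amplitude_functions_disc)
qed

lemma moment_0:
  assumes "strict_mono_on {1..N} X" "strict_mono_on {1..N} Y"
  shows "moment \<nu> Y 0 X \<pi> =
    (if (\<forall>i\<in>{1..N}. X i = Y i) \<and> same_word N \<pi> \<nu> then (2 * of_real pi * \<i>) ^ N else 0)"
proof -
  have "moment \<nu> Y 0 X \<pi> = (\<Sum>\<sigma> | \<sigma> permutes {1..N}. if \<sigma> = id then
      torus_integral N \<rho> (\<lambda>\<xi>. plane_wave Y X id \<xi> * amplitude N b \<nu> id \<xi> \<pi>) else 0)"
    unfolding moment_def using wave_amplitude_integral_nontrivial[OF _ _ assms]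
    by (intro sum.cong) auto
  also have "\<dots> = torus_integral N \<rho> (\<lambda>\<xi>. plane_wave Y X id \<xi> * amplitude N b \<nu> id \<xi> \<pi>)"
    by (subst sum.delta) (auto simp: finite_permutations permutes_id)
  also have "\<dots> = torus_integral N \<rho> (\<lambda>\<xi>. (if same_word N \<pi> \<nu> then 1 else 0) * plane_wave Y X id \<xi>)"
  proof (rule torus_integral_cong[OF radius])
    fix \<xi> assume "\<xi> \<in> torus N \<rho>"
    then interpret nonsingular b \<xi> by (rule torus_nonsingular)
    have "expresses N [] id" by (simp add: expresses_def)
    then show "plane_wave Y X id \<xi> * amplitude N b \<nu> id \<xi> \<pi> = (if same_word N \<pi> \<nu> then 1 else 0) * plane_wave Y X id \<xi>"
      by (simp add: amplitude_eq)
  qed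
  also have "\<dots> = (if same_word N \<pi> \<nu> then 1 else 0) * torus_integral N \<rho> (plane_wave Y X id)"
    by (rule torus_integral_cmult[OF radius torus_continuous_plane_wave[OF permutes_id]])
  also have "torus_integral N \<rho> (plane_wave Y X id) =
      (\<Sum>t\<leftarrow>[(1, \<lambda>i z. z powi (X i - Y i - 1))]. fst t * (\<Prod>i=1..N. circ_integral \<rho> (snd t i)))"
    by (rule torus_integral_products[OF radius])
       (auto simp: sum_of_products_def plane_wave_def continuous_powi radius)
  also have "\<dots> = (\<Prod>i=1..N. if X i = Y i then 2 * of_real pi * \<i> else 0)"
    by (auto simp: circ_integral_powi[OF radius] intro!: prod.cong)
  also have "\<dots> = (if \<forall>i\<in>{1..N}. X i = Y i then (2 * of_real pi * \<i>) ^ N else 0)"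
    by (auto simp: prod_constant intro!: prod_zero)
  finally show ?thesis by auto
qed

end

section \<open>Sequences of attempts\<close>

lemma attempt_free:
  assumes "\<not> (\<exists>q\<in>{1..N}. z q = z p + 1)"
  shows "attempt N \<nu> p z = z(p := z p + 1)"
  using assms by (simp add: attempt_def del: atLeastAtMost_iff)

lemma attempt_occupied:
  assumes "inj_on z {1..N}" "q \<in> {1..N}" "z q = z p + 1"
  shows "attempt N \<nu> p z = (if \<nu> q < \<nu> p then z(p := z q, q := z p) else z)"
proof -
  have "(THE q. q \<in> {1..N} \<and> z q = z p + 1) = q"
    by (rule the_equality) (use assms in \<open>metis inj_onD\<close>)+
  moreover have "\<exists>q\<in>{1..N}. z q = z p + 1" using assms by blast
  ultimately show ?thesis by (simp add: attempt_def Let_def del: atLeastAtMost_iff)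
qed

lemma inj_on_attempt:
  assumes "inj_on z {1..N}" "p \<in> {1..N}"
  shows "inj_on (attempt N \<nu> p z) {1..N}"
proof (cases "\<exists>q\<in>{1..N}. z q = z p + 1")
  case True
  then obtain q where q: "q \<in> {1..N}" "z q = z p + 1" by blast
  have "z(p := z q, q := z p) = z \<circ> Transposition.transpose p q"
    by (rule ext) (simp add: Transposition.transpose_def)
  moreover have "inj_on z (Transposition.transpose p q ` {1..N})"
    unfolding permutes_image[OF permutes_swap_id[OF assms(2) q(1)]] by (rule assms(1))
  then have "inj_on (z \<circ> Transposition.transpose p q) {1..N}" by (rule comp_inj_on[OF inj_on_transpose])
  ultimately show ?thesis using assms q by (simp add: attempt_occupied)
next
  case False
  then show ?thesis
    unfolding attempt_free[OF False] using assms by (intro inj_on_fun_updI) (auto simp: image_iff)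
qed

lemma attempt_occupies_target:
  assumes "inj_on z {1..N}" "p \<in> {1..N}"
  shows "\<exists>q\<in>{1..N}. attempt N \<nu> p z q = z p + 1"
proof (cases "\<exists>q\<in>{1..N}. z q = z p + 1")
  case True
  then obtain q where "q \<in> {1..N}" "z q = z p + 1" by blast
  moreover from this have "p \<noteq> q" by auto
  ultimately show ?thesis
    using assms by (cases "\<nu> q < \<nu> p") (auto simp: attempt_occupied intro: bexI[of _ p] bexI[of _ q])
next
  case False
  then show ?thesis using assms(2) by (intro bexI[of _ p]) (auto simp: attempt_free)
qed

text \<open>\<open>N\<close> distinct sites account for all particles.\<close>

lemma in_state_particle:
  assumes "in_state N \<nu> z X \<pi>" "inj_on X {1..N}" "p \<in> {1..N}"
  shows "\<exists>i\<in>{1..N}. X i = z p \<and> \<pi> i = \<nu> p"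
proof -
  obtain f where f: "\<And>i. i \<in> {1..N} \<Longrightarrow> f i \<in> {1..N} \<and> z (f i) = X i \<and> \<nu> (f i) = \<pi> i"
    using assms(1) unfolding in_state_def by metis
  have "inj_on f {1..N}" using f assms(2) by (metis inj_onD inj_onI)
  then have "f ` {1..N} = {1..N}" using f by (intro endo_inj_surj) auto
  then obtain i where "i \<in> {1..N}" "f i = p" using assms(3) by (metis imageE)
  then show ?thesis using f by auto
qed

lemma strict_mono_on_adjacent:
  fixes X :: "nat \<Rightarrow> int"
  assumes X: "strict_mono_on {1..N} X" and "i \<in> {1..N}" "j \<in> {1..N}" "X j = X i - 1"
  shows "Suc j = i"
proof -
  have "j < i"
  proof (rule ccontr)
    assume "\<not> j < i"
    then have "X i \<le> X j" using strict_mono_on_gap[OF X, of i j] assms(2,3) by auto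
    then show False using assms(4) by simp
  qed
  then have "X j + int (i - j) \<le> X i" using assms by (intro strict_mono_on_gap[OF X]) auto
  then show ?thesis using assms(4) \<open>j < i\<close> by auto
qed

text \<open>
The particle that attempts to jump to the site \<open>X i\<close> stands at \<open>X i - 1\<close>. If the site \<open>X i - 1\<close> also belongs to the
state \<open>(X, \<pi>)\<close> afterwards, two particles were involved, and they either interchanged or blocked each other.
\<close>

definition enters :: "nat \<Rightarrow> (nat \<Rightarrow> nat) \<Rightarrow> (nat \<Rightarrow> int) \<Rightarrow> (nat \<Rightarrow> int) \<Rightarrow> (nat \<Rightarrow> nat) \<Rightarrow> nat \<Rightarrow> bool" where
  "enters N \<nu> z X \<pi> i \<longleftrightarrow>
    (if 1 < i \<and> X (i - 1) = X i - 1
     then \<pi> (i - 1) < \<pi> i \<and> in_state N \<nu> z X (swap_slots (i - 1) \<pi>) \<or>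
       \<pi> (i - 1) \<le> \<pi> i \<and> in_state N \<nu> z X \<pi>
     else in_state N \<nu> z (X(i := X i - 1)) \<pi>)"

lemma in_state_attempt:
  assumes z: "inj_on z {1..N}" and X: "strict_mono_on {1..N} X"
    and p: "p \<in> {1..N}" and i: "i \<in> {1..N}" and t: "X i = z p + 1"
  shows "in_state N \<nu> (attempt N \<nu> p z) X \<pi> \<longleftrightarrow> enters N \<nu> z X \<pi> i"
proof -
  have injX: "inj_on X {1..N}" using X by (rule strict_mono_on_imp_inj_on)
  have X_eq: "X j = X i \<longleftrightarrow> j = i" if "j \<in> {1..N}" for j using injX i that by (auto dest: inj_onD)
  have z_eq: "z r = z s \<longleftrightarrow> r = s" if "r \<in> {1..N}" "s \<in> {1..N}" for r s using z that by (auto dest: inj_onD)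
  consider (adj) "1 < i" "X (i - 1) = z p" | (gap) "\<not> (1 < i \<and> X (i - 1) = z p)" by blast
  note adjacency = this
  have gapX: "X j \<noteq> z p" if "\<not> (1 < i \<and> X (i - 1) = z p)" "j \<in> {1..N}" for j
  proof
    assume "X j = z p"
    then have "Suc j = i" using strict_mono_on_adjacent[OF X i that(2)] t by simp
    then show False using that \<open>X j = z p\<close> by auto
  qed
  show ?thesis
  proof (cases "\<exists>q\<in>{1..N}. z q = z p + 1")
    case False
    note free = attempt_free[OF False]
    show ?thesis
    proof (cases rule: adjacency)
      case adj
      then have "i - 1 \<in> {1..N}" using i by auto
      then have "\<not> in_state N \<nu> (attempt N \<nu> p z) X \<pi>"
        unfolding in_state_def free using adj(2) z_eq p by (metis fun_upd_apply add_cancel_left_right zero_neq_one)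
      moreover have "\<not> in_state N \<nu> z X \<pi>'" for \<pi>' using False i t unfolding in_state_def by metis
      ultimately show ?thesis using adj t by (simp add: enters_def)
    next
      case gap
      have "(\<exists>r\<in>{1..N}. (z(p := z p + 1)) r = X j \<and> \<nu> r = \<pi> j) \<longleftrightarrow>
          (\<exists>r\<in>{1..N}. z r = (X(i := X i - 1)) j \<and> \<nu> r = \<pi> j)" if j: "j \<in> {1..N}" for j
      proof (cases "j = i")
        case True
        then show ?thesis using t p z_eq False by (metis add_diff_cancel_right' fun_upd_apply)
      next
        case False
        then have "X j \<noteq> z p + 1" "X j \<noteq> z p" using X_eq[OF j] t gapX[OF gap j] by auto
        then show ?thesis using False by (metis fun_upd_apply)
      qed
      moreover have no: "\<not> (1 < i \<and> X (i - 1) = X i - 1)" using gap t by simp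
      ultimately show ?thesis
        unfolding enters_def free if_not_P[OF no] in_state_def by (intro ball_cong refl)
    qed
  next
    case True
    then obtain q where q: "q \<in> {1..N}" "z q = z p + 1" by blast
    note occ = attempt_occupied[OF z q]
    show ?thesis
    proof (cases rule: adjacency)
      case adj
      define l where "l = i - 1"
      have l: "l \<in> {1..N}" "X l = z p" "Suc l = i" using adj i by (auto simp: l_def)
      have s: "swap_slots l \<pi> l = \<pi> i" "swap_slots l \<pi> i = \<pi> l" using l(3) by (auto simp: swap_slots_def)
      have s': "swap_slots l \<pi> j = \<pi> j" if "j \<noteq> l" "j \<noteq> i" for j using that l(3) by (auto simp: swap_slots_def Transposition.transpose_def)
      have Xl: "X j = X l \<longleftrightarrow> j = l" if "j \<in> {1..N}" for j using injX l(1) that by (metis inj_onD)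
      have plain: "\<pi>' l = \<nu> p \<and> \<pi>' i = \<nu> q" if "in_state N \<nu> z X \<pi>'" for \<pi>'
        using that l i t p q z_eq unfolding in_state_def by metis
      have at: "(\<exists>r\<in>{1..N}. z r = z s \<and> \<nu> r = a) \<longleftrightarrow> \<nu> s = a" if "s \<in> {1..N}" for s a
        using z_eq that by metis
      have "p \<noteq> q" using q by auto
      then have at_p: "(\<exists>r\<in>{1..N}. (z(p := z q, q := z p)) r = z p \<and> \<nu> r = a) \<longleftrightarrow> \<nu> q = a" for a
        using z_eq p q(1) by (metis fun_upd_apply)
      have at_q: "(\<exists>r\<in>{1..N}. (z(p := z q, q := z p)) r = z q \<and> \<nu> r = a) \<longleftrightarrow> \<nu> p = a" for a
        using z_eq p q(1) \<open>p \<noteq> q\<close> by (metis fun_upd_apply)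
      have "in_state N \<nu> (z(p := z q, q := z p)) X \<pi> \<longleftrightarrow> in_state N \<nu> z X (swap_slots l \<pi>)"
      proof -
        have Xi: "X i = z q" using t q by simp
        have "(\<exists>r\<in>{1..N}. (z(p := z q, q := z p)) r = X j \<and> \<nu> r = \<pi> j) \<longleftrightarrow>
          (\<exists>r\<in>{1..N}. z r = X (Transposition.transpose l i j) \<and> \<nu> r = swap_slots l \<pi> (Transposition.transpose l i j))"
          if j: "j \<in> {1..N}" for j
        proof -
          consider "j = l" | "j = i" | "j \<noteq> l" "j \<noteq> i" by blast
          then show ?thesis
          proof cases
            case 1
            show ?thesis unfolding 1 Transposition.transpose_apply_first Xi l(2) at_p at[OF q(1)] s by (rule refl)
          next
            case 2
            show ?thesis unfolding 2 Transposition.transpose_apply_second Xi l(2) at_q at[OF p] s by (rule refl)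
          next
            case 3
            then have "X j \<noteq> z p" "X j \<noteq> z q" using X_eq[OF j] Xl[OF j] l t q by auto
            then show ?thesis using 3 s' by simp metis
          qed
        qed
        then have "in_state N \<nu> (z(p := z q, q := z p)) X \<pi> \<longleftrightarrow>
          (\<forall>j\<in>{1..N}. \<exists>r\<in>{1..N}. z r = X (Transposition.transpose l i j) \<and> \<nu> r = swap_slots l \<pi> (Transposition.transpose l i j))"
          unfolding in_state_def by blast
        also have "\<dots> \<longleftrightarrow> (\<forall>j\<in>Transposition.transpose l i ` {1..N}. \<exists>r\<in>{1..N}. z r = X j \<and> \<nu> r = swap_slots l \<pi> j)" by blast
        also have "Transposition.transpose l i ` {1..N} = {1..N}"
          by (rule permutes_image[OF permutes_swap_id[OF l(1) i]])
        finally show ?thesis unfolding in_state_def .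
      qed
      then show ?thesis
        using adj t plain s unfolding enters_def occ l_def[symmetric] by (auto dest: plain)
    next
      case gap
      have "\<not> in_state N \<nu> (attempt N \<nu> p z) X \<pi>"
      proof
        assume a: "in_state N \<nu> (attempt N \<nu> p z) X \<pi>"
        have "\<exists>r\<in>{1..N}. attempt N \<nu> p z r = z p"
          unfolding occ using p q by (cases "\<nu> q < \<nu> p") auto
        then show False using in_state_particle[OF a injX] gapX[OF gap] by metis
      qed
      moreover have "\<not> in_state N \<nu> z (X(i := X i - 1)) \<pi>"
      proof
        assume a: "in_state N \<nu> z (X(i := X i - 1)) \<pi>"
        have "inj_on (X(i := X i - 1)) {1..N}"
          using injX gapX[OF gap] t unfolding inj_on_def by (metis add_diff_cancel_right' fun_upd_apply)
        from in_state_particle[OF a this q(1)] obtain j where "j \<in> {1..N}" "(X(i := X i - 1)) j = z q" by blast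
        then show False using X_eq q(2) t by (auto split: if_splits)
      qed
      moreover have no: "\<not> (1 < i \<and> X (i - 1) = X i - 1)" using gap t by simp
      ultimately show ?thesis unfolding enters_def if_not_P[OF no] by blast
    qed
  qed
qed

text \<open>
The right-hand side of the master equation, split by the site \<open>X i\<close> at which the last attempt was aimed; \<open>w\<close>
is the quantity that was present before it. Rates and weights are kept in one definition for real
weights of attempts and complex integrals, so that both recursions can be compared literally.
\<close>

definition inflow ::
  "nat \<Rightarrow> (nat \<Rightarrow> real) \<Rightarrow> ((nat \<Rightarrow> int) \<Rightarrow> (nat \<Rightarrow> nat) \<Rightarrow> 'a) \<Rightarrow> (nat \<Rightarrow> int) \<Rightarrow> (nat \<Rightarrow> nat) \<Rightarrow> nat \<Rightarrow> 'a::real_algebra_1" where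
  "inflow N b w X \<pi> i =
    (if 1 < i \<and> X (i - 1) = X i - 1
     then if \<pi> (i - 1) < \<pi> i
       then of_real (b (\<pi> i)) * w X (swap_slots (i - 1) \<pi>) + of_real (b (\<pi> (i - 1))) * w X \<pi>
       else if \<pi> (i - 1) = \<pi> i then of_real (b (\<pi> i)) * w X \<pi>
       else 0
     else of_real (b (\<pi> i)) * w (X(i := X i - 1)) \<pi>)"

lemma inflow_adjacent:
  assumes "Suc l = i" "1 \<le> l" "X l = X i - 1"
  shows "inflow N b w X \<pi> i =
    (if \<pi> l < \<pi> i then of_real (b (\<pi> i)) * w X (swap_slots l \<pi>) + of_real (b (\<pi> l)) * w X \<pi>
     else if \<pi> l = \<pi> i then of_real (b (\<pi> i)) * w X \<pi> else 0)"
  using assms by (auto simp: inflow_def)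

lemma inflow_gap:
  assumes "\<not> (1 < i \<and> X (i - 1) = X i - 1)"
  shows "inflow N b w X \<pi> i = of_real (b (\<pi> i)) * w (X(i := X i - 1)) \<pi>"
  unfolding inflow_def if_not_P[OF assms] by (rule refl)

lemma in_state_species_unique:
  assumes z: "inj_on z {1..N}" and "in_state N \<nu> z X \<pi>" "in_state N \<nu> z X \<pi>'" "i \<in> {1..N}"
  shows "\<pi> i = \<pi>' i"
  using assms unfolding in_state_def by (metis inj_onD)

lemma enters_weight:
  fixes b :: "nat \<Rightarrow> real"
  assumes z: "inj_on z {1..N}" and X: "strict_mono_on {1..N} X" and i: "i \<in> {1..N}"
  shows "(\<Sum>p=1..N. if X i = z p + 1 \<and> enters N \<nu> z X \<pi> i then b (\<nu> p) else 0) =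
    inflow N b (\<lambda>X \<pi>. of_bool (in_state N \<nu> z X \<pi>)) X \<pi> i"
proof -
  have unique: "(\<Sum>p=1..N. if X i = z p + 1 \<and> enters N \<nu> z X \<pi> i then b (\<nu> p) else 0) = b a"
    if "enters N \<nu> z X \<pi> i" "\<exists>p\<in>{1..N}. z p = X i - 1 \<and> \<nu> p = a" for a
  proof -
    obtain p where p: "p \<in> {1..N}" "z p = X i - 1" "\<nu> p = a" using \<open>\<exists>p\<in>{1..N}. z p = X i - 1 \<and> \<nu> p = a\<close> by blast
    have "(\<Sum>r=1..N. if X i = z r + 1 \<and> enters N \<nu> z X \<pi> i then b (\<nu> r) else 0) =
        (\<Sum>r=1..N. if r = p then b a else 0)"
    proof (rule sum.cong)
      fix r assume "r \<in> {1..N}"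
      then have "z r = z p \<longleftrightarrow> r = p" using p(1) z by (metis inj_onD)
      then have "X i = z r + 1 \<longleftrightarrow> r = p" using p(2) by auto
      then show "(if X i = z r + 1 \<and> enters N \<nu> z X \<pi> i then b (\<nu> r) else 0) = (if r = p then b a else 0)"
        using p \<open>enters N \<nu> z X \<pi> i\<close> by simp
    qed simp
    also have "\<dots> = b a" using p(1) by simp
    finally show ?thesis .
  qed
  show ?thesis
  proof (cases "1 < i \<and> X (i - 1) = X i - 1")
    case True
    define l where "l = i - 1"
    have l: "l \<in> {1..N}" "Suc l = i" "X l = X i - 1" using True i by (auto simp: l_def)
    have s: "swap_slots l \<pi> l = \<pi> i" using l by (auto simp: swap_slots_def)
    have inflow: "inflow N b w X \<pi> i =
      (if \<pi> l < \<pi> i then b (\<pi> i) * w X (swap_slots l \<pi>) + b (\<pi> l) * w X \<pi>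
       else if \<pi> l = \<pi> i then b (\<pi> i) * w X \<pi> else 0)" for w :: "(nat \<Rightarrow> int) \<Rightarrow> (nat \<Rightarrow> nat) \<Rightarrow> real"
      using inflow_adjacent[of l i X N b w \<pi>] l by simp
    have E: "enters N \<nu> z X \<pi> i \<longleftrightarrow> \<pi> l < \<pi> i \<and> in_state N \<nu> z X (swap_slots l \<pi>) \<or>
       \<pi> l \<le> \<pi> i \<and> in_state N \<nu> z X \<pi>"
      using True unfolding enters_def l_def by simp
    have site: "\<exists>p\<in>{1..N}. z p = X i - 1 \<and> \<nu> p = \<pi>' l" if "in_state N \<nu> z X \<pi>'" for \<pi>'
      using that l(1,3) unfolding in_state_def by metis
    have excl: "\<not> (in_state N \<nu> z X (swap_slots l \<pi>) \<and> in_state N \<nu> z X \<pi>)" if "\<pi> l < \<pi> i"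
      using in_state_species_unique[OF z _ _ l(1), of \<nu> X "swap_slots l \<pi>" \<pi>] s that by auto
    show ?thesis
    proof (cases "\<not> enters N \<nu> z X \<pi> i")
      case True
      then show ?thesis using E by (auto simp: inflow)
    next
      case False
      then consider "\<pi> l < \<pi> i" "in_state N \<nu> z X (swap_slots l \<pi>)" | "\<pi> l \<le> \<pi> i" "in_state N \<nu> z X \<pi>"
        using E by blast
      then show ?thesis
      proof cases
        case 1
        show ?thesis
          using unique[OF _ site[OF 1(2)]] False excl[OF 1(1)] 1 s by (simp add: inflow)
      next
        case 2
        show ?thesis
          using unique[OF _ site[OF 2(2)]] False excl 2 by (auto simp: inflow)
      qed
    qed
  next
    case False
    then have E: "enters N \<nu> z X \<pi> i \<longleftrightarrow> in_state N \<nu> z (X(i := X i - 1)) \<pi>"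
      unfolding enters_def by (rule if_not_P)
    show ?thesis
    proof (cases "enters N \<nu> z X \<pi> i")
      case True
      then have "\<exists>p\<in>{1..N}. z p = X i - 1 \<and> \<nu> p = \<pi> i"
        using i unfolding E in_state_def by (metis fun_upd_same)
      then show ?thesis using unique[OF True] True E by (simp add: inflow_gap[OF False])
    next
      case no: False
      then show ?thesis using E by (simp add: inflow_gap[OF False])
    qed
  qed
qed

lemma sum_attempt_in_state:
  fixes b :: "nat \<Rightarrow> real"
  assumes z: "inj_on z {1..N}" and X: "strict_mono_on {1..N} X"
  shows "(\<Sum>p=1..N. b (\<nu> p) * of_bool (in_state N \<nu> (attempt N \<nu> p z) X \<pi>)) =
    (\<Sum>i=1..N. inflow N b (\<lambda>X \<pi>. of_bool (in_state N \<nu> z X \<pi>)) X \<pi> i)"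
proof -
  have injX: "inj_on X {1..N}" using X by (rule strict_mono_on_imp_inj_on)
  have "b (\<nu> p) * of_bool (in_state N \<nu> (attempt N \<nu> p z) X \<pi>) =
      (\<Sum>i=1..N. if X i = z p + 1 \<and> enters N \<nu> z X \<pi> i then b (\<nu> p) else 0)" if p: "p \<in> {1..N}" for p
  proof (cases "\<exists>i\<in>{1..N}. X i = z p + 1")
    case True
    then obtain i where i: "i \<in> {1..N}" "X i = z p + 1" by blast
    have "(\<Sum>j=1..N. if X j = z p + 1 \<and> enters N \<nu> z X \<pi> j then b (\<nu> p) else 0) =
       (\<Sum>j=1..N. if j = i then b (\<nu> p) * of_bool (enters N \<nu> z X \<pi> i) else 0)"
    proof (rule sum.cong)
      fix j assume "j \<in> {1..N}"
      then have "X j = z p + 1 \<longleftrightarrow> j = i" using i injX by (metis inj_onD)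
      then show "(if X j = z p + 1 \<and> enters N \<nu> z X \<pi> j then b (\<nu> p) else 0) =
        (if j = i then b (\<nu> p) * of_bool (enters N \<nu> z X \<pi> i) else 0)" by auto
    qed simp
    also have "\<dots> = b (\<nu> p) * of_bool (enters N \<nu> z X \<pi> i)" using i(1) by simp
    finally show ?thesis by (simp only: in_state_attempt[OF z X p i])
  next
    case False
    then have "\<not> in_state N \<nu> (attempt N \<nu> p z) X \<pi>"
      using attempt_occupies_target[OF z p] in_state_particle[OF _ injX] by metis
    then show ?thesis using False by (auto intro!: sum.neutral[symmetric])
  qed
  then have "(\<Sum>p=1..N. b (\<nu> p) * of_bool (in_state N \<nu> (attempt N \<nu> p z) X \<pi>)) =
      (\<Sum>p=1..N. \<Sum>i=1..N. if X i = z p + 1 \<and> enters N \<nu> z X \<pi> i then b (\<nu> p) else 0)"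
    by (intro sum.cong) auto
  also have "\<dots> = (\<Sum>i=1..N. \<Sum>p=1..N. if X i = z p + 1 \<and> enters N \<nu> z X \<pi> i then b (\<nu> p) else 0)"
    by (rule sum.swap)
  also have "\<dots> = (\<Sum>i=1..N. inflow N b (\<lambda>X \<pi>. of_bool (in_state N \<nu> z X \<pi>)) X \<pi> i)"
    by (intro sum.cong enters_weight[OF z X]) auto
  finally show ?thesis .
qed

definition particle_lists :: "nat \<Rightarrow> nat \<Rightarrow> nat list set" where
  "particle_lists N n = {ps. set ps \<subseteq> {1..N} \<and> length ps = n}"

definition list_rate :: "(nat \<Rightarrow> real) \<Rightarrow> (nat \<Rightarrow> nat) \<Rightarrow> nat list \<Rightarrow> real" where
  "list_rate b \<nu> ps = (\<Prod>p\<leftarrow>ps. b (\<nu> p))"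

text \<open>
  All lists of length \<open>n\<close> share the same dependence on time, so only the product of rates and the
  outcome of the attempts enter here.
\<close>

definition attempt_weight ::
  "nat \<Rightarrow> (nat \<Rightarrow> real) \<Rightarrow> (nat \<Rightarrow> nat) \<Rightarrow> (nat \<Rightarrow> int) \<Rightarrow> nat \<Rightarrow> (nat \<Rightarrow> int) \<Rightarrow> (nat \<Rightarrow> nat) \<Rightarrow> real" where
  "attempt_weight N b \<nu> Y n X \<pi> =
    (\<Sum>ps\<in>particle_lists N n. list_rate b \<nu> ps * of_bool (in_state N \<nu> (fold (attempt N \<nu>) ps Y) X \<pi>))"

lemma finite_particle_lists: "finite (particle_lists N n)"
  unfolding particle_lists_def by (rule finite_lists_length_eq) simp

lemma sum_particle_lists_Suc:
  "(\<Sum>ps\<in>particle_lists N (Suc n). f ps) = (\<Sum>ps\<in>particle_lists N n. \<Sum>p=1..N. f (ps @ [p]))"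
proof -
  have "bij_betw (\<lambda>(ps, p). ps @ [p]) (particle_lists N n \<times> {1..N}) (particle_lists N (Suc n))"
  proof (rule bij_betw_imageI)
    show "inj_on (\<lambda>(ps, p). ps @ [p]) (particle_lists N n \<times> {1..N})" by (auto simp: inj_on_def)
    show "(\<lambda>(ps, p). ps @ [p]) ` (particle_lists N n \<times> {1..N}) = particle_lists N (Suc n)"
    proof (intro equalityI subsetI)
      fix qs assume qs: "qs \<in> particle_lists N (Suc n)"
      then obtain ps p where "qs = ps @ [p]" by (cases qs rule: rev_cases) (auto simp: particle_lists_def)
      then show "qs \<in> (\<lambda>(ps, p). ps @ [p]) ` (particle_lists N n \<times> {1..N})"
        using qs by (auto simp: particle_lists_def image_iff)
    qed (auto simp: particle_lists_def)
  qed
  from sum.reindex_bij_betw[OF this, of f] show ?thesis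
    by (simp add: sum.cartesian_product case_prod_beta)
qed

lemma inj_on_fold_attempt:
  "inj_on z {1..N} \<Longrightarrow> set ps \<subseteq> {1..N} \<Longrightarrow> inj_on (fold (attempt N \<nu>) ps z) {1..N}"
proof (induction ps arbitrary: z)
  case (Cons p ps)
  then show ?case using inj_on_attempt[of z N p \<nu>] by simp
qed simp

lemma inflow_sum:
  "(\<Sum>a\<in>A. c a * inflow N b (w a) X \<pi> i) = inflow N b (\<lambda>X \<pi>. \<Sum>a\<in>A. c a * w a X \<pi> :: real) X \<pi> i"
  by (auto simp: inflow_def sum_distrib_left sum.distrib algebra_simps)

text \<open>
Conditioning on the last attempt; attempts aimed at sites outside \<open>X\<close> cannot lead to \<open>(X, \<pi>)\<close> because the
site aimed at is occupied afterwards in any case.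
\<close>

lemma attempt_weight_Suc:
  assumes Y: "inj_on Y {1..N}" and X: "strict_mono_on {1..N} X"
  shows "attempt_weight N b \<nu> Y (Suc n) X \<pi> = (\<Sum>i=1..N. inflow N b (attempt_weight N b \<nu> Y n) X \<pi> i)"
proof -
  have "attempt_weight N b \<nu> Y (Suc n) X \<pi> = (\<Sum>ps\<in>particle_lists N n. list_rate b \<nu> ps *
     (\<Sum>p=1..N. b (\<nu> p) * of_bool (in_state N \<nu> (attempt N \<nu> p (fold (attempt N \<nu>) ps Y)) X \<pi>)))"
    by (simp add: attempt_weight_def sum_particle_lists_Suc list_rate_def sum_distrib_left mult_ac del: sum_mult_of_bool_eq sum_of_bool_mult_eq)
  also have "\<dots> = (\<Sum>ps\<in>particle_lists N n. \<Sum>i=1..N. list_rate b \<nu> ps *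
     inflow N b (\<lambda>X \<pi>. of_bool (in_state N \<nu> (fold (attempt N \<nu>) ps Y) X \<pi>)) X \<pi> i)"
  proof (rule sum.cong)
    fix ps assume "ps \<in> particle_lists N n"
    then have "inj_on (fold (attempt N \<nu>) ps Y) {1..N}"
      by (intro inj_on_fold_attempt[OF Y]) (simp add: particle_lists_def)
    from sum_attempt_in_state[OF this X] show "list_rate b \<nu> ps *
     (\<Sum>p=1..N. b (\<nu> p) * of_bool (in_state N \<nu> (attempt N \<nu> p (fold (attempt N \<nu>) ps Y)) X \<pi>)) =
     (\<Sum>i=1..N. list_rate b \<nu> ps * inflow N b (\<lambda>X \<pi>. of_bool (in_state N \<nu> (fold (attempt N \<nu>) ps Y) X \<pi>)) X \<pi> i)"
      by (simp add: sum_distrib_left)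
  qed simp
  also have "\<dots> = (\<Sum>i=1..N. inflow N b (attempt_weight N b \<nu> Y n) X \<pi> i)"
    by (subst sum.swap) (simp add: inflow_sum attempt_weight_def[abs_def])
  finally show ?thesis .
qed

lemma strict_mono_on_same_range:
  fixes X Y :: "nat \<Rightarrow> int"
  assumes "strict_mono_on {1..N} X" "strict_mono_on {1..N} Y" "X ` {1..N} \<subseteq> Y ` {1..N}" "i \<in> {1..N}"
  shows "X i = Y i"
proof -
  have sorted: "sorted (map Z [1..<Suc N])" "distinct (map Z [1..<Suc N])"
    if Z: "strict_mono_on {1..N} Z" for Z :: "nat \<Rightarrow> int"
  proof -
    have "sorted_wrt (<) (map Z [1..<Suc N])"
      using strict_mono_onD[OF Z] by (auto simp: sorted_wrt_iff_nth_less simp del: upt_Suc)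
    then show "sorted (map Z [1..<Suc N])" "distinct (map Z [1..<Suc N])"
      by (simp_all only: strict_sorted_iff)
  qed
  have "card (X ` {1..N}) = card (Y ` {1..N})"
    using assms(1,2)[THEN strict_mono_on_imp_inj_on] by (simp add: card_image)
  then have "X ` {1..N} = Y ` {1..N}" using assms(3) by (intro card_subset_eq) auto
  then have "set (map X [1..<Suc N]) = set (map Y [1..<Suc N])"
    by (simp add: atLeastLessThanSuc_atLeastAtMost del: upt_Suc)
  then have "map X [1..<Suc N] = map Y [1..<Suc N]"
    using sorted[OF assms(1)] sorted[OF assms(2)] by (intro sorted_distinct_set_unique)
  then show ?thesis using assms(4) by (simp add: map_eq_conv del: upt_Suc)
qed

lemma attempt_weight_0:
  assumes X: "strict_mono_on {1..N} X" and Y: "strict_mono_on {1..N} Y"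
  shows "attempt_weight N b \<nu> Y 0 X \<pi> = of_bool ((\<forall>i\<in>{1..N}. X i = Y i) \<and> same_word N \<pi> \<nu>)"
proof -
  have "in_state N \<nu> Y X \<pi> \<longleftrightarrow> (\<forall>i\<in>{1..N}. X i = Y i) \<and> same_word N \<pi> \<nu>"
  proof
    assume a: "in_state N \<nu> Y X \<pi>"
    then have "X ` {1..N} \<subseteq> Y ` {1..N}" unfolding in_state_def by (metis image_eqI image_subsetI)
    then have eq: "X i = Y i" if "i \<in> {1..N}" for i by (rule strict_mono_on_same_range[OF X Y _ that])
    moreover have "\<pi> i = \<nu> i" if i: "i \<in> {1..N}" for i
    proof -
      obtain p where "p \<in> {1..N}" "Y p = X i" "\<nu> p = \<pi> i" using a i unfolding in_state_def by blast
      then show ?thesis using eq[OF i] i strict_mono_on_imp_inj_on[OF Y] by (metis inj_onD)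
    qed
    ultimately show "(\<forall>i\<in>{1..N}. X i = Y i) \<and> same_word N \<pi> \<nu>" by (auto simp: same_word_def)
  qed (auto simp: in_state_def same_word_def)
  moreover have "particle_lists N 0 = {[]}" by (auto simp: particle_lists_def)
  ultimately show ?thesis by (simp add: attempt_weight_def list_rate_def)
qed

context contour begin

definition wave_weight :: "(nat \<Rightarrow> int) \<Rightarrow> (nat \<Rightarrow> nat) \<Rightarrow> complex" where
  "wave_weight X \<pi> = (\<Prod>i=1..N. complex_of_real (b (\<pi> i)) powi X i)"

definition bethe :: "(nat \<Rightarrow> nat) \<Rightarrow> (nat \<Rightarrow> int) \<Rightarrow> nat \<Rightarrow> (nat \<Rightarrow> int) \<Rightarrow> (nat \<Rightarrow> nat) \<Rightarrow> complex" where
  "bethe \<nu> Y n X \<pi> = (1 / (2 * of_real pi * \<i>)) ^ N * wave_weight X \<pi> * moment \<nu> Y n X \<pi> * wave_weight (\<lambda>i. - Y i) \<nu>"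

lemma wave_weight_shift:
  assumes "i \<in> {1..N}" "b (\<pi> i) > 0"
  shows "wave_weight (X(i := X i + k)) \<pi> = wave_weight X \<pi> * complex_of_real (b (\<pi> i)) powi k"
proof -
  have "wave_weight (X(i := X i + k)) \<pi> =
      complex_of_real (b (\<pi> i)) powi (X i + k) * (\<Prod>j\<in>{1..N} - {i}. complex_of_real (b (\<pi> j)) powi X j)"
    unfolding wave_weight_def using assms(1)
    by (subst prod.remove[of _ i]) (auto intro!: prod.cong arg_cong2[where f = "(*)"])
  also have "\<dots> = wave_weight X \<pi> * complex_of_real (b (\<pi> i)) powi k"
    unfolding wave_weight_def using assms
    by (subst (2) prod.remove[of _ i]) (auto simp: power_int_add)
  finally show ?thesis .
qed

lemma wave_weight_swap_slots:
  assumes "X (Suc l) = X l" "l \<in> {1..<N}"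
  shows "wave_weight X (swap_slots l \<pi>) = wave_weight X \<pi>"
proof -
  have "Transposition.transpose l (Suc l) permutes {1..N}"
    using assms(2) by (intro permutes_swap_id) auto
  moreover have "X (Transposition.transpose l (Suc l) i) = X i" for i
    using assms(1) by (simp add: Transposition.transpose_def)
  ultimately show ?thesis
    unfolding wave_weight_def swap_slots_def
    by (subst (2) prod.permute[of "Transposition.transpose l (Suc l)"]) (auto simp: o_def)
qed

text \<open>
Lowering the position in slot \<open>i\<close> may produce a collision with slot \<open>i - 1\<close>. The boundary condition then turns
the meaningless value at coinciding positions into exactly the blocked and interchanging attempts.
\<close>

lemma bethe_Suc:
  assumes pos: "\<And>i. i \<in> {1..N} \<Longrightarrow> b (\<pi> i) > 0"
  shows "bethe \<nu> Y (Suc n) X \<pi> = (\<Sum>i=1..N. inflow N b (bethe \<nu> Y n) X \<pi> i)"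
proof -
  define c where "c = (1 / (2 * of_real pi * \<i>)) ^ N * wave_weight (\<lambda>i. - Y i) \<nu>"
  have bethe: "bethe \<nu> Y n X \<pi> = c * (wave_weight X \<pi> * moment \<nu> Y n X \<pi>)" for n X \<pi>
    by (simp add: bethe_def c_def mult_ac)
  have "bethe \<nu> Y (Suc n) X \<pi> = (\<Sum>i=1..N. c * (wave_weight X \<pi> * moment \<nu> Y n (X(i := X i - 1)) \<pi>))"
    by (simp add: bethe moment_Suc sum_distrib_left)
  also have "\<dots> = (\<Sum>i=1..N. inflow N b (bethe \<nu> Y n) X \<pi> i)"
  proof (rule sum.cong)
    fix i assume i: "i \<in> {1..N}"
    define X0 where "X0 = X(i := X i - 1)"
    have X: "X = X0(i := X0 i + 1)" by (simp add: X0_def)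
    have W: "wave_weight X \<pi>' = wave_weight X0 \<pi>' * complex_of_real (b (\<pi>' i))" if "b (\<pi>' i) > 0" for \<pi>'
      using wave_weight_shift[where i = i and \<pi> = \<pi>' and X = X0 and k = 1] i that X by simp
    show "c * (wave_weight X \<pi> * moment \<nu> Y n (X(i := X i - 1)) \<pi>) = inflow N b (bethe \<nu> Y n) X \<pi> i"
    proof (cases "1 < i \<and> X (i - 1) = X i - 1")
      case True
      define l where "l = i - 1"
      have l: "l \<in> {1..<N}" "Suc l = i" "l \<noteq> i" using True i by (auto simp: l_def)
      have X0: "X0 (Suc l) = X0 l" using True l by (simp add: X0_def l_def)
      have bl: "b (\<pi> l) > 0" using l by (intro pos) auto
      have s: "swap_slots l \<pi> i = \<pi> l" using l by (auto simp: swap_slots_def)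
      have m: "moment \<nu> Y n X0 \<pi> =
         (if \<pi> l < \<pi> i then b (\<pi> l) * (moment \<nu> Y n X \<pi> + moment \<nu> Y n X (swap_slots l \<pi>))
          else if \<pi> l = \<pi> i then b (\<pi> l) * moment \<nu> Y n X \<pi> else 0)"
        using moment_boundary[of X0 l \<nu> Y n \<pi>, OF X0 l(1)] X l(2) by simp
      have W1: "wave_weight X \<pi> = wave_weight X0 \<pi> * complex_of_real (b (\<pi> i))" using W[of \<pi>] pos[OF i] by simp
      have W2: "wave_weight X (swap_slots l \<pi>) = wave_weight X0 \<pi> * complex_of_real (b (\<pi> l))"
        using W[of "swap_slots l \<pi>"] bl s wave_weight_swap_slots[of X0 l \<pi>, OF X0 l(1)] by simp
      show ?thesis
        using True l unfolding X0_def[symmetric] m bethe W1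
        by (subst inflow_adjacent[of l]) (auto simp: l_def[symmetric] bethe W1 W2 algebra_simps)
    next
      case False
      have "wave_weight X \<pi> = wave_weight X0 \<pi> * complex_of_real (b (\<pi> i))" using W[of \<pi>] pos[OF i] by simp
      then show ?thesis
        by (simp add: inflow_gap[OF False] X0_def[symmetric] bethe mult_ac)
    qed
  qed simp
  finally show ?thesis .
qed

lemma inflow_of_real:
  "complex_of_real (inflow N b w X \<pi> i) = inflow N b (\<lambda>X \<pi>. complex_of_real (w X \<pi>)) X \<pi> i"
  by (simp add: inflow_def)

lemma inflow_cong:
  assumes X: "strict_mono_on {1..N} X" and i: "i \<in> {1..N}" and \<pi>: "\<And>j. j \<in> {1..N} \<Longrightarrow> P (\<pi> j)"
    and eq: "\<And>X \<pi>. strict_mono_on {1..N} X \<Longrightarrow> (\<And>j. j \<in> {1..N} \<Longrightarrow> P (\<pi> j)) \<Longrightarrow> v X \<pi> = w X \<pi>"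
  shows "inflow N b v X \<pi> i = inflow N b w X \<pi> i"
proof (cases "1 < i \<and> X (i - 1) = X i - 1")
  case True
  define l where "l = i - 1"
  have l: "Suc l = i" "1 \<le> l" "X l = X i - 1" using True by (auto simp: l_def)
  have "P (\<pi> l)" "P (\<pi> (Suc l))" using l i by (auto intro: \<pi>)
  then have "P (swap_slots l \<pi> j)" if "j \<in> {1..N}" for j
    using \<pi>[OF that] by (auto simp: swap_slots_def Transposition.transpose_def)
  then have "v X (swap_slots l \<pi>) = w X (swap_slots l \<pi>)" by (rule eq[OF X])
  moreover have "v X \<pi> = w X \<pi>" by (rule eq[OF X \<pi>])
  ultimately show ?thesis by (simp add: inflow_adjacent[OF l])
next
  case False
  have "strict_mono_on {1..N} (X(i := X i - 1))"
  proof (rule strict_mono_onI)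
    fix r s :: nat assume rs: "r \<in> {1..N}" "s \<in> {1..N}" "r < s"
    have 1: "X r < X s" using rs by (intro strict_mono_onD[OF X])
    have 2: "X r \<noteq> X s - 1" if "s = i"
      using strict_mono_on_adjacent[OF X rs(2,1)] False rs that by auto
    show "(X(i := X i - 1)) r < (X(i := X i - 1)) s" using 1 2 rs by auto
  qed
  then have "v (X(i := X i - 1)) \<pi> = w (X(i := X i - 1)) \<pi>" by (rule eq[OF _ \<pi>])
  then show ?thesis by (simp add: inflow_gap[OF False])
qed

text \<open>
  Both sides start from the same initial condition and obey the same recursion on the
  number of attempts.
\<close>

theorem bethe_eq_attempt_weight:
  assumes Y: "strict_mono_on {1..N} Y" and \<nu>: "\<And>i. i \<in> {1..N} \<Longrightarrow> b (\<nu> i) > 0"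
    and "strict_mono_on {1..N} X" and "\<And>i. i \<in> {1..N} \<Longrightarrow> b (\<pi> i) > 0"
  shows "bethe \<nu> Y n X \<pi> = complex_of_real (attempt_weight N b \<nu> Y n X \<pi>)"
  using assms(3,4)
proof (induction n arbitrary: X \<pi>)
  case 0
  show ?case
  proof (cases "(\<forall>i\<in>{1..N}. X i = Y i) \<and> same_word N \<pi> \<nu>")
    case True
    have "wave_weight X \<pi> * wave_weight (\<lambda>i. - Y i) \<nu> = (\<Prod>i=1..N. 1)"
      unfolding wave_weight_def prod.distrib[symmetric]
      by (rule prod.cong) (use True \<nu> in \<open>force simp: same_word_def power_int_minus\<close>)+
    then show ?thesis
      using True by (simp add: bethe_def moment_0[OF 0(1) Y] attempt_weight_0[OF 0(1) Y] power_one_over field_simps)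
  next
    case False
    then show ?thesis by (auto simp: bethe_def moment_0[OF 0(1) Y] attempt_weight_0[OF 0(1) Y])
  qed
next
  case (Suc n)
  have "bethe \<nu> Y (Suc n) X \<pi> = (\<Sum>i=1..N. inflow N b (bethe \<nu> Y n) X \<pi> i)"
    by (rule bethe_Suc) (rule Suc.prems)
  also have "\<dots> = (\<Sum>i=1..N. inflow N b (\<lambda>X \<pi>. complex_of_real (attempt_weight N b \<nu> Y n X \<pi>)) X \<pi> i)"
    by (intro sum.cong refl inflow_cong[where P = "\<lambda>j. b j > 0", OF Suc.prems(1) _ Suc.prems(2) Suc.IH])
  also have "\<dots> = complex_of_real (attempt_weight N b \<nu> Y (Suc n) X \<pi>)"
    unfolding attempt_weight_Suc[OF strict_mono_on_imp_inj_on[OF Y] Suc.prems(1)] of_real_sum inflow_of_real ..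
  finally show ?case .
qed

end

section \<open>The law of the sequence of attempts\<close>

text \<open>
Up to time \<open>t\<close> the attempts after time \<open>u\<close> are made by the particles in the given list, in this order.
The last attempt of particle \<open>q\<close> so far was its \<open>k q\<close>-th one and took place at time \<open>c q\<close>. In the
recursion only the attempting particle consumes a waiting time, so the
waiting times can be integrated out one after another.
\<close>

primrec attempts_are ::
  "nat \<Rightarrow> real \<Rightarrow> nat list \<Rightarrow> real \<Rightarrow> (nat \<Rightarrow> real) \<Rightarrow> (nat \<Rightarrow> nat) \<Rightarrow> (nat \<times> nat \<Rightarrow> real) \<Rightarrow> bool" where
  "attempts_are N t [] u c k w \<longleftrightarrow> (\<forall>q\<in>{1..N}. t < c q + w (q, k q))"
| "attempts_are N t (p # ps) u c k w \<longleftrightarrow> u < c p + w (p, k p) \<and> c p + w (p, k p) \<le> t \<and>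
     attempts_are N t ps (c p + w (p, k p)) (c(p := c p + w (p, k p))) (k(p := Suc (k p))) w"

text \<open>
The waiting times on which \<^const>\<open>attempts_are\<close> depends.
\<close>

definition remaining :: "nat \<Rightarrow> (nat \<Rightarrow> nat) \<Rightarrow> (nat \<times> nat) set" where
  "remaining N k = {(p, n). p \<in> {1..N} \<and> k p \<le> n}"

definition exp_times :: "(nat \<Rightarrow> real) \<Rightarrow> nat \<times> nat \<Rightarrow> real measure" where
  "exp_times r = (\<lambda>(p, n). density lborel (exponential_density (r p)))"

lemma remaining_Suc:
  "p \<in> {1..N} \<Longrightarrow> remaining N k = insert (p, k p) (remaining N (k(p := Suc (k p))))"
  by (auto simp: remaining_def split: if_splits)

lemma remaining_Suc_notin: "(p, k p) \<notin> remaining N (k(p := Suc (k p)))"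
  by (auto simp: remaining_def)

lemma attempts_are_cong:
  assumes "\<And>x. x \<in> remaining N k \<Longrightarrow> w x = w' x" "set ps \<subseteq> {1..N}"
  shows "attempts_are N t ps u c k w \<longleftrightarrow> attempts_are N t ps u c k w'"
  using assms
proof (induction ps arbitrary: u c k)
  case Nil
  then show ?case by (auto simp: remaining_def)
next
  case (Cons p ps)
  have "w (p, k p) = w' (p, k p)" using Cons.prems by (auto simp: remaining_def)
  moreover have "attempts_are N t ps u c (k(p := Suc (k p))) w \<longleftrightarrow> attempts_are N t ps u c (k(p := Suc (k p))) w'" for u c
    by (rule Cons.IH) (use Cons.prems remaining_Suc[of p N k] in \<open>auto simp del: fun_upd_apply\<close>)
  ultimately show ?case by simp
qed

lemma attempts_are_measurable:
  assumes "u \<in> borel_measurable M" "\<And>q. c q \<in> borel_measurable M"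
    "\<And>x. x \<in> remaining N k \<Longrightarrow> (\<lambda>y. W y x) \<in> borel_measurable M" "set ps \<subseteq> {1..N}"
  shows "Measurable.pred M (\<lambda>y. attempts_are N t ps (u y) (\<lambda>q. c q y) k (W y))"
  using assms
proof (induction ps arbitrary: u c k)
  case Nil
  have "(\<lambda>y. W y (q, k q)) \<in> borel_measurable M" if "q \<in> {1..N}" for q
    using Nil.prems(3) that by (simp add: remaining_def)
  note [measurable] = this Nil.prems(2)
  show ?case by simp
next
  case (Cons p ps)
  have p: "p \<in> {1..N}" using Cons.prems by auto
  have [measurable]: "(\<lambda>y. W y (p, k p)) \<in> borel_measurable M"
    using Cons.prems(3) p by (simp add: remaining_def)
  note [measurable] = Cons.prems(1,2)
  have "Measurable.pred M (\<lambda>y. attempts_are N t ps (c p y + W y (p, k p))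
      (\<lambda>q. (if q = p then (\<lambda>y. c p y + W y (p, k p)) else c q) y) (k(p := Suc (k p))) (W y))"
  proof (rule Cons.IH)
    fix x assume "x \<in> remaining N (k(p := Suc (k p)))"
    then show "(\<lambda>y. W y x) \<in> borel_measurable M"
      by (intro Cons.prems(3)) (simp add: remaining_Suc[OF p, of k] del: fun_upd_apply)
  qed (use Cons.prems in auto)
  moreover have "(\<lambda>q. (if q = p then (\<lambda>y. c p y + W y (p, k p)) else c q) y) =
      (\<lambda>q. c q y)(p := c p y + W y (p, k p))" for y
    by (auto simp: fun_eq_iff)
  ultimately have [measurable]: "Measurable.pred M (\<lambda>y. attempts_are N t ps (c p y + W y (p, k p))
      ((\<lambda>q. c q y)(p := c p y + W y (p, k p))) (k(p := Suc (k p))) (W y))" by simp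
  show ?case by simp
qed

lemma emeasure_exponential_gt:
  assumes "r > 0" "a \<ge> 0"
  shows "emeasure (density lborel (exponential_density r)) {a<..} = ennreal (exp (- r * a))"
proof -
  interpret prob_space "density lborel (exponential_density r)"
    by (rule prob_space_exponential_density) fact
  have "distributed (density lborel (exponential_density r)) lborel (\<lambda>x. x) (exponential_density r)"
    by (simp add: distributed_def distr_id2 sets_lborel)
  from exponential_distributedD_gt[OF this assms(2,1)]
  show ?thesis by (simp add: emeasure_eq_measure greaterThan_def mult.commute)
qed

lemma nn_integral_polynomial:
  fixes a d :: real
  assumes "a \<le> d" "C \<ge> 0"
  shows "(\<integral>\<^sup>+x. ennreal (C * (d - x) ^ n / fact n) * indicator {a<..d} x \<partial>lborel) = ennreal (C * (d - a) ^ Suc n / fact (Suc n))"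
proof -
  have "(\<integral>\<^sup>+x. ennreal (C * (d - x) ^ n / fact n) * indicator {a<..d} x \<partial>lborel) =
      (\<integral>\<^sup>+x. ennreal (C * (d - x) ^ n / fact n) * indicator {a..d} x \<partial>lborel)"
    by (rule nn_integral_cong_AE) (use AE_lborel_singleton[of a] in \<open>eventually_elim; auto split: split_indicator\<close>)
  also have "\<dots> = ennreal ((- (C * (d - d) ^ Suc n / fact (Suc n))) - (- (C * (d - a) ^ Suc n / fact (Suc n))))"
  proof (rule nn_integral_FTC_Icc)
    fix x assume "x \<in> {a..d}"
    have "((\<lambda>x. - (C * (d - x) ^ Suc n / fact (Suc n))) has_real_derivative
        - (C * (of_nat (Suc n) * (0 - 1) * (d - x) ^ n) / fact (Suc n))) (at x)"
      by (auto intro!: derivative_eq_intros simp del: power_Suc of_nat_Suc fact_Suc)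
    moreover have "- (C * (of_nat (Suc n) * (0 - 1) * (d - x) ^ n) / fact (Suc n)) = C * (d - x) ^ n / fact n"
      by (simp add: field_simps del: of_nat_Suc)
    ultimately show "((\<lambda>x. - (C * (d - x) ^ Suc n / fact (Suc n))) has_real_derivative C * (d - x) ^ n / fact n) (at x)"
      by simp
  qed (use assms in auto)
  finally show ?thesis by simp
qed

text \<open>
  Given the times \<open>c q\<close> of the last attempts, integrating out the next attempt of \<open>p\<close> turns
  the density \<open>r p * exp (- r p * x)\<close> and the exponential factor of the remaining
  attempts into a constant; only the simplex volume \<open>(t - u) ^ n / fact n\<close> remains.
\<close>

lemma emeasure_attempts_are:
  assumes r: "\<And>p. p \<in> {1..N} \<Longrightarrow> r p > 0"
    and "set ps \<subseteq> {1..N}" "\<And>q. q \<in> {1..N} \<Longrightarrow> c q \<le> u" "u \<le> t"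
  shows "emeasure (PiM (remaining N k) (exp_times r))
      {w \<in> space (PiM (remaining N k) (exp_times r)). attempts_are N t ps u c k w} =
    ennreal ((\<Prod>p\<leftarrow>ps. r p) * (t - u) ^ length ps / fact (length ps) * exp (- (\<Sum>q=1..N. r q * (t - c q))))"
  using assms(2-)
proof (induction ps arbitrary: u c k)
  case Nil
  have prob: "prob_space (exp_times r x)" if "x \<in> remaining N k" for x
    using that r by (auto simp: exp_times_def remaining_def intro!: prob_space_exponential_density)
  define J where "J = (\<lambda>q. (q, k q)) ` {1..N}"
  define A where "A = (\<lambda>x :: nat \<times> nat. {t - c (fst x)<..})"
  have "{w \<in> space (PiM (remaining N k) (exp_times r)). attempts_are N t [] u c k w} =
      prod_emb (remaining N k) (exp_times r) J (Pi\<^sub>E J A)"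
    by (auto simp: prod_emb_def space_PiM J_def A_def PiE_iff restrict_def extensional_def algebra_simps)
  then have "emeasure (PiM (remaining N k) (exp_times r))
      {w \<in> space (PiM (remaining N k) (exp_times r)). attempts_are N t [] u c k w} =
      (\<Prod>x\<in>J. emeasure (exp_times r x) (A x))"
    by (simp only:) (rule emeasure_PiM_emb[OF prob], auto simp: J_def A_def remaining_def exp_times_def)
  also have "\<dots> = (\<Prod>q=1..N. emeasure (exp_times r (q, k q)) (A (q, k q)))"
    unfolding J_def by (rule prod.reindex_cong[of "\<lambda>q. (q, k q)"]) (auto simp: inj_on_def)
  also have "\<dots> = (\<Prod>q=1..N. ennreal (exp (- (r q * (t - c q)))))"
  proof (rule prod.cong)
    fix q assume q: "q \<in> {1..N}"
    then have "t - c q \<ge> 0" using Nil.prems(2)[of q] Nil.prems(3) by simp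
    then show "emeasure (exp_times r (q, k q)) (A (q, k q)) = ennreal (exp (- (r q * (t - c q))))"
      using emeasure_exponential_gt[OF r[OF q]] by (simp add: exp_times_def A_def)
  qed simp
  also have "\<dots> = ennreal (exp (- (\<Sum>q=1..N. r q * (t - c q))))"
    by (simp add: prod_ennreal exp_sum[symmetric] sum_negf)
  finally show ?case by simp
next
  case (Cons p ps)
  have p: "p \<in> {1..N}" using Cons.prems by auto
  define k' where "k' = k(p := Suc (k p))"
  define i where "i = (p, k p)"
  define M where "M = PiM (remaining N k') (exp_times r)"
  define E where "E = density lborel (exponential_density (r p))"
  have prob: "prob_space (exp_times r x)" if "x \<in> remaining N k'" for x
    using that r by (auto simp: exp_times_def remaining_def intro!: prob_space_exponential_density)
  have E: "exp_times r i = E" by (simp add: exp_times_def i_def E_def)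
  have probE: "prob_space E" unfolding E_def by (rule prob_space_exponential_density[OF r[OF p]])
  interpret M: prob_space M unfolding M_def by (rule prob_space_PiM) (rule prob)
  interpret E: prob_space E by (rule probE)
  have ins: "remaining N k = insert i (remaining N k')" unfolding i_def k'_def by (rule remaining_Suc[OF p])
  have i_notin: "i \<notin> remaining N k'" unfolding i_def k'_def by (rule remaining_Suc_notin)
  define S where "S = {w \<in> space (PiM (remaining N k) (exp_times r)). attempts_are N t (p # ps) u c k w}"
  have comp: "(\<lambda>y. y x) \<in> borel_measurable (PiM (remaining N k) (exp_times r))" if "x \<in> remaining N k" for x
    using measurable_component_singleton[OF that, of "exp_times r"] by (auto simp: exp_times_def case_prod_beta)
  have "Measurable.pred (PiM (remaining N k) (exp_times r)) (attempts_are N t (p # ps) u c k)"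
    by (rule attempts_are_measurable[where u = "\<lambda>_. u" and c = "\<lambda>q _. c q" and W = "\<lambda>y. y"])
       (use Cons.prems(1) comp in auto)
  then have S: "S \<in> sets (PiM (insert i (remaining N k')) (exp_times r))"
    unfolding S_def pred_def ins by simp
  have upd: "(\<lambda>(x, X). X(i := x)) \<in> measurable (E \<Otimes>\<^sub>M M) (PiM (insert i (remaining N k')) (exp_times r))"
    unfolding M_def case_prod_beta
    by (rule measurable_fun_upd[where J = "remaining N k'"]) (auto simp: E)
  have "emeasure (PiM (remaining N k) (exp_times r)) S =
      emeasure (distr (E \<Otimes>\<^sub>M M) (PiM (insert i (remaining N k')) (exp_times r)) (\<lambda>(x, X). X(i := x))) S"
    unfolding M_def E[symmetric] ins
    by (subst distr_pair_PiM_eq_PiM) (use prob probE E in auto)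
  also have "\<dots> = emeasure (E \<Otimes>\<^sub>M M) ((\<lambda>(x, X). X(i := x)) -` S \<inter> space (E \<Otimes>\<^sub>M M))"
    by (rule emeasure_distr[OF upd S])
  also have "\<dots> = (\<integral>\<^sup>+x. emeasure M (Pair x -` ((\<lambda>(x, X). X(i := x)) -` S \<inter> space (E \<Otimes>\<^sub>M M))) \<partial>E)"
    by (rule M.emeasure_pair_measure_alt) (rule measurable_sets[OF upd S])
  also have "\<dots> = (\<integral>\<^sup>+x. indicator {u - c p<..t - c p} x * ennreal ((\<Prod>p\<leftarrow>ps. r p) * (t - (c p + x)) ^ length ps / fact (length ps) *
      exp (- (\<Sum>q=1..N. r q * (t - (c(p := c p + x)) q)))) \<partial>E)"
  proof (rule nn_integral_cong)
    fix x assume "x \<in> space E"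
    have mem: "y(i := x) \<in> space (PiM (remaining N k) (exp_times r)) \<longleftrightarrow> y \<in> space M" if "y \<in> space M" for y
      using that unfolding M_def ins by (auto simp: space_PiM PiE_iff extensional_def exp_times_def case_prod_beta)
    have slice: "Pair x -` ((\<lambda>(x, X). X(i := x)) -` S \<inter> space (E \<Otimes>\<^sub>M M)) =
      {y \<in> space M. x \<in> {u - c p<..t - c p} \<and> attempts_are N t ps (c p + x) (c(p := c p + x)) k' y}"
    proof -
      have "attempts_are N t ps (c p + x) (c(p := c p + x)) k' (y(i := x)) \<longleftrightarrow>
          attempts_are N t ps (c p + x) (c(p := c p + x)) k' y" for y
        by (rule attempts_are_cong) (use i_notin Cons.prems in auto)
      then have "attempts_are N t (p # ps) u c k (y(i := x)) \<longleftrightarrow>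
        x \<in> {u - c p<..t - c p} \<and> attempts_are N t ps (c p + x) (c(p := c p + x)) k' y" for y
        by (auto simp: i_def k'_def)
      then show ?thesis
        using mem \<open>x \<in> space E\<close> unfolding S_def by (auto simp: space_pair_measure)
    qed
    show "emeasure M (Pair x -` ((\<lambda>(x, X). X(i := x)) -` S \<inter> space (E \<Otimes>\<^sub>M M))) =
      indicator {u - c p<..t - c p} x * ennreal ((\<Prod>p\<leftarrow>ps. r p) * (t - (c p + x)) ^ length ps / fact (length ps) *
      exp (- (\<Sum>q=1..N. r q * (t - (c(p := c p + x)) q))))"
    proof (cases "x \<in> {u - c p<..t - c p}")
      case True
      have "emeasure M {y \<in> space M. attempts_are N t ps (c p + x) (c(p := c p + x)) k' y} =
        ennreal ((\<Prod>p\<leftarrow>ps. r p) * (t - (c p + x)) ^ length ps / fact (length ps) *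
          exp (- (\<Sum>q=1..N. r q * (t - (c(p := c p + x)) q))))"
        unfolding M_def
      proof (rule Cons.IH)
        fix q assume "q \<in> {1..N}"
        then show "(c(p := c p + x)) q \<le> c p + x" using Cons.prems(2)[of q] True by auto
      qed (use Cons.prems True in auto)
      then show ?thesis unfolding slice using True by simp
    next
      case False
      then have empty: "{y \<in> space M. x \<in> {u - c p<..t - c p} \<and> Q y} = {}" for Q by blast
      show ?thesis unfolding slice empty using False by simp
    qed
  qed
  also have "\<dots> = (\<integral>\<^sup>+x. ennreal ((\<Prod>p\<leftarrow>p # ps. r p) * exp (- (\<Sum>q=1..N. r q * (t - c q))) * (t - c p - x) ^ length ps / fact (length ps)) *
      indicator {u - c p<..t - c p} x \<partial>lborel)"
  proof -
    have *: "ennreal (exponential_density (r p) x) * (indicator {u - c p<..t - c p} x *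
          ennreal ((\<Prod>p\<leftarrow>ps. r p) * (t - (c p + x)) ^ length ps / fact (length ps) *
            exp (- (\<Sum>q=1..N. r q * (t - (c(p := c p + x)) q))))) =
        ennreal ((\<Prod>p\<leftarrow>p # ps. r p) * exp (- (\<Sum>q=1..N. r q * (t - c q))) * (t - c p - x) ^ length ps / fact (length ps)) *
          indicator {u - c p<..t - c p} x" for x
    proof (cases "x \<in> {u - c p<..t - c p}")
      case True
      then have x: "x \<ge> 0" using Cons.prems(2)[OF p] by auto
      have "(\<Sum>q=1..N. r q * (t - (c(p := c p + x)) q)) = r p * (t - (c p + x)) + (\<Sum>q\<in>{1..N} - {p}. r q * (t - c q))"
        using p by (subst sum.remove[of _ p]) auto
      moreover have "(\<Sum>q=1..N. r q * (t - c q)) = r p * (t - c p) + (\<Sum>q\<in>{1..N} - {p}. r q * (t - c q))"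
        using p by (subst sum.remove[of _ p]) auto
      ultimately have "exp (- (\<Sum>q=1..N. r q * (t - c q))) =
          exp (- x * r p) * exp (- (\<Sum>q=1..N. r q * (t - (c(p := c p + x)) q)))"
        by (simp add: exp_add[symmetric] algebra_simps)
      then have "(\<Prod>p\<leftarrow>p # ps. r p) * exp (- (\<Sum>q=1..N. r q * (t - c q))) * (t - c p - x) ^ length ps / fact (length ps) =
        exponential_density (r p) x * ((\<Prod>p\<leftarrow>ps. r p) * (t - (c p + x)) ^ length ps / fact (length ps) *
            exp (- (\<Sum>q=1..N. r q * (t - (c(p := c p + x)) q))))"
        using x by (simp add: exponential_density_def diff_diff_eq)
      then show ?thesis using True x r[OF p]
        by (simp only: indicator_simps mult_1 mult_1_right) (subst ennreal_mult', auto simp: exponential_density_def)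
    qed simp
    have sums: "(\<lambda>x. \<Sum>q=1..N. r q * (t - (c(p := c p + x)) q)) \<in> borel_measurable borel"
      by (auto intro!: borel_measurable_sum)
    note [measurable] = sums
    show ?thesis
      unfolding E_def *[symmetric] by (rule nn_integral_density) measurable
  qed
  also have "\<dots> = ennreal ((\<Prod>p\<leftarrow>p # ps. r p) * exp (- (\<Sum>q=1..N. r q * (t - c q))) * (t - c p - (u - c p)) ^ Suc (length ps) / fact (Suc (length ps)))"
  proof (rule nn_integral_polynomial)
    have "(\<Prod>p\<leftarrow>qs. r p) \<ge> 0" if "set qs \<subseteq> {1..N}" for qs
      using that by (induction qs) (auto intro!: mult_nonneg_nonneg less_imp_le[OF r])
    then show "(\<Prod>p\<leftarrow>p # ps. r p) * exp (- (\<Sum>q=1..N. r q * (t - c q))) \<ge> 0"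
      using Cons.prems(1) by (intro mult_nonneg_nonneg) (auto simp del: list.map)
  qed (use Cons.prems in auto)
  finally show ?case by (simp add: S_def mult_ac)
qed

section \<open>Transition probabilities as a series\<close>

primrec attempt_keys :: "nat list \<Rightarrow> (nat \<Rightarrow> nat) \<Rightarrow> (nat \<times> nat) list" where
  "attempt_keys [] k = []"
| "attempt_keys (p # ps) k = (p, k p) # attempt_keys ps (k(p := Suc (k p)))"

lemma map_fst_attempt_keys [simp]: "map fst (attempt_keys ps k) = ps"
  by (induction ps arbitrary: k) simp_all

lemma attempt_time_mono:
  assumes "\<And>n. w (p, n) \<ge> 0" "m \<le> n"
  shows "attempt_time w (p, m) \<le> attempt_time w (p, n)"
  using assms by (simp add: attempt_time_def sum_mono2)

text \<open>
Waiting times beyond the last one mentioned in \<^const>\<open>attempts_are\<close> are constrained only by being nonnegative;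
this suffices for them to lie after \<open>t\<close>.
\<close>

lemma attempts_are_keys:
  assumes nonneg: "\<And>p n. p \<in> {1..N} \<Longrightarrow> w (p, n) \<ge> 0"
    and "set ps \<subseteq> {1..N}" "attempts_are N t ps u c k w"
    and "\<And>q. q \<in> {1..N} \<Longrightarrow> attempt_time w (q, k q) = c q + w (q, k q)"
  shows "set (attempt_keys ps k) = {x \<in> remaining N k. attempt_time w x \<le> t} \<and>
    sorted_wrt (<) (map (attempt_time w) (attempt_keys ps k)) \<and>
    (\<forall>x\<in>set (attempt_keys ps k). u < attempt_time w x)"
  using assms(2-)
proof (induction ps arbitrary: u c k)
  case Nil
  have "\<not> attempt_time w x \<le> t" if "x \<in> remaining N k" for x
  proof -
    obtain p n where x: "x = (p, n)" "p \<in> {1..N}" "k p \<le> n" using that \<open>x \<in> remaining N k\<close> by (auto simp: remaining_def)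
    then have "attempt_time w (p, k p) \<le> attempt_time w x" using nonneg attempt_time_mono by blast
    moreover have "t < attempt_time w (p, k p)" using Nil.prems(2) Nil.prems(3)[OF x(2)] x(2) by simp
    ultimately show ?thesis by simp
  qed
  then show ?case by auto
next
  case (Cons p ps)
  have p: "p \<in> {1..N}" using Cons.prems by auto
  define k' where "k' = k(p := Suc (k p))"
  define s where "s = c p + w (p, k p)"
  have s: "attempt_time w (p, k p) = s" "u < s" "s \<le> t"
    using Cons.prems(2,3) p by (auto simp: s_def)
  have IH: "set (attempt_keys ps k') = {x \<in> remaining N k'. attempt_time w x \<le> t} \<and>
    sorted_wrt (<) (map (attempt_time w) (attempt_keys ps k')) \<and> (\<forall>x\<in>set (attempt_keys ps k'). s < attempt_time w x)"
  proof (rule Cons.IH)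
    fix q assume q: "q \<in> {1..N}"
    show "attempt_time w (q, k' q) = (c(p := s)) q + w (q, k' q)"
    proof (cases "q = p")
      case True
      have "attempt_time w (p, Suc (k p)) = attempt_time w (p, k p) + w (p, Suc (k p))"
        by (simp add: attempt_time_def)
      then show ?thesis using True s by (simp add: k'_def)
    qed (use Cons.prems(3) q in \<open>simp add: k'_def\<close>)
  qed (use Cons.prems in \<open>auto simp: k'_def s_def simp del: fun_upd_apply\<close>)
  have keys: "attempt_keys (p # ps) k = (p, k p) # attempt_keys ps k'" by (simp add: k'_def)
  have set: "set (attempt_keys (p # ps) k) = {x \<in> remaining N k. attempt_time w x \<le> t}"
    unfolding keys remaining_Suc[OF p, of k] using IH s by (auto simp: k'_def)
  have "\<forall>x\<in>set (attempt_keys ps k'). u < attempt_time w x"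
    using IH s(2) by (meson less_trans)
  then have "\<forall>x\<in>set (attempt_keys (p # ps) k). u < attempt_time w x"
    unfolding keys using s by simp
  moreover have "sorted_wrt (<) (map (attempt_time w) (attempt_keys (p # ps) k))"
    unfolding keys using IH s(1) by simp
  ultimately show ?case using set by blast
qed

text \<open>
The equation covers keys with ties, for which \<^const>\<open>sorted_key_list_of_set\<close> has no other description.
\<close>

lemma sorted_key_list_of_set_fold:
  "sorted_key_list_of_set f A = Finite_Set.fold (insort_key f) [] A"
proof -
  have "folding_on {} (insort_key f)" by unfold_locales simp
  from folding_on.eq_fold[OF this] show ?thesis by (simp add: sorted_key_list_of_set_def)
qed

lemma sorted_key_list_of_set_eq:
  fixes f :: "'b \<Rightarrow> 'a::linorder"
  assumes "sorted_wrt (<) (map f l)"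
  shows "sorted_key_list_of_set f (set l) = l"
proof -
  have d: "distinct (map f l)" using assms by (simp add: strict_sorted_iff)
  interpret folding_insort_key "(\<le>)" "(<)" "set l" f
    by unfold_locales (use d in \<open>simp add: distinct_map\<close>)
  have "linorder.insort_key (\<le>) f x ys = insort_key f x ys" for x ys
    by (induction ys) (simp_all add: linorder.insort_key.simps[OF linorder_class.linorder_axioms])
  then have "linorder.insort_key (\<le>) f = insort_key f" by (intro ext)
  then have eq: "sorted_key_list_of_set f = linorder.sorted_key_list_of_set (\<le>) f"
    unfolding sorted_key_list_of_set_def linorder.sorted_key_list_of_set_def[OF linorder_class.linorder_axioms] by simp
  show ?thesis
    unfolding eq by (rule idem_if_sorted_distinct) (use assms d in \<open>auto simp: distinct_map strict_sorted_iff\<close>)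
qed

lemma config_at_attempts_are:
  assumes "\<And>p n. p \<in> {1..N} \<Longrightarrow> w (p, n) \<ge> 0" "set ps \<subseteq> {1..N}"
    and "attempts_are N t ps 0 (\<lambda>_. 0) (\<lambda>_. 0) w"
  shows "config_at N \<nu> Y w t = fold (attempt N \<nu>) ps Y"
    and "ps = map fst (sorted_key_list_of_set (attempt_time w) {(p, n). p \<in> {1..N} \<and> attempt_time w (p, n) \<le> t})"
proof -
  let ?l = "attempt_keys ps (\<lambda>_. 0)"
  have l: "set ?l = {x \<in> remaining N (\<lambda>_. 0). attempt_time w x \<le> t}" "sorted_wrt (<) (map (attempt_time w) ?l)"
    using attempts_are_keys[OF assms(1-3)] by (auto simp: attempt_time_def)
  have "{x \<in> remaining N (\<lambda>_. 0). attempt_time w x \<le> t} = {(p, n). p \<in> {1..N} \<and> attempt_time w (p, n) \<le> t}"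
    by (auto simp: remaining_def)
  then have s: "sorted_key_list_of_set (attempt_time w) {(p, n). p \<in> {1..N} \<and> attempt_time w (p, n) \<le> t} = ?l"
    using sorted_key_list_of_set_eq[OF l(2)] l(1) by simp
  have split: "fold (\<lambda>(p, n). attempt N \<nu> p) l z = fold (attempt N \<nu>) (map fst l) z" for l z
    by (induction l arbitrary: z) auto
  then show "config_at N \<nu> Y w t = fold (attempt N \<nu>) ps Y"
    unfolding config_at_def s by (simp only: split map_fst_attempt_keys)
  show "ps = map fst (sorted_key_list_of_set (attempt_time w) {(p, n). p \<in> {1..N} \<and> attempt_time w (p, n) \<le> t})"
    unfolding s by simp
qed

subsection \<open>Measurability\<close>

lemma insort_key_cong:
  "(\<And>y. y \<in> set ys \<Longrightarrow> f x \<le> f y \<longleftrightarrow> g x \<le> g y) \<Longrightarrow> insort_key f x ys = insort_key g x ys"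
  by (induction ys) auto

lemma fold_graph_insort_key:
  assumes "fold_graph (insort_key f) [] B ys" "\<And>x y. x \<in> B \<Longrightarrow> y \<in> B \<Longrightarrow> f x \<le> f y \<longleftrightarrow> g x \<le> g y"
  shows "fold_graph (insort_key g) [] B ys \<and> set ys = B"
  using assms
proof (induction rule: fold_graph.induct)
  case emptyI
  show ?case by (simp add: fold_graph.emptyI)
next
  case (insertI x A y)
  then have IH: "fold_graph (insort_key g) [] A y" "set y = A" by auto
  then have "insort_key f x y = insort_key g x y" using insertI.prems by (intro insort_key_cong) auto
  then show ?case using fold_graph.insertI[OF insertI.hyps(1) IH(1)] IH(2) by (auto simp: set_insort_key)
qed

lemma sorted_key_list_of_set_cong:
  fixes f :: "'b \<Rightarrow> 'a::linorder" and g :: "'b \<Rightarrow> 'c::linorder"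
  assumes "\<And>x y. x \<in> A \<Longrightarrow> y \<in> A \<Longrightarrow> f x \<le> f y \<longleftrightarrow> g x \<le> g y"
  shows "sorted_key_list_of_set f A = sorted_key_list_of_set g A"
proof -
  have "fold_graph (insort_key f) [] A = fold_graph (insort_key g) [] A"
    using fold_graph_insort_key[of f A _ g] fold_graph_insort_key[of g A _ f] assms by (intro ext) blast
  then show ?thesis by (simp add: sorted_key_list_of_set_fold Finite_Set.fold_def)
qed

text \<open>
  Ties and accumulating attempts are null events, but they have to be measurable. The configuration
  depends only on the finite set of attempts up to \<open>t\<close> and on the preorder of their times.
\<close>

lemma config_at_measurable:
  assumes comp: "\<And>p n. p \<in> {1..N} \<Longrightarrow> (\<lambda>w. w (p, n)) \<in> borel_measurable M"
  shows "{w \<in> space M. P (config_at N \<nu> Y w t)} \<in> sets M"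
proof -
  define A where "A w = {(p, n). p \<in> {1..N} \<and> attempt_time w (p, n) \<le> t}" for w
  define R where "R w = {(x, y). x \<in> A w \<and> y \<in> A w \<and> attempt_time w x \<le> attempt_time w y}" for w
  define I :: "(nat \<times> nat) set" where "I = {1..N} \<times> UNIV"
  define K where "K = (SIGMA B:{B. finite B \<and> B \<subseteq> I}. Pow (B \<times> B))"
  have config_key: "config_at N \<nu> Y w t = config_at N \<nu> Y w' t" if "A w = A w'" "R w = R w'" for w w'
  proof -
    have "attempt_time w x \<le> attempt_time w y \<longleftrightarrow> attempt_time w' x \<le> attempt_time w' y"
      if "x \<in> A w" "y \<in> A w" for x y
    proof -
      have "(x, y) \<in> R w \<longleftrightarrow> (x, y) \<in> R w'" using \<open>R w = R w'\<close> by simp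
      then show ?thesis using that \<open>A w = A w'\<close> unfolding R_def by auto
    qed
    then have "sorted_key_list_of_set (attempt_time w) (A w) = sorted_key_list_of_set (attempt_time w') (A w')"
      unfolding \<open>A w = A w'\<close>[symmetric] by (rule sorted_key_list_of_set_cong)
    then show ?thesis unfolding config_at_def A_def by simp
  qed
  have config_infinite: "config_at N \<nu> Y w t = Y" if "infinite (A w)" for w
    using that unfolding config_at_def A_def by (simp add: sorted_key_list_of_set_fold)
  have at [measurable]: "(\<lambda>w. attempt_time w x) \<in> borel_measurable M" if "x \<in> I" for x
    using that comp by (auto simp: attempt_time_def I_def case_prod_beta intro!: borel_measurable_sum)
  have "countable I" by (simp add: I_def)
  then have countable_K: "countable K"
    unfolding K_def
    by (intro countable_SIGMA countable_Collect_finite_subset) (auto intro: countable_finite)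
  have key: "{w \<in> space M. A w = B \<and> R w = S} \<in> sets M" if "(B, S) \<in> K" for B S
  proof -
    have B: "finite B" "B \<subseteq> I" "S \<subseteq> B \<times> B" using that by (auto simp: K_def)
    have eqv: "A w = B \<and> R w = S \<longleftrightarrow> (\<forall>x\<in>I. attempt_time w x \<le> t \<longleftrightarrow> x \<in> B) \<and>
        (\<forall>x\<in>B. \<forall>y\<in>B. attempt_time w x \<le> attempt_time w y \<longleftrightarrow> (x, y) \<in> S)" for w
    proof -
      have "A w = B \<longleftrightarrow> (\<forall>x\<in>I. attempt_time w x \<le> t \<longleftrightarrow> x \<in> B)"
        using B(2) by (auto simp: A_def I_def)
      moreover have "R w = S \<longleftrightarrow> (\<forall>x\<in>B. \<forall>y\<in>B. attempt_time w x \<le> attempt_time w y \<longleftrightarrow> (x, y) \<in> S)" if "A w = B"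
        using B(3) that by (auto simp: R_def)
      ultimately show ?thesis by blast
    qed
    have "{w \<in> space M. (\<forall>x\<in>I. attempt_time w x \<le> t \<longleftrightarrow> x \<in> B) \<and>
        (\<forall>x\<in>B. \<forall>y\<in>B. attempt_time w x \<le> attempt_time w y \<longleftrightarrow> (x, y) \<in> S)} \<in> sets M"
    proof (intro sets.sets_Collect_conj sets.sets_Collect_countable_All')
      fix x assume "x \<in> I"
      note [measurable] = at[OF this]
      show "{w \<in> space M. (attempt_time w x \<le> t) = (x \<in> B)} \<in> sets M" by measurable
    next
      fix x y assume "x \<in> B" "y \<in> B"
      then have "x \<in> I" "y \<in> I" using B(2) by auto
      then show "{w \<in> space M. (attempt_time w x \<le> attempt_time w y) = ((x, y) \<in> S)} \<in> sets M"
        by (cases "(x, y) \<in> S") (auto simp: not_le intro!: borel_measurable_le borel_measurable_less at)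
    qed (simp_all add: B(1) \<open>countable I\<close> countable_finite)
    then show ?thesis unfolding eqv .
  qed
  have key_K: "(A w, R w) \<in> K \<longleftrightarrow> finite (A w)" for w
    by (auto simp: K_def A_def R_def I_def)
  define C where "C \<kappa> = {w \<in> space M. A w = fst \<kappa> \<and> R w = snd \<kappa>}" for \<kappa>
  define L where "L = {\<kappa> \<in> K. \<exists>w. (A w, R w) = \<kappa> \<and> P (config_at N \<nu> Y w t)}"
  have "{w \<in> space M. P (config_at N \<nu> Y w t)} =
     (\<Union>\<kappa>\<in>L. C \<kappa>) \<union>
     (if P Y then space M - (\<Union>\<kappa>\<in>K. C \<kappa>) else {})"
  proof (intro equalityI subsetI)
    fix w assume w: "w \<in> {w \<in> space M. P (config_at N \<nu> Y w t)}"
    show "w \<in> (\<Union>\<kappa>\<in>L. C \<kappa>) \<union>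
     (if P Y then space M - (\<Union>\<kappa>\<in>K. C \<kappa>) else {})"
    proof (cases "finite (A w)")
      case True
      then have "(A w, R w) \<in> L" using w key_K by (auto simp: L_def)
      moreover have "w \<in> C (A w, R w)" using w by (simp add: C_def)
      ultimately show ?thesis by blast
    next
      case False
      then have "\<kappa> \<in> K \<Longrightarrow> w \<notin> C \<kappa>" for \<kappa> using key_K by (cases \<kappa>) (auto simp: C_def)
      then show ?thesis using w config_infinite[OF False] by auto
    qed
  next
    fix w assume "w \<in> (\<Union>\<kappa>\<in>L. C \<kappa>) \<union>
     (if P Y then space M - (\<Union>\<kappa>\<in>K. C \<kappa>) else {})"
    note w = this
    show "w \<in> {w \<in> space M. P (config_at N \<nu> Y w t)}"
    proof (cases "w \<in> (\<Union>\<kappa>\<in>L. C \<kappa>)")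
      case True
      then obtain \<kappa> where 1: "\<kappa> \<in> L" "w \<in> space M" "A w = fst \<kappa>" "R w = snd \<kappa>"
        by (auto simp: C_def)
      then obtain w' where w': "A w' = fst \<kappa>" "R w' = snd \<kappa>" "P (config_at N \<nu> Y w' t)" by (auto simp: L_def)
      then have "config_at N \<nu> Y w t = config_at N \<nu> Y w' t" using 1 by (intro config_key) auto
      then show ?thesis using w' 1 by simp
    next
      case False
      with w have w2: "w \<in> (if P Y then space M - (\<Union>\<kappa>\<in>K. C \<kappa>) else {})"
        by blast
      then have "P Y" by (cases "P Y") simp_all
      with w2 have 2: "P Y" "w \<in> space M - (\<Union>\<kappa>\<in>K. C \<kappa>)"
        by simp_all
      then have "(A w, R w) \<notin> K" by (auto simp: C_def)
      then have "infinite (A w)" using key_K[of w] by simp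
      then show ?thesis using 2 config_infinite by simp
    qed
  qed
  moreover have "(\<Union>\<kappa>\<in>J. C \<kappa>) \<in> sets M" if "J \<subseteq> K" for J
    by (rule sets.countable_UN'[OF countable_subset[OF that countable_K]]) (use that key in \<open>auto simp: C_def\<close>)
  moreover have "L \<subseteq> K" by (auto simp: L_def)
  ultimately show ?thesis by auto
qed

subsection \<open>Summation over the sequences of attempts\<close>

lemma sum_list_rate: "(\<Sum>ps\<in>particle_lists N n. list_rate b \<nu> ps) = (\<Sum>q=1..N. b (\<nu> q)) ^ n"
proof (induction n)
  case 0
  have "particle_lists N 0 = {[]}" by (auto simp: particle_lists_def)
  then show ?case by (simp add: list_rate_def)
next
  case (Suc n)
  have "(\<Sum>ps\<in>particle_lists N (Suc n). list_rate b \<nu> ps) =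
      (\<Sum>ps\<in>particle_lists N n. list_rate b \<nu> ps * (\<Sum>q=1..N. b (\<nu> q)))"
    by (simp add: sum_particle_lists_Suc list_rate_def sum_distrib_left)
  then show ?case by (simp add: sum_distrib_right[symmetric] Suc mult.commute)
qed

text \<open>
The events that a given sequence of attempts occurs are disjoint and have total mass 1 by the exponential series.
Hence almost surely one of them occurs; in particular there are almost surely no ties and only finitely many
attempts up to time \<open>t\<close>.
\<close>

theorem transition_prob_sums:
  assumes r: "\<And>p. p \<in> {1..N} \<Longrightarrow> b (\<nu> p) > 0" and t: "t \<ge> 0"
  shows "(\<lambda>n. exp (- (\<Sum>q=1..N. b (\<nu> q)) * t) * t ^ n / fact n * attempt_weight N b \<nu> Y n X \<pi>) sums
    transition_prob N b Y \<nu> X \<pi> t"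
proof -
  define M where "M = waiting_times N b \<nu>"
  define B where "B = (\<Sum>q=1..N. b (\<nu> q))"
  have rem: "remaining N (\<lambda>_. 0) = {1..N} \<times> UNIV" by (auto simp: remaining_def)
  have M: "M = PiM (remaining N (\<lambda>_. 0)) (exp_times (\<lambda>p. b (\<nu> p)))"
    by (simp add: M_def waiting_times_def rem exp_times_def)
  have prob: "prob_space (exp_times (\<lambda>p. b (\<nu> p)) x)" if "x \<in> remaining N (\<lambda>_. 0)" for x
    using that r by (auto simp: exp_times_def remaining_def intro!: prob_space_exponential_density)
  interpret prob_space M unfolding M by (rule prob_space_PiM) (rule prob)
  have comp: "(\<lambda>w. w (p, n)) \<in> borel_measurable M" if "p \<in> {1..N}" for p n
  proof -
    have "(p, n) \<in> remaining N (\<lambda>_. 0)" using that by (simp add: remaining_def)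
    from measurable_component_singleton[OF this, of "exp_times (\<lambda>p. b (\<nu> p))"]
    show ?thesis unfolding M by (simp add: exp_times_def)
  qed
  define S where "S = {w \<in> space M. in_state N \<nu> (config_at N \<nu> Y w t) X \<pi>}"
  have S: "S \<in> sets M" unfolding S_def by (rule config_at_measurable) (rule comp)
  define Z where "Z = {w \<in> space M. \<forall>x\<in>{1..N} \<times> UNIV. w x \<ge> 0}"
  have Z: "Z \<in> sets M"
    unfolding Z_def
  proof (rule sets.sets_Collect_countable_All')
    fix x assume "x \<in> {1..N} \<times> (UNIV :: nat set)"
    then have "(\<lambda>w. w x) \<in> borel_measurable M" using comp by (cases x) auto
    note [measurable] = this
    show "{w \<in> space M. 0 \<le> w x} \<in> sets M" by measurable
  qed simp
  have "AE w in M. \<forall>x\<in>{1..N} \<times> UNIV. w x \<ge> 0"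
  proof (subst AE_ball_countable, simp, intro ballI)
    fix x assume x: "x \<in> {1..N} \<times> (UNIV :: nat set)"
    have "AE y in exp_times (\<lambda>p. b (\<nu> p)) x. y \<ge> 0"
    proof (cases x)
      case (Pair p n)
      have "AE y in density lborel (exponential_density (b (\<nu> p))). 0 \<le> y"
        by (subst AE_density) (auto simp: exponential_density_def split: if_splits intro!: AE_I2)
      then show ?thesis unfolding Pair exp_times_def prod.case .
    qed
    then show "AE w in M. w x \<ge> 0"
      unfolding M using x by (intro AE_PiM_component prob) (auto simp: rem)
  qed
  then have AE_Z: "AE w in M. w \<in> Z" using AE_space by eventually_elim (auto simp: Z_def)
  define E where "E ps = {w \<in> space M. attempts_are N t ps 0 (\<lambda>_. 0) (\<lambda>_. 0) w} \<inter> Z" for ps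
  have E0: "{w \<in> space M. attempts_are N t ps 0 (\<lambda>_. 0) (\<lambda>_. 0) w} \<in> sets M" if "set ps \<subseteq> {1..N}" for ps
    using attempts_are_measurable[of "\<lambda>_. 0" M "\<lambda>_ _. 0" N "\<lambda>_. 0" "\<lambda>w. w" ps t] comp that
    by (auto simp: pred_def rem)
  have E: "E ps \<in> sets M" if "set ps \<subseteq> {1..N}" for ps
    unfolding E_def using E0[OF that] Z by blast
  have prob_E: "prob (E ps) = list_rate b \<nu> ps * t ^ length ps / fact (length ps) * exp (- B * t)"
    if ps: "set ps \<subseteq> {1..N}" for ps
  proof -
    have nonneg: "list_rate b \<nu> ps \<ge> 0"
      using ps unfolding list_rate_def by (induction ps) (auto intro!: mult_nonneg_nonneg less_imp_le[OF r])
    have "prob (E ps) = prob {w \<in> space M. attempts_are N t ps 0 (\<lambda>_. 0) (\<lambda>_. 0) w}"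
      by (rule measure_eq_AE) (use AE_Z E[OF ps] E0[OF ps] in \<open>auto simp: E_def\<close>)
    also have "\<dots> = enn2real (ennreal (list_rate b \<nu> ps * t ^ length ps / fact (length ps) * exp (- B * t)))"
      unfolding measure_def M
      by (subst emeasure_attempts_are) (use r ps t in \<open>auto simp: list_rate_def B_def sum_distrib_right\<close>)
    also have "\<dots> = list_rate b \<nu> ps * t ^ length ps / fact (length ps) * exp (- B * t)"
      using nonneg t by (intro enn2real_ennreal) auto
    finally show ?thesis .
  qed
  have E_w: "config_at N \<nu> Y w t = fold (attempt N \<nu>) ps Y"
    "ps = map fst (sorted_key_list_of_set (attempt_time w) {(p, n). p \<in> {1..N} \<and> attempt_time w (p, n) \<le> t})"
    if "w \<in> E ps" "set ps \<subseteq> {1..N}" for w ps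
  proof -
    have 1: "\<And>p n. p \<in> {1..N} \<Longrightarrow> w (p, n) \<ge> 0" using that(1) unfolding E_def Z_def by auto
    have 2: "attempts_are N t ps 0 (\<lambda>_. 0) (\<lambda>_. 0) w" using that(1) unfolding E_def by auto
    show "config_at N \<nu> Y w t = fold (attempt N \<nu>) ps Y"
      "ps = map fst (sorted_key_list_of_set (attempt_time w) {(p, n). p \<in> {1..N} \<and> attempt_time w (p, n) \<le> t})"
      using config_at_attempts_are[OF 1 that(2) 2] by blast+
  qed
  have disj: "ps = qs" if "w \<in> E ps" "w \<in> E qs" "set ps \<subseteq> {1..N}" "set qs \<subseteq> {1..N}" for w ps qs
    using E_w(2)[OF that(1,3)] E_w(2)[OF that(2,4)] by simp
  have lists: "set ps \<subseteq> {1..N}" "length ps = n" if "ps \<in> particle_lists N n" for ps n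
    using that by (auto simp: particle_lists_def)
  have sums: "(\<lambda>n. \<Sum>ps\<in>particle_lists N n. if G ps then prob (E ps) else 0) sums
      prob (\<Union>n. \<Union>ps\<in>{ps\<in>particle_lists N n. G ps}. E ps)" for G
  proof -
    let ?D = "\<lambda>n. \<Union>ps\<in>{ps\<in>particle_lists N n. G ps}. E ps"
    have "prob (?D n) = (\<Sum>ps\<in>{ps\<in>particle_lists N n. G ps}. prob (E ps))" for n
    proof (rule finite_measure_finite_Union)
      show "disjoint_family_on E {ps \<in> particle_lists N n. G ps}"
        using disj lists unfolding disjoint_family_on_def by blast
    qed (use finite_particle_lists E lists in auto)
    then have "prob (?D n) = (\<Sum>ps\<in>particle_lists N n. if G ps then prob (E ps) else 0)" for n
      by (simp add: sum.inter_filter finite_particle_lists)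
    moreover have "(\<lambda>n. prob (?D n)) sums prob (\<Union>n. ?D n)"
    proof (rule finite_measure_UNION)
      show "disjoint_family ?D"
        unfolding disjoint_family_on_def
      proof (intro ballI impI equals0I)
        fix m n w assume "m \<noteq> n" "w \<in> ?D m \<inter> ?D n"
        then obtain ps qs where "ps \<in> particle_lists N m" "qs \<in> particle_lists N n" "w \<in> E ps" "w \<in> E qs" by auto
        then show False using disj lists \<open>m \<noteq> n\<close> by metis
      qed
      show "range ?D \<subseteq> sets M"
        using E lists finite_particle_lists by (auto intro!: sets.finite_UN)
    qed
    ultimately show ?thesis by simp
  qed
  have prob_E': "prob (E ps) = list_rate b \<nu> ps * (t ^ n / fact n * exp (- B * t))"
    if "ps \<in> particle_lists N n" for ps n
    using prob_E[OF lists(1)[OF that]] lists(2)[OF that] by simp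
  have D: "(\<Union>ps\<in>{ps\<in>particle_lists N n. G ps}. E ps) \<in> sets M" for G n
    by (rule sets.finite_UN) (use finite_particle_lists E lists in auto)
  have UN: "(\<Union>n. \<Union>ps\<in>{ps\<in>particle_lists N n. G ps}. E ps) \<in> sets M" for G
    by (rule sets.countable_nat_UN) (use D in blast)
  have "(\<lambda>n. \<Sum>ps\<in>particle_lists N n. prob (E ps)) = (\<lambda>n. exp (- B * t) * ((B * t) ^ n / fact n))"
  proof
    fix n
    have "(\<Sum>ps\<in>particle_lists N n. prob (E ps)) = (\<Sum>ps\<in>particle_lists N n. list_rate b \<nu> ps * (t ^ n / fact n * exp (- B * t)))"
      by (rule sum.cong[OF refl]) (rule prob_E')
    also have "\<dots> = B ^ n * (t ^ n / fact n * exp (- B * t))"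
      by (simp only: sum_distrib_right[symmetric] sum_list_rate B_def)
    also have "\<dots> = exp (- B * t) * ((B * t) ^ n / fact n)" by (simp add: power_mult_distrib)
    finally show "(\<Sum>ps\<in>particle_lists N n. prob (E ps)) = exp (- B * t) * ((B * t) ^ n / fact n)" .
  qed
  moreover have "(\<lambda>n. exp (- B * t) * ((B * t) ^ n / fact n)) sums (exp (- B * t) * exp (B * t))"
    using exp_converges[of "B * t"] by (intro sums_mult) (simp add: divide_inverse mult.commute)
  ultimately have total: "prob (\<Union>n. \<Union>ps\<in>particle_lists N n. E ps) = 1"
    using sums[of "\<lambda>_. True"] sums_unique2 by (fastforce simp: exp_add[symmetric])
  have "(\<Union>n. \<Union>ps\<in>particle_lists N n. E ps) \<in> sets M" using UN[of "\<lambda>_. True"] by simp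
  then have AE_E: "AE w in M. w \<in> (\<Union>n. \<Union>ps\<in>particle_lists N n. E ps)"
    using total by (subst prob_eq_1[symmetric]) auto
  let ?G = "\<lambda>ps. in_state N \<nu> (fold (attempt N \<nu>) ps Y) X \<pi>"
  have "prob S = prob (\<Union>n. \<Union>ps\<in>{ps\<in>particle_lists N n. ?G ps}. E ps)"
  proof (rule measure_eq_AE)
    show "AE w in M. w \<in> S \<longleftrightarrow> w \<in> (\<Union>n. \<Union>ps\<in>{ps\<in>particle_lists N n. ?G ps}. E ps)"
      using AE_E AE_space
    proof eventually_elim
      fix w assume w: "w \<in> (\<Union>n. \<Union>ps\<in>particle_lists N n. E ps)" "w \<in> space M"
      then obtain n ps where ps: "ps \<in> particle_lists N n" "w \<in> E ps" by blast
      have *: "w \<in> S \<longleftrightarrow> ?G qs" if "qs \<in> particle_lists N m" "w \<in> E qs" for qs m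
        using E_w(1)[OF that(2) lists(1)[OF that(1)]] w(2) by (simp add: S_def)
      show "w \<in> S \<longleftrightarrow> w \<in> (\<Union>n. \<Union>ps\<in>{ps\<in>particle_lists N n. ?G ps}. E ps)"
        using * ps by blast
    qed
    show "(\<Union>n. \<Union>ps\<in>{ps\<in>particle_lists N n. ?G ps}. E ps) \<in> sets M" by (rule UN)
  qed (rule S)
  moreover have "(\<Sum>ps\<in>particle_lists N n. if ?G ps then prob (E ps) else 0) =
      exp (- B * t) * t ^ n / fact n * attempt_weight N b \<nu> Y n X \<pi>" for n
    unfolding attempt_weight_def sum_distrib_left
    by (rule sum.cong) (auto simp: prob_E')
  ultimately show ?thesis
    using sums[of ?G] by (simp add: transition_prob_def M_def[symmetric] S_def[symmetric] B_def)
qed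

section \<open>The matrices act on functions of words\<close>

lemma word_range: "N \<ge> 1 \<Longrightarrow> word N n r i \<in> {1..N}"
  by (auto simp: word_def Suc_le_eq)

lemma word_prefix:
  assumes "i \<le> m"
  shows "word N (m + n) r i = word N m (r div N ^ n) i"
proof -
  have "m + n - i = n + (m - i)" using assms by simp
  then show ?thesis by (simp add: word_def power_add div_mult2_eq)
qed

lemma div_mod_digits:
  assumes "(N :: nat) > 0" "i \<ge> 1" "i \<le> n"
  shows "r mod N ^ n div N ^ (n - i) mod N = r div N ^ (n - i) mod N"
proof -
  have n: "N ^ n = N ^ (n - i) * N ^ i" using assms(3) by (simp flip: power_add)
  have "r mod N ^ n div N ^ (n - i) = r div N ^ (n - i) mod N ^ i"
    unfolding n by (subst mod_mult2_eq) (use assms(1) in simp)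
  moreover have "N dvd N ^ i" using assms(2) by (simp add: dvd_power)
  ultimately show ?thesis by (simp add: mod_mod_cancel)
qed

lemma word_suffix:
  assumes "N > 0" "1 \<le> i" "i \<le> n"
  shows "word N (m + n) r (m + i) = word N n (r mod N ^ n) i"
  using div_mod_digits[OF assms] by (simp add: word_def)

lemma word_inject:
  assumes "r < N ^ n" "s < N ^ n" "\<And>i. i \<in> {1..n} \<Longrightarrow> word N n r i = word N n s i"
  shows "r = s"
  using assms
proof (induction n arbitrary: r s)
  case (Suc n)
  then have N: "N > 0" by (cases N) auto
  have "r div N = s div N"
  proof (rule Suc.IH)
    fix i assume i: "i \<in> {1..n}"
    then have "word N (n + 1) r i = word N n (r div N ^ 1) i" "word N (n + 1) s i = word N n (s div N ^ 1) i"
      by (intro word_prefix; simp)+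
    then show "word N n (r div N) i = word N n (s div N) i" using Suc.prems(3)[of i] i by simp
  qed (use Suc.prems N in \<open>auto simp: less_mult_imp_div_less mult.commute\<close>)
  moreover have "r mod N = s mod N" using Suc.prems(3)[of "Suc n"] by (simp add: word_def)
  ultimately show ?case by (metis div_mult_mod_eq)
qed simp

lemma word_surj:
  assumes "\<And>i. i \<in> {1..n} \<Longrightarrow> w i \<in> {1..N}"
  shows "\<exists>r < N ^ n. \<forall>i\<in>{1..n}. word N n r i = w i"
  using assms
proof (induction n)
  case (Suc n)
  then obtain r where r: "r < N ^ n" "\<forall>i\<in>{1..n}. word N n r i = w i" by auto
  have w: "1 \<le> w (Suc n)" "w (Suc n) \<le> N" using Suc.prems[of "Suc n"] by auto
  then obtain d where d: "w (Suc n) = Suc d" "d < N" by (cases "w (Suc n)") auto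
  define s where "s = r * N + d"
  have s: "s div N = r" "s mod N = d" using d by (auto simp: s_def)
  have "s < (r + 1) * N" using d by (simp add: s_def)
  also have "\<dots> \<le> N ^ n * N" using r(1) by (intro mult_right_mono) auto
  finally have "s < N ^ Suc n" by (simp add: mult.commute)
  moreover have "word N (Suc n) s i = w i" if "i \<in> {1..Suc n}" for i
  proof (cases "i = Suc n")
    case True
    then show ?thesis using s(2) d by (simp add: word_def)
  next
    case False
    then have i: "i \<in> {1..n}" using that by auto
    then have "word N (n + 1) s i = word N n (s div N ^ 1) i" by (intro word_prefix) simp
    then show ?thesis using r(2) i s(1) by simp
  qed
  ultimately show ?case by blast
qed simp

lemma kron_one: "1\<^sub>m m \<otimes>\<^sub>k 1\<^sub>m n = (1\<^sub>m (m * n) :: 'a::semiring_1 mat)"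
proof (rule eq_matI)
  fix r c assume "r < dim_row (1\<^sub>m (m * n) :: 'a mat)" "c < dim_col (1\<^sub>m (m * n) :: 'a mat)"
  then have rc: "r < m * n" "c < m * n" by auto
  then have n: "n > 0" by (cases n) auto
  have "r div n < m" "c div n < m" using rc by (auto simp: less_mult_imp_div_less)
  moreover have "r = c \<longleftrightarrow> r div n = c div n \<and> r mod n = c mod n" by (metis div_mult_mod_eq)
  ultimately show "(1\<^sub>m m \<otimes>\<^sub>k 1\<^sub>m n) $$ (r, c) = (1\<^sub>m (m * n) :: 'a mat) $$ (r, c)"
    using rc n by (auto simp: kron_def)
qed (auto simp: kron_def)

lemma kron_power_one: "kron_power (1\<^sub>m N) n = (1\<^sub>m (N ^ n) :: 'a::semiring_1 mat)"
  by (induction n) (simp_all add: kron_one)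

definition R_entry :: "(nat \<Rightarrow> real) \<Rightarrow> (nat \<Rightarrow> complex) \<Rightarrow> nat \<Rightarrow> nat \<Rightarrow> nat \<Rightarrow> nat \<Rightarrow> nat \<Rightarrow> nat \<Rightarrow> complex" where
  "R_entry b \<xi> \<beta> \<alpha> i j k l =
    (if (i, j) = (k, l) \<and> i \<le> j then S_coeff b \<xi> \<beta> \<alpha> i
     else if (i, j) = (k, l) \<and> i > j then - 1
     else if (i, j) = (l, k) \<and> i < j then T_coeff b \<xi> \<beta> \<alpha> i
     else 0)"

lemma T_mat_dim:
  assumes "l \<in> {1..<N}"
  shows "dim_row (T_mat N b \<xi> l \<beta> \<alpha>) = N ^ N" "dim_col (T_mat N b \<xi> l \<beta> \<alpha>) = N ^ N"
proof -
  have "N ^ (l - 1) * (N ^ 2 * N ^ (N - l - 1)) = N ^ N"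
    unfolding power_add[symmetric] using assms by (intro arg_cong[where f = "(^) N"]) auto
  then show "dim_row (T_mat N b \<xi> l \<beta> \<alpha>) = N ^ N" "dim_col (T_mat N b \<xi> l \<beta> \<alpha>) = N ^ N"
    by (simp_all add: T_mat_def kron_power_one kron_def R_mat_def)
qed

text \<open>
A word splits into the slots left of \<open>l\<close>, the slots \<open>l\<close>, \<open>l + 1\<close> and the rest; the Kronecker factors see one part each.
\<close>

lemma T_mat_entry:
  assumes l: "l \<in> {1..<N}" and rc: "r < N ^ N" "c < N ^ N"
  shows "T_mat N b \<xi> l \<beta> \<alpha> $$ (r, c) =
    (if \<forall>i\<in>{1..N} - {l, Suc l}. word N N r i = word N N c i
     then R_entry b \<xi> \<beta> \<alpha> (word N N r l) (word N N r (Suc l)) (word N N c l) (word N N c (Suc l)) else 0)"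
proof -
  define m n where "m = l - 1" and "n = N - l - 1"
  have N: "N > 0" "N = m + (2 + n)" "l = m + 1" using l by (auto simp: m_def n_def)
  have pow: "N ^ N = N ^ m * N ^ (2 + n)" using N(2) by (metis power_add)
  have pow2: "N ^ 2 * N ^ n = N ^ (2 + n)" by (rule power_add[symmetric])
  let ?p = "\<lambda>r. r div N ^ (2 + n)" and ?q = "\<lambda>r. r mod N ^ (2 + n) div N ^ n" and ?s = "\<lambda>r. r mod N ^ (2 + n) mod N ^ n"
  have bounds: "?p x < N ^ m" "?q x < N ^ 2" "?s x < N ^ n" if "x < N ^ N" for x
    using that N(1) unfolding pow pow2[symmetric] by (auto intro!: less_mult_imp_div_less)
  have p: "word N N x i = word N m (?p x) i" if "i \<le> m" for x i
    using word_prefix[OF that, of N "2 + n" x] N(2) by simp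
  have qs: "word N N x (m + i) = word N (2 + n) (x mod N ^ (2 + n)) i" if "1 \<le> i" "i \<le> 2 + n" for x i
    using word_suffix[OF N(1) that, of m x] N(2) by simp
  have q: "word N N x (m + i) = word N 2 (?q x) i" if "1 \<le> i" "i \<le> 2" for x i
    using qs[of i x] that word_prefix[of i 2 N n "x mod N ^ (2 + n)"] by simp
  have s: "word N N x (m + 2 + i) = word N n (?s x) i" if "1 \<le> i" "i \<le> n" for x i
    using qs[of "2 + i" x] that word_suffix[OF N(1) that, of 2 "x mod N ^ (2 + n)"] by (simp add: add.assoc)
  have off: "(\<forall>i\<in>{1..N} - {l, Suc l}. word N N r i = word N N c i) \<longleftrightarrow> ?p r = ?p c \<and> ?s r = ?s c"
  proof
    assume a: "\<forall>i\<in>{1..N} - {l, Suc l}. word N N r i = word N N c i"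
    have "?p r = ?p c"
    proof (rule word_inject[OF bounds(1)[OF rc(1)] bounds(1)[OF rc(2)]])
      fix i assume i: "i \<in> {1..m}"
      then have "i \<in> {1..N} - {l, Suc l}" using N(2,3) by auto
      then have "word N N r i = word N N c i" using a by blast
      moreover have "i \<le> m" using i by simp
      ultimately show "word N m (?p r) i = word N m (?p c) i" by (simp only: p)
    qed
    moreover have "?s r = ?s c"
    proof (rule word_inject[OF bounds(3)[OF rc(1)] bounds(3)[OF rc(2)]])
      fix i assume i: "i \<in> {1..n}"
      then have "m + 2 + i \<in> {1..N} - {l, Suc l}" using N(2,3) by auto
      then have "word N N r (m + 2 + i) = word N N c (m + 2 + i)" using a by blast
      then show "word N n (?s r) i = word N n (?s c) i" using s[of i] i by auto
    qed
    ultimately show "?p r = ?p c \<and> ?s r = ?s c" by simp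
  next
    assume a: "?p r = ?p c \<and> ?s r = ?s c"
    show "\<forall>i\<in>{1..N} - {l, Suc l}. word N N r i = word N N c i"
    proof
      fix i assume i: "i \<in> {1..N} - {l, Suc l}"
      then consider "i \<le> m" | "m + 2 < i" "i \<le> N" using N(3) by fastforce
      then show "word N N r i = word N N c i"
      proof cases
        case 1
        then show ?thesis using p a by simp
      next
        case 2
        then have "m + 2 + (i - (m + 2)) = i" "1 \<le> i - (m + 2)" "i - (m + 2) \<le> n" using N(2) by auto
        then show ?thesis using s[of "i - (m + 2)"] a by metis
      qed
    qed
  qed
  have R: "R_mat N b \<xi> \<beta> \<alpha> $$ (?q r, ?q c) =
      R_entry b \<xi> \<beta> \<alpha> (word N N r l) (word N N r (Suc l)) (word N N c l) (word N N c (Suc l))"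
    using bounds(2)[OF rc(1)] bounds(2)[OF rc(2)] q[of 1] q[of 2] N(3)
    by (simp add: R_mat_def R_entry_def Let_def)
  have "T_mat N b \<xi> l \<beta> \<alpha> $$ (r, c) =
      (if ?p r = ?p c then 1 else 0) * (R_mat N b \<xi> \<beta> \<alpha> $$ (?q r, ?q c) * (if ?s r = ?s c then 1 else 0))"
  proof -
    have dims: "dim_row (R_mat N b \<xi> \<beta> \<alpha>) = N ^ 2" "dim_col (R_mat N b \<xi> \<beta> \<alpha>) = N ^ 2" by (simp_all add: R_mat_def)
    have inner: "(R_mat N b \<xi> \<beta> \<alpha> \<otimes>\<^sub>k 1\<^sub>m (N ^ n)) $$ (r mod N ^ (2 + n), c mod N ^ (2 + n)) =
        R_mat N b \<xi> \<beta> \<alpha> $$ (?q r, ?q c) * (if ?s r = ?s c then 1 else 0)"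
      unfolding kron_def using N(1) bounds(3)[OF rc(1)] bounds(3)[OF rc(2)]
      by (subst index_mat) (simp_all add: dims pow2)
    have T: "T_mat N b \<xi> l \<beta> \<alpha> = 1\<^sub>m (N ^ m) \<otimes>\<^sub>k (R_mat N b \<xi> \<beta> \<alpha> \<otimes>\<^sub>k 1\<^sub>m (N ^ n))"
      by (simp add: T_mat_def kron_power_one m_def n_def)
    have d2: "dim_row (R_mat N b \<xi> \<beta> \<alpha> \<otimes>\<^sub>k 1\<^sub>m (N ^ n)) = N ^ (2 + n)"
      "dim_col (R_mat N b \<xi> \<beta> \<alpha> \<otimes>\<^sub>k 1\<^sub>m (N ^ n)) = N ^ (2 + n)"
      by (simp_all add: kron_def dims pow2)
    have outer: "(1\<^sub>m (N ^ m) \<otimes>\<^sub>k B) $$ (r, c) = (if ?p r = ?p c then 1 else 0) * B $$ (r mod N ^ (2 + n), c mod N ^ (2 + n))"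
      if "dim_row B = N ^ (2 + n)" "dim_col B = N ^ (2 + n)" for B :: "complex mat"
      unfolding kron_def using rc bounds(1)[OF rc(1)] bounds(1)[OF rc(2)] that
      by (subst index_mat) (simp_all add: pow)
    show ?thesis unfolding T outer[OF d2] inner by (rule refl)
  qed
  then show ?thesis
    unfolding off R[symmetric]
    by (cases "?p r = ?p c"; cases "?s r = ?s c")
       (simp_all only: simp_thms if_True if_False mult_1 mult_1_right mult_zero_left mult_zero_right)
qed

text \<open>
Row numbers correspond to words on \<open>{1..N}\<close> only, whereas words are functions on all of \<open>nat\<close>; interchanging slots
of \<open>word N N r\<close> gives a function that agrees with some \<open>word N N r'\<close> merely on \<open>{1..N}\<close>.
\<close>

definition depends_on_slots :: "nat \<Rightarrow> ((nat \<Rightarrow> nat) \<Rightarrow> 'a) \<Rightarrow> bool" where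
  "depends_on_slots N f \<longleftrightarrow> (\<forall>\<pi> \<pi>'. same_word N \<pi> \<pi>' \<longrightarrow> f \<pi> = f \<pi>')"

lemma depends_on_slots_R_op:
  assumes "depends_on_slots N f" "l \<in> {1..<N}"
  shows "depends_on_slots N (R_op b \<xi> l \<beta> \<alpha> f)"
  unfolding depends_on_slots_def
proof (intro allI impI)
  fix \<pi> \<pi>' assume a: "same_word N \<pi> \<pi>'"
  then have "\<pi> l = \<pi>' l" "\<pi> (Suc l) = \<pi>' (Suc l)" using assms(2) by (auto simp: same_word_def)
  moreover from this have "same_word N (swap_slots l \<pi>) (swap_slots l \<pi>')"
    using a by (auto simp: same_word_def swap_slots_def Transposition.transpose_def)
  moreover from this have "f \<pi> = f \<pi>'" "f (swap_slots l \<pi>) = f (swap_slots l \<pi>')"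
    using assms(1) a unfolding depends_on_slots_def by blast+
  ultimately show "R_op b \<xi> l \<beta> \<alpha> f \<pi> = R_op b \<xi> l \<beta> \<alpha> f \<pi>'"
    by (simp add: R_op_def)
qed

lemma T_mat_apply:
  assumes l: "l \<in> {1..<N}" and r: "r < N ^ N" and f: "depends_on_slots N f"
  shows "(\<Sum>c<N ^ N. T_mat N b \<xi> l \<beta> \<alpha> $$ (r, c) * f (word N N c)) = R_op b \<xi> l \<beta> \<alpha> f (word N N r)"
proof -
  define \<pi> where "\<pi> = word N N r"
  have sl: "swap_slots l \<pi> l = \<pi> (Suc l)" "swap_slots l \<pi> (Suc l) = \<pi> l"
    "\<And>i. i \<noteq> l \<Longrightarrow> i \<noteq> Suc l \<Longrightarrow> swap_slots l \<pi> i = \<pi> i"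
    by (auto simp: swap_slots_def Transposition.transpose_def)
  have "swap_slots l \<pi> i \<in> {1..N}" for i
    unfolding swap_slots_def \<pi>_def using word_range[of N] l by simp
  then obtain r' where r': "r' < N ^ N" "\<And>i. i \<in> {1..N} \<Longrightarrow> word N N r' i = swap_slots l \<pi> i"
    using word_surj[of N "swap_slots l \<pi>" N] by blast
  have lN: "l \<in> {1..N}" "Suc l \<in> {1..N}" using l by auto
  have f': "f (word N N r') = f (swap_slots l \<pi>)"
    using f r'(2) unfolding depends_on_slots_def same_word_def by blast
  have same: "c = r \<longleftrightarrow> (\<forall>i\<in>{1..N} - {l, Suc l}. \<pi> i = word N N c i) \<and> word N N c l = \<pi> l \<and> word N N c (Suc l) = \<pi> (Suc l)"
    if "c < N ^ N" for c
  proof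
    assume a: "(\<forall>i\<in>{1..N} - {l, Suc l}. \<pi> i = word N N c i) \<and> word N N c l = \<pi> l \<and> word N N c (Suc l) = \<pi> (Suc l)"
    show "c = r"
    proof (rule word_inject[OF that r])
      fix i assume "i \<in> {1..N}"
      then show "word N N c i = word N N r i" using a unfolding \<pi>_def by (cases "i = l \<or> i = Suc l") auto
    qed
  qed (auto simp: \<pi>_def)
  have swapped: "c = r' \<longleftrightarrow> (\<forall>i\<in>{1..N} - {l, Suc l}. \<pi> i = word N N c i) \<and> word N N c l = \<pi> (Suc l) \<and> word N N c (Suc l) = \<pi> l"
    if "c < N ^ N" for c
  proof
    assume a: "(\<forall>i\<in>{1..N} - {l, Suc l}. \<pi> i = word N N c i) \<and> word N N c l = \<pi> (Suc l) \<and> word N N c (Suc l) = \<pi> l"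
    show "c = r'"
    proof (rule word_inject[OF that r'(1)])
      fix i assume i: "i \<in> {1..N}"
      consider "i = l" | "i = Suc l" | "i \<noteq> l" "i \<noteq> Suc l" by blast
      then have "word N N c i = swap_slots l \<pi> i"
      proof cases
        case 3
        then have "\<pi> i = word N N c i" using a i by blast
        then show ?thesis using sl(3)[OF 3] by simp
      qed (simp_all only: a sl)
      then show "word N N c i = word N N r' i" by (simp only: r'(2)[OF i])
    qed
  qed (use r'(2) lN sl in auto)
  define D where "D = (if \<pi> l \<le> \<pi> (Suc l) then S_coeff b \<xi> \<beta> \<alpha> (\<pi> l) else - 1)"
  define E where "E = (if \<pi> l < \<pi> (Suc l) then T_coeff b \<xi> \<beta> \<alpha> (\<pi> l) else 0)"
  have R: "R_entry b \<xi> \<beta> \<alpha> (\<pi> l) (\<pi> (Suc l)) k k' =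
      (if k = \<pi> l \<and> k' = \<pi> (Suc l) then D else 0) + (if k = \<pi> (Suc l) \<and> k' = \<pi> l then E else 0)" for k k'
    by (cases "\<pi> l" "\<pi> (Suc l)" rule: linorder_cases) (auto simp: R_entry_def D_def E_def)
  have entry: "T_mat N b \<xi> l \<beta> \<alpha> $$ (r, c) = (if c = r then D else 0) + (if c = r' then E else 0)" if c: "c < N ^ N" for c
  proof -
    define P where "P \<longleftrightarrow> (\<forall>i\<in>{1..N} - {l, Suc l}. \<pi> i = word N N c i)"
    show ?thesis
      unfolding T_mat_entry[OF l r c] same[OF c] swapped[OF c] \<pi>_def[symmetric] R P_def[symmetric]
      by (cases P) simp_all
  qed
  have "(\<Sum>c<N ^ N. T_mat N b \<xi> l \<beta> \<alpha> $$ (r, c) * f (word N N c)) =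
      (\<Sum>c<N ^ N. (if c = r then D * f (word N N r) else 0) + (if c = r' then E * f (word N N r') else 0))"
    by (intro sum.cong refl) (simp add: entry distrib_right)
  also have "\<dots> = D * f \<pi> + E * f (swap_slots l \<pi>)"
    using r r'(1) by (simp add: sum.distrib f' \<pi>_def)
  also have "\<dots> = R_op b \<xi> l \<beta> \<alpha> f \<pi>"
    by (auto simp: D_def E_def R_op_def)
  finally show ?thesis by (simp add: \<pi>_def)
qed

lemma mult_mat_entry:
  assumes "A \<in> carrier_mat d d" "B \<in> carrier_mat d d" "r < d" "c < d"
  shows "(A * B) $$ (r, c) = (\<Sum>k<d. A $$ (r, k) * B $$ (k, c))"
  using assms by (auto simp: scalar_prod_def atLeast0LessThan)

lemma T_product_carrier: "set ls \<subseteq> {1..<N} \<Longrightarrow> T_product N b \<xi> \<sigma> ls \<in> carrier_mat (N ^ N) (N ^ N)"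
proof (induction ls arbitrary: \<sigma>)
  case (Cons l ls)
  have l: "l \<in> {1..<N}" and ls: "set ls \<subseteq> {1..<N}" using Cons.prems by auto
  show ?case
    unfolding T_product.simps by (rule mult_carrier_mat[OF Cons.IH[OF ls] carrier_matI[OF T_mat_dim[OF l]]])
qed simp

lemma T_product_apply:
  assumes "set ls \<subseteq> {1..<N}" "r < N ^ N" "depends_on_slots N f"
  shows "(\<Sum>c<N ^ N. T_product N b \<xi> \<sigma> ls $$ (r, c) * f (word N N c)) = snd (fold (scatter b \<xi>) ls (\<sigma>, f)) (word N N r)"
  using assms
proof (induction ls arbitrary: \<sigma> f)
  case Nil
  have "(\<Sum>c<N ^ N. 1\<^sub>m (N ^ N) $$ (r, c) * f (word N N c)) = (\<Sum>c<N ^ N. if c = r then f (word N N r) else 0)"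
    using Nil.prems(2) by (intro sum.cong) auto
  then show ?case using Nil.prems(2) by simp
next
  case (Cons l ls)
  have l: "l \<in> {1..<N}" using Cons.prems(1) by simp
  let ?P = "T_product N b \<xi> (swap_slots l \<sigma>) ls" and ?T = "T_mat N b \<xi> l (\<sigma> (l + 1)) (\<sigma> l)"
  have P: "?P \<in> carrier_mat (N ^ N) (N ^ N)" using Cons.prems(1) by (intro T_product_carrier) simp
  have T: "?T \<in> carrier_mat (N ^ N) (N ^ N)" by (rule carrier_matI[OF T_mat_dim[OF l]])
  have "(\<Sum>c<N ^ N. (?P * ?T) $$ (r, c) * f (word N N c)) =
      (\<Sum>c<N ^ N. \<Sum>k<N ^ N. ?P $$ (r, k) * (?T $$ (k, c) * f (word N N c)))"
    by (intro sum.cong refl)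
       (simp only: mult_mat_entry[OF P T Cons.prems(2)] lessThan_iff sum_distrib_right mult.assoc)
  also have "\<dots> = (\<Sum>k<N ^ N. ?P $$ (r, k) * (\<Sum>c<N ^ N. ?T $$ (k, c) * f (word N N c)))"
    by (subst sum.swap) (simp add: sum_distrib_left)
  also have "\<dots> = (\<Sum>k<N ^ N. ?P $$ (r, k) * R_op b \<xi> l (\<sigma> (Suc l)) (\<sigma> l) f (word N N k))"
    by (intro sum.cong refl) (simp add: T_mat_apply[OF l _ Cons.prems(3)])
  also have "\<dots> = snd (fold (scatter b \<xi>) ls (swap_slots l \<sigma>, R_op b \<xi> l (\<sigma> (Suc l)) (\<sigma> l) f)) (word N N r)"
    by (rule Cons.IH) (use Cons.prems depends_on_slots_R_op[OF _ l] in auto)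
  finally show ?case by (simp add: scatter_Pair)
qed

lemma A_mat_entry:
  assumes "\<sigma> permutes {1..N}" "r < N ^ N" "c < N ^ N"
  shows "A_mat N b \<xi> \<sigma> $$ (r, c) = amplitude N b (word N N c) \<sigma> \<xi> (word N N r)"
    and "A_mat N b \<xi> \<sigma> \<in> carrier_mat (N ^ N) (N ^ N)"
proof -
  have "expresses N (SOME ls. expresses N ls \<sigma>) \<sigma>"
    using permutes_expressible[OF assms(1)] by (rule someI_ex)
  then have ls: "set (SOME ls. expresses N ls \<sigma>) \<subseteq> {1..<N}" by (simp add: expresses_def)
  then show "A_mat N b \<xi> \<sigma> \<in> carrier_mat (N ^ N) (N ^ N)"
    unfolding A_mat_def by (rule T_product_carrier)
  have \<delta>: "depends_on_slots N (\<lambda>\<pi>. if same_word N \<pi> (word N N c) then 1 else (0::complex))"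
    by (auto simp: depends_on_slots_def same_word_def)
  have "same_word N (word N N k) (word N N c) \<longleftrightarrow> k = c" if "k < N ^ N" for k
    using word_inject[OF that assms(3)] by (auto simp: same_word_def)
  then have "(\<Sum>k<N ^ N. A_mat N b \<xi> \<sigma> $$ (r, k) * (if same_word N (word N N k) (word N N c) then 1 else 0)) =
      (\<Sum>k<N ^ N. if k = c then A_mat N b \<xi> \<sigma> $$ (r, c) else 0)"
    by (intro sum.cong) auto
  also have "\<dots> = A_mat N b \<xi> \<sigma> $$ (r, c)" using assms(3) by simp
  finally show "A_mat N b \<xi> \<sigma> $$ (r, c) = amplitude N b (word N N c) \<sigma> \<xi> (word N N r)"
    using T_product_apply[OF ls assms(2) \<delta>, of b \<xi> id] by (simp add: amplitude_def A_mat_def)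
qed

lemma T_product_cong:
  assumes "N \<ge> 1" "\<And>i. i \<in> {1..N} \<Longrightarrow> b i = b' i"
  shows "T_product N b \<xi> \<sigma> ls = T_product N b' \<xi> \<sigma> ls"
proof -
  have "R_mat N b \<xi> \<beta> \<alpha> = R_mat N b' \<xi> \<beta> \<alpha>" for \<beta> \<alpha>
    unfolding R_mat_def
    by (rule cong_mat) (simp_all add: S_coeff_def T_coeff_def Let_def assms(2)[OF word_range[OF assms(1)]])
  then show ?thesis by (induction ls arbitrary: \<sigma>) (simp_all add: T_mat_def)
qed

lemma eq_mat_entriesI:
  assumes "M \<in> carrier_mat m n" "\<And>r c. r < m \<Longrightarrow> c < n \<Longrightarrow> M $$ (r, c) = f r c"
  shows "M = mat m n (\<lambda>(r, c). f r c)"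
  using assms by (intro eq_matI) auto

lemma diagonal_carrier: "diagonal d f \<in> carrier_mat d d"
  by (simp add: diagonal_def)

lemma diagonal_mult_entry:
  fixes A :: "'a::semiring_0 mat"
  assumes "A \<in> carrier_mat d d" "r < d" "c < d"
  shows "(diagonal d f * A) $$ (r, c) = f r * A $$ (r, c)" "(A * diagonal d f) $$ (r, c) = A $$ (r, c) * f c"
proof -
  have D: "diagonal d f \<in> carrier_mat d d" by (rule diagonal_carrier)
  have "(diagonal d f * A) $$ (r, c) = (\<Sum>k<d. if k = r then f r * A $$ (r, c) else 0)"
    unfolding mult_mat_entry[OF D assms] using assms by (intro sum.cong) (auto simp: diagonal_def)
  then show "(diagonal d f * A) $$ (r, c) = f r * A $$ (r, c)" using assms by simp
  have "(A * diagonal d f) $$ (r, c) = (\<Sum>k<d. if k = c then A $$ (r, c) * f c else 0)"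
    unfolding mult_mat_entry[OF assms(1) D assms(2,3)] using assms by (intro sum.cong) (auto simp: diagonal_def)
  then show "(A * diagonal d f) $$ (r, c) = A $$ (r, c) * f c" using assms by simp
qed

lemma matrix_integrand_entry:
  assumes "\<sigma> permutes {1..N}" "r < N ^ N" "c < N ^ N"
  shows "(J_mat N b \<xi> t * D_mat N b X * A_mat N b \<xi> \<sigma> * D'_mat N b Y) $$ (r, c) =
    exp (((\<Sum>i=1..N. 1 / \<xi> i) - complex_of_real (\<Sum>i=1..N. b (word N N r i))) * t) *
    (\<Prod>i=1..N. complex_of_real (b (word N N r i)) powi X i) *
    amplitude N b (word N N c) \<sigma> \<xi> (word N N r) *
    (\<Prod>i=1..N. complex_of_real (b (word N N c i)) powi (- Y i))"
proof -
  note A = A_mat_entry(2)[OF assms, of b \<xi>]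
  have J: "J_mat N b \<xi> t \<in> carrier_mat (N ^ N) (N ^ N)" unfolding J_mat_def by (rule diagonal_carrier)
  have D: "D_mat N b X \<in> carrier_mat (N ^ N) (N ^ N)" unfolding D_mat_def by (rule diagonal_carrier)
  have DA: "D_mat N b X * A_mat N b \<xi> \<sigma> \<in> carrier_mat (N ^ N) (N ^ N)" by (rule mult_carrier_mat[OF D A])
  have JDA: "J_mat N b \<xi> t * D_mat N b X * A_mat N b \<xi> \<sigma> = J_mat N b \<xi> t * (D_mat N b X * A_mat N b \<xi> \<sigma>)"
    by (rule assoc_mult_mat[OF J D A])
  have JDA': "J_mat N b \<xi> t * (D_mat N b X * A_mat N b \<xi> \<sigma>) \<in> carrier_mat (N ^ N) (N ^ N)"
    by (rule mult_carrier_mat[OF J DA])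
  show ?thesis
    unfolding JDA unfolding D'_mat_def diagonal_mult_entry(2)[OF JDA' assms(2,3)]
    unfolding J_mat_def diagonal_mult_entry(1)[OF DA assms(2,3)]
    unfolding D_mat_def diagonal_mult_entry(1)[OF A assms(2,3)] A_mat_entry(1)[OF assms]
    by (simp add: mult.assoc)
qed

section \<open>The transition probabilities\<close>

text \<open>
Species are conserved, so the exponential factor may be written with the final word \<open>\<pi>\<close> as well as with the initial one.
\<close>

lemma in_state_total_rate:
  fixes b :: "nat \<Rightarrow> real"
  assumes "in_state N \<nu> z X \<pi>" "inj_on X {1..N}"
  shows "(\<Sum>i=1..N. b (\<pi> i)) = (\<Sum>p=1..N. b (\<nu> p))"
proof -
  obtain f where f: "\<And>i. i \<in> {1..N} \<Longrightarrow> f i \<in> {1..N} \<and> z (f i) = X i \<and> \<nu> (f i) = \<pi> i"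
    using assms(1) unfolding in_state_def by metis
  have inj: "inj_on f {1..N}" using f assms(2) by (metis inj_onD inj_onI)
  then have "f ` {1..N} = {1..N}" using f by (intro endo_inj_surj) auto
  with inj have "bij_betw f {1..N} {1..N}" by (simp add: bij_betw_def)
  from sum.reindex_bij_betw[OF this, of "\<lambda>p. b (\<nu> p)"]
  have "(\<Sum>i=1..N. b (\<nu> (f i))) = (\<Sum>p=1..N. b (\<nu> p))" .
  moreover have "(\<Sum>i=1..N. b (\<nu> (f i))) = (\<Sum>i=1..N. b (\<pi> i))"
    by (rule sum.cong[OF refl]) (use f in metis)
  ultimately show ?thesis by simp
qed

lemma attempt_weight_total_rate:
  assumes "attempt_weight N b \<nu> Y n X \<pi> \<noteq> 0" "inj_on X {1..N}"
  shows "(\<Sum>i=1..N. b (\<pi> i)) = (\<Sum>p=1..N. b (\<nu> p))"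
proof -
  obtain ps where "list_rate b \<nu> ps * of_bool (in_state N \<nu> (fold (attempt N \<nu>) ps Y) X \<pi>) \<noteq> 0"
    using assms(1) unfolding attempt_weight_def by (meson sum.not_neutral_contains_not_neutral)
  then have "in_state N \<nu> (fold (attempt N \<nu>) ps Y) X \<pi>" by (auto split: if_splits)
  then show ?thesis by (rule in_state_total_rate) (rule assms(2))
qed

context contour begin

theorem transition_prob_eq_integrals:
  assumes Y: "strict_mono_on {1..N} Y" and X: "strict_mono_on {1..N} X" and t: "t \<ge> 0"
    and \<nu>: "\<And>i. i \<in> {1..N} \<Longrightarrow> b (\<nu> i) > 0" and \<pi>: "\<And>i. i \<in> {1..N} \<Longrightarrow> b (\<pi> i) > 0"
  shows "complex_of_real (transition_prob N b Y \<nu> X \<pi> t) =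
    (1 / (2 * of_real pi * \<i>)) ^ N * (exp (- (\<Sum>i=1..N. complex_of_real (b (\<pi> i))) * t) *
      wave_weight X \<pi> * wave_weight (\<lambda>i. - Y i) \<nu>) *
    (\<Sum>\<sigma> | \<sigma> permutes {1..N}.
      torus_integral N \<rho> (\<lambda>\<xi>. bethe_wave \<nu> Y X \<pi> \<sigma> \<xi> * exp (t * energy \<xi>)))"
    (is "_ = ?c * (?e * ?wX * ?wY) * ?I")
proof -
  have series: "complex_of_real (exp (- (\<Sum>q=1..N. b (\<nu> q)) * t) * t ^ n / fact n * attempt_weight N b \<nu> Y n X \<pi>) =
      ?c * (?e * ?wX * ?wY) * (complex_of_real t ^ n / fact n * moment \<nu> Y n X \<pi>)" for n
  proof -
    have e: "complex_of_real (exp (- (\<Sum>i=1..N. b (\<pi> i)) * t)) = ?e"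
      by (simp add: exp_of_real[symmetric])
    have "exp (- (\<Sum>q=1..N. b (\<nu> q)) * t) * attempt_weight N b \<nu> Y n X \<pi> =
        exp (- (\<Sum>i=1..N. b (\<pi> i)) * t) * attempt_weight N b \<nu> Y n X \<pi>"
      using attempt_weight_total_rate[OF _ strict_mono_on_imp_inj_on[OF X], of b \<nu> Y n \<pi>]
      by (cases "attempt_weight N b \<nu> Y n X \<pi> = 0") auto
    then have "exp (- (\<Sum>q=1..N. b (\<nu> q)) * t) * t ^ n / fact n * attempt_weight N b \<nu> Y n X \<pi> =
        exp (- (\<Sum>i=1..N. b (\<pi> i)) * t) * (t ^ n / fact n) * attempt_weight N b \<nu> Y n X \<pi>"
      by (simp add: mult_ac)
    then have "complex_of_real (exp (- (\<Sum>q=1..N. b (\<nu> q)) * t) * t ^ n / fact n * attempt_weight N b \<nu> Y n X \<pi>) =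
        ?e * (complex_of_real t ^ n / fact n) * complex_of_real (attempt_weight N b \<nu> Y n X \<pi>)"
      unfolding e[symmetric] by (simp only: of_real_mult of_real_divide of_real_power of_real_fact)
    also have "\<dots> = ?e * (complex_of_real t ^ n / fact n) * bethe \<nu> Y n X \<pi>"
      by (simp only: bethe_eq_attempt_weight[OF Y \<nu> X \<pi>])
    also have "\<dots> = ?c * (?e * ?wX * ?wY) * (complex_of_real t ^ n / fact n * moment \<nu> Y n X \<pi>)"
      by (simp add: bethe_def mult_ac)
    finally show ?thesis .
  qed
  have "(\<lambda>n. complex_of_real (exp (- (\<Sum>q=1..N. b (\<nu> q)) * t) * t ^ n / fact n * attempt_weight N b \<nu> Y n X \<pi>)) sums
      complex_of_real (transition_prob N b Y \<nu> X \<pi> t)"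
    by (rule sums_of_real) (rule transition_prob_sums[where b = b and \<nu> = \<nu>, OF \<nu> t])
  moreover have "(\<lambda>n. ?c * (?e * ?wX * ?wY) * (complex_of_real t ^ n / fact n * moment \<nu> Y n X \<pi>)) sums
      (?c * (?e * ?wX * ?wY) * ?I)"
    by (rule sums_mult) (rule moment_exp_sums)
  ultimately show ?thesis unfolding series by (rule sums_unique2)
qed

end

theorem theorem1p2:
  fixes N :: nat and b :: "nat \<Rightarrow> real" and \<rho> :: real
    and X Y :: "nat \<Rightarrow> int" and t :: real
  assumes "N \<ge> 1"
    and "\<And>l. l \<in> {1..N} \<Longrightarrow> b l > 0"
    and "\<rho> > 0" and "\<And>l. l \<in> {1..N} \<Longrightarrow> \<rho> < 1 / b l"
    and "strict_mono_on {1..N} X" and "strict_mono_on {1..N} Y"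
    and "t \<ge> 0"
  shows "P_mat N b Y X t =
    mat (N ^ N) (N ^ N) (\<lambda>(r, c).
      \<Sum>\<sigma> | \<sigma> permutes {1..N}.
        (1 / (2 * pi * \<i>)) ^ N *
        iterated_contour_integral N (circlepath 0 \<rho>) (\<lambda>\<xi>.
          ((\<Prod>i=1..N. \<xi> (\<sigma> i) powi (X i - Y (\<sigma> i) - 1)) \<cdot>\<^sub>m
             (J_mat N b \<xi> t * D_mat N b X * A_mat N b \<xi> \<sigma> * D'_mat N b Y)) $$ (r, c)))"
proof -
  \<comment> \<open>Rates of species outside \<open>{1..N}\<close> do not occur; making them 0 excludes spurious poles.\<close>
  define b' where "b' l = (if l \<in> {1..N} then b l else 0)" for l
  have b': "b (word N N k i) = b' (word N N k i)" "b' (word N N k i) > 0" for k i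
    using word_range[OF assms(1), of N k i] assms(2) by (auto simp: b'_def)
  interpret contour N b' \<rho>
  proof
    fix l
    show "\<bar>b' l\<bar> * \<rho> < 1"
      using assms(2)[of l] assms(4)[of l] by (auto simp: b'_def field_simps)
  qed (rule assms(3))
  have A: "A_mat N b \<xi> \<sigma> = A_mat N b' \<xi> \<sigma>" for \<xi> \<sigma>
    unfolding A_mat_def by (rule T_product_cong[OF assms(1)]) (simp add: b'_def)
  have mats: "J_mat N b \<xi> t = J_mat N b' \<xi> t" "D_mat N b X = D_mat N b' X" "D'_mat N b Y = D'_mat N b' Y" for \<xi>
    by (simp_all add: J_mat_def D_mat_def D'_mat_def b'(1))
  show ?thesis
  proof (rule eq_mat_entriesI)
    fix r c
    assume rc: "r < N ^ N" "c < N ^ N"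
    define \<pi> \<nu> where "\<pi> = word N N r" and "\<nu> = word N N c"
    define K where "K = exp (- (\<Sum>i=1..N. complex_of_real (b' (\<pi> i))) * t) * wave_weight X \<pi> * wave_weight (\<lambda>i. - Y i) \<nu>"
    have integrand: "((\<Prod>i=1..N. \<xi> (\<sigma> i) powi (X i - Y (\<sigma> i) - 1)) \<cdot>\<^sub>m
             (J_mat N b \<xi> t * D_mat N b X * A_mat N b \<xi> \<sigma> * D'_mat N b Y)) $$ (r, c) =
        K * (bethe_wave \<nu> Y X \<pi> \<sigma> \<xi> * exp (t * energy \<xi>))"
      if p: "\<sigma> permutes {1..N}" for \<sigma> \<xi>
    proof -
      let ?M = "J_mat N b \<xi> t * D_mat N b X * A_mat N b \<xi> \<sigma> * D'_mat N b Y"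
      have dims: "dim_row ?M = N ^ N" "dim_col ?M = N ^ N"
        by (simp_all add: J_mat_def D'_mat_def diagonal_def)
      have "(plane_wave Y X \<sigma> \<xi> \<cdot>\<^sub>m ?M) $$ (r, c) = plane_wave Y X \<sigma> \<xi> * ?M $$ (r, c)"
        using rc dims by (intro index_smult_mat) simp_all
      also have "?M $$ (r, c) = exp (((\<Sum>i=1..N. 1 / \<xi> i) - complex_of_real (\<Sum>i=1..N. b' (\<pi> i))) * t) *
          wave_weight X \<pi> * amplitude N b' \<nu> \<sigma> \<xi> \<pi> * wave_weight (\<lambda>i. - Y i) \<nu>"
        unfolding A mats matrix_integrand_entry[OF p rc] wave_weight_def \<pi>_def \<nu>_def by (rule refl)
      also have "exp (((\<Sum>i=1..N. 1 / \<xi> i) - complex_of_real (\<Sum>i=1..N. b' (\<pi> i))) * t) =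
          exp (t * energy \<xi>) * exp (- (\<Sum>i=1..N. complex_of_real (b' (\<pi> i))) * t)"
        by (simp add: energy_def exp_add[symmetric] algebra_simps)
      finally show ?thesis unfolding plane_wave_def[symmetric] by (simp add: K_def mult_ac)
    qed
    have "transition_prob N b Y \<nu> X \<pi> t = transition_prob N b' Y \<nu> X \<pi> t"
      by (simp add: transition_prob_def waiting_times_def \<nu>_def b'(1))
    then have "P_mat N b Y X t $$ (r, c) = complex_of_real (transition_prob N b' Y \<nu> X \<pi> t)"
      using rc by (simp add: P_mat_def \<pi>_def \<nu>_def)
    also have "\<dots> = (1 / (2 * of_real pi * \<i>)) ^ N * K * (\<Sum>\<sigma> | \<sigma> permutes {1..N}.
      torus_integral N \<rho> (\<lambda>\<xi>. bethe_wave \<nu> Y X \<pi> \<sigma> \<xi> * exp (t * energy \<xi>)))"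
      unfolding K_def by (rule transition_prob_eq_integrals[OF assms(6,5,7)]) (simp_all add: \<pi>_def \<nu>_def b'(2))
    also have "\<dots> = (\<Sum>\<sigma> | \<sigma> permutes {1..N}. (1 / (2 * of_real pi * \<i>)) ^ N * torus_integral N \<rho>
        (\<lambda>\<xi>. K * (bethe_wave \<nu> Y X \<pi> \<sigma> \<xi> * exp (t * energy \<xi>))))"
      unfolding sum_distrib_left
    proof (rule sum.cong[OF refl])
      fix \<sigma> assume "\<sigma> \<in> {\<sigma>. \<sigma> permutes {1..N}}"
      then have p: "\<sigma> permutes {1..N}" by simp
      have "torus_integral N \<rho> (\<lambda>\<xi>. K * (bethe_wave \<nu> Y X \<pi> \<sigma> \<xi> * exp (t * energy \<xi>))) =
          K * torus_integral N \<rho> (\<lambda>\<xi>. bethe_wave \<nu> Y X \<pi> \<sigma> \<xi> * exp (t * energy \<xi>))"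
        by (intro torus_integral_cmult radius continuous_mult[OF torus_continuous_wave_amplitude[OF p]]
            torus_continuous_exp_energy)
      then show "(1 / (2 * of_real pi * \<i>)) ^ N * K *
          torus_integral N \<rho> (\<lambda>\<xi>. bethe_wave \<nu> Y X \<pi> \<sigma> \<xi> * exp (t * energy \<xi>)) =
        (1 / (2 * of_real pi * \<i>)) ^ N * torus_integral N \<rho>
          (\<lambda>\<xi>. K * (bethe_wave \<nu> Y X \<pi> \<sigma> \<xi> * exp (t * energy \<xi>)))"
        by (simp only: mult.assoc)
    qed
    finally show "P_mat N b Y X t $$ (r, c) = (\<Sum>\<sigma> | \<sigma> permutes {1..N}. (1 / (2 * pi * \<i>)) ^ N *
        iterated_contour_integral N (circlepath 0 \<rho>) (\<lambda>\<xi>.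
          ((\<Prod>i=1..N. \<xi> (\<sigma> i) powi (X i - Y (\<sigma> i) - 1)) \<cdot>\<^sub>m
             (J_mat N b \<xi> t * D_mat N b X * A_mat N b \<xi> \<sigma> * D'_mat N b Y)) $$ (r, c)))"
      by (rule trans) (rule sum.cong[OF refl], simp only: mem_Collect_eq integrand of_real_mult of_real_numeral)
  qed (simp add: P_mat_def)
qed

end
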